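(* For every fixed $t\in\mathbb N$, setting $\pi_t:=\pi_0P^t$, $$4\|\pi_t-\pi_\star\|_{\mathrm{TV}}^2\le \frac{n(\gamma-1)}{m(1-\varrho)}\varrho^t+o_{\mathbf P}(1),$$ where $o_{\mathbf P}(1)$ denotes a term tending to $0$ in probability as $n\to\infty$.
   Context: Configuration model: for each $n$, let $(d_i^-)_{1\le i\le n}$ and $(d_i^+)_{1\le i\le n}$ be positive integers with $\sum_i d_i^-=\sum_i d_i^+=m$. Each vertex $i\in V=\{1,\dots,n\}$ carries a set $E_i^+$ of $d_i^+$ tails and a set $E_i^-$ of $d_i^-$ heads. The environment $\omega$ is a uniformly random bijection from $\bigcup_i E_i^+$ to $\bigcup_i E_i^-$; each pair $\omega(e)=f$ is an arc from the vertex of $e$ to the vertex of $f$ (loops, multiple arcs allowed), giving a random directed multigraph $G$. The random walk has transition matrix $P(i,j)=\frac{1}{d_i^+}|\{e\in E_i^+:\omega(e)\in E_j^-\}|$. Standing assumption: $\delta:=\min_i\min(d_i^+,d_i^-)\ge2$ and $\Delta:=\max_i\max(d_i^+,d_i^-)$ is bounded uniformly in $n$. $\pi_\star$ is the invariant probability measure of $P$ (unique with high probability). $\pi_0(i)=d_i^-/m$ is the in-degree distribution, $\varrho=\frac1m\sum_i\frac{d_i^-}{d_i^+}$ and $\gamma=\frac1m\sum_i\frac{(d_i^-)^2}{d_i^+}$. $\|\cdot\|_{\mathrm{TV}}$ is total variation distance. *)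

theory Defs
  imports "HOL-Library.FuncSet" "HOL-Probability.Probability_Mass_Function"
begin

text \<open>Directed configuration model on vertex set {0..<n} (vertex i stands for i+1).
 Tails of vertex i: pairs (i,k), k < dout i; heads of vertex j: pairs (j,l), l < din j.\<close>

definition tails :: "(nat \<Rightarrow> nat) \<Rightarrow> nat \<Rightarrow> (nat \<times> nat) set" where
  "tails dout n = Sigma {..<n} (\<lambda>i. {..<dout i})"

definition heads :: "(nat \<Rightarrow> nat) \<Rightarrow> nat \<Rightarrow> (nat \<times> nat) set" where
  "heads din n = Sigma {..<n} (\<lambda>j. {..<din j})"

text \<open>Environments: bijections from all tails onto all heads (extensional, so that
 they are in one-to-one correspondence with the bijections).\<close>
definition envs :: "(nat \<Rightarrow> nat) \<Rightarrow> (nat \<Rightarrow> nat) \<Rightarrow> nat \<Rightarrow> ((nat \<times> nat) \<Rightarrow> (nat \<times> nat)) set" where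
  "envs din dout n = {\<omega> \<in> extensional (tails dout n). bij_betw \<omega> (tails dout n) (heads din n)}"

definition env_pmf :: "(nat \<Rightarrow> nat) \<Rightarrow> (nat \<Rightarrow> nat) \<Rightarrow> nat \<Rightarrow> ((nat \<times> nat) \<Rightarrow> (nat \<times> nat)) pmf" where
  "env_pmf din dout n = pmf_of_set (envs din dout n)"

definition num_edges :: "(nat \<Rightarrow> nat) \<Rightarrow> nat \<Rightarrow> nat" where
  "num_edges d n = (\<Sum>i<n. d i)"

definition trans :: "(nat \<Rightarrow> nat) \<Rightarrow> ((nat \<times> nat) \<Rightarrow> (nat \<times> nat)) \<Rightarrow> nat \<Rightarrow> nat \<Rightarrow> real" where
  "trans dout \<omega> i j = real (card {k. k < dout i \<and> fst (\<omega> (i, k)) = j}) / real (dout i)"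

definition step :: "nat \<Rightarrow> (nat \<Rightarrow> nat) \<Rightarrow> ((nat \<times> nat) \<Rightarrow> (nat \<times> nat)) \<Rightarrow> (nat \<Rightarrow> real) \<Rightarrow> nat \<Rightarrow> real" where
  "step n dout \<omega> \<mu> j = (\<Sum>i<n. \<mu> i * trans dout \<omega> i j)"

definition pi0 :: "(nat \<Rightarrow> nat) \<Rightarrow> nat \<Rightarrow> nat \<Rightarrow> real" where
  "pi0 din n i = real (din i) / real (num_edges din n)"

definition pit :: "nat \<Rightarrow> (nat \<Rightarrow> nat) \<Rightarrow> (nat \<Rightarrow> nat) \<Rightarrow> ((nat \<times> nat) \<Rightarrow> (nat \<times> nat)) \<Rightarrow> nat \<Rightarrow> nat \<Rightarrow> real" where
  "pit n din dout \<omega> t = (step n dout \<omega> ^^ t) (pi0 din n)"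

definition invariant_prob :: "nat \<Rightarrow> (nat \<Rightarrow> nat) \<Rightarrow> ((nat \<times> nat) \<Rightarrow> (nat \<times> nat)) \<Rightarrow> (nat \<Rightarrow> real) \<Rightarrow> bool" where
  "invariant_prob n dout \<omega> \<pi> \<longleftrightarrow>
     (\<forall>i<n. \<pi> i \<ge> 0) \<and> (\<Sum>i<n. \<pi> i) = 1 \<and> (\<forall>j<n. step n dout \<omega> \<pi> j = \<pi> j)"

definition tv_dist :: "nat \<Rightarrow> (nat \<Rightarrow> real) \<Rightarrow> (nat \<Rightarrow> real) \<Rightarrow> real" where
  "tv_dist n \<mu> \<nu> = (\<Sum>i<n. \<bar>\<mu> i - \<nu> i\<bar>) / 2"

definition varrho :: "(nat \<Rightarrow> nat) \<Rightarrow> (nat \<Rightarrow> nat) \<Rightarrow> nat \<Rightarrow> real" where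
  "varrho din dout n = (\<Sum>i<n. real (din i) / real (dout i)) / real (num_edges din n)"

definition gamma_deg :: "(nat \<Rightarrow> nat) \<Rightarrow> (nat \<Rightarrow> nat) \<Rightarrow> nat \<Rightarrow> real" where
  "gamma_deg din dout n = (\<Sum>i<n. real (din i) ^ 2 / real (dout i)) / real (num_edges din n)"

end

theory Submission
  imports Defs "HOL-Combinatorics.Transposition" "HOL-Real_Asymp.Real_Asymp"
begin

text \<open>
  Reveal the arcs of the environment one at a time, as walkers need them. As long as few arcs are
  revealed, a new arc hits an already visited vertex with probability at most \<open>\<eta> = O(log n / n)\<close>. For two
  walkers leaving from distinct fresh tails of the same environment this determines the probability
  of being at the same vertex after \<open>T = O(log n)\<close> steps up to \<open>\<eta>\<^sup>2\<close> times logarithms: walkers on the same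
  fresh tail stay together with probability \<open>\<varrho>\<close> per step, walkers on distinct tails merge at rate
  \<open>(\<gamma> - \<varrho>) / m\<close>, and everything else needs two surprises. Summing over uniform starting tails gives
  \<open>E \<Sum>j. (\<pi>\<^sub>s j - \<pi>\<^sub>s' j)\<^sup>2 \<le> (\<gamma> - 1) / (m (1 - \<varrho>)) \<varrho>\<^sup>s\<close> up to the same error.

  The same estimates show that the squared Hilbert-Schmidt norm of the \<open>T\<close>-step kernel minus its
  rank one part is of order \<open>n \<eta>\<^sup>2\<close> up to logarithms when \<open>T\<close> is about \<open>2 log\<^sub>2 n\<close>, so every invariant
  \<open>\<pi>\<close>, being a fixed point of that kernel, is close to \<open>\<pi>\<^sub>T\<close>; no bound on the masses of \<open>\<pi>\<close> is needed. Finally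
  \<open>\<pi>\<^sub>T\<close> is compared with \<open>\<pi>\<^sub>h\<close> for a large fixed \<open>h\<close> by Markov's inequality, and
  \<open>n \<Sum>j. (\<pi>\<^sub>t j - \<pi>\<^sub>h j)\<^sup>2\<close> concentrates because switching two arcs changes it by \<open>O(1/n)\<close>.
\<close>

text \<open>Second-order accuracy shapes the whole proof. The kernel has \<open>m\<close> rows, so a
  meeting probability known only up to \<open>\<eta>\<close>, about \<open>log n / n\<close>, would
  leave an error that does not vanish after summation over the rows; \<open>\<eta>^2\<close> up to
  logarithms leaves room. For distinct fresh tails this precision is available because every
  first-order error sits on an event of probability \<open>O(\<eta>)\<close>. Walkers on a common
  tail lack that protection, and for them only a one-sided bound of this precision is proved
  (\<open>cmeet_diag_upper\<close>); it suffices for the spread.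

  Two estimates with opposite ranges force the intermediate time \<open>h\<close>. Concentration
  keeps the bound with coefficient one, but switching costs grow like
  \<open>\<Delta>^(2 * h)\<close>, so it is confined to fixed times. Markov's inequality reaches
  times of order \<open>log n\<close>, but is useful only for a quantity with small mean, which a
  large \<open>h\<close> provides.

  For an invariant \<open>p\<close>, the weights \<open>p v / dout v\<close> on tails have a sum of
  squares at most half that of \<open>p\<close>; this lets the estimate close on itself.\<close>

declare split_paired_All [simp del] split_paired_Ex [simp del]

section \<open>Averages over pairs and elementary inequalities\<close>

lemma abs_mean_mean_le:
  fixes g :: "nat \<Rightarrow> nat \<Rightarrow> real"
  assumes "0 < a" "0 < b" "\<And>i j. i < a \<Longrightarrow> j < b \<Longrightarrow> \<bar>g i j - c\<bar> \<le> x"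
  shows "\<bar>(\<Sum>i<a. \<Sum>j<b. g i j) / (real a * real b) - c\<bar> \<le> x"
proof -
  have "(\<Sum>i<a. \<Sum>j<b. g i j) / (real a * real b) - c = (\<Sum>i<a. \<Sum>j<b. g i j - c) / (real a * real b)"
    using assms(1,2) by (simp add: sum_subtractf field_simps)
  also have "\<bar>\<dots>\<bar> = \<bar>\<Sum>i<a. \<Sum>j<b. g i j - c\<bar> / (real a * real b)"
    by (simp add: abs_divide)
  also have "\<dots> \<le> (\<Sum>i<a. \<Sum>j<b. x) / (real a * real b)"
    using assms(3) by (intro divide_right_mono order_trans[OF sum_abs] sum_mono) auto
  also have "\<dots> = x" using assms by simp
  finally show ?thesis .
qed

lemma mean_mean_le:
  fixes g :: "nat \<Rightarrow> nat \<Rightarrow> real"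
  assumes "0 < a" "0 < b" "\<And>i j. i < a \<Longrightarrow> j < b \<Longrightarrow> g i j \<le> x"
  shows "(\<Sum>i<a. \<Sum>j<b. g i j) / (real a * real b) \<le> x"
proof -
  have "(\<Sum>i<a. \<Sum>j<b. g i j) \<le> (\<Sum>i<a. \<Sum>j<b. x)"
    using assms by (intro sum_mono) auto
  then show ?thesis using assms(1,2) by (simp add: divide_le_eq mult_ac)
qed

lemma sum_diag_offdiag:
  "(\<Sum>i<d. \<Sum>j<d. if i = j then a else b) = real d * a + real d * (real d - 1) * (b::real)"
proof -
  have "(\<Sum>i<d. \<Sum>j<d. if i = j then a else b) = (\<Sum>i<d. \<Sum>j<d. b + (if j = i then a - b else 0))"
    by (intro sum.cong) auto
  also have "\<dots> = real d * (real d * b) + real d * (a - b)"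
    by (simp add: sum.distrib algebra_simps)
  finally show ?thesis by (simp add: algebra_simps)
qed

text \<open>The diagonal has weight \<open>1 / d\<close>, at most one half; since
  \<open>b \<le> a\<close>, the case \<open>d = 2\<close> is the worst.\<close>

lemma diag_mean_le:
  fixes g :: "nat \<Rightarrow> nat \<Rightarrow> real"
  assumes "2 \<le> d" "\<And>i. i < d \<Longrightarrow> g i i \<le> a" "\<And>i j. i < d \<Longrightarrow> j < d \<Longrightarrow> i \<noteq> j \<Longrightarrow> g i j \<le> b"
    and "b \<le> a"
  shows "(\<Sum>i<d. \<Sum>j<d. g i j) / (real d * real d) \<le> (a + b) / 2"
proof -
  have "(\<Sum>i<d. \<Sum>j<d. g i j) \<le> (\<Sum>i<d. \<Sum>j<d. if i = j then a else b)"
    using assms by (intro sum_mono) auto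
  also have "\<dots> = real d * a + real d * (real d - 1) * b" by (rule sum_diag_offdiag)
  finally have "(\<Sum>i<d. \<Sum>j<d. g i j) / (real d * real d) \<le> (real d * a + real d * (real d - 1) * b) / (real d * real d)"
    by (rule divide_right_mono) simp
  also have "\<dots> = b + (a - b) / real d" using assms(1) by (simp add: field_simps)
  also have "\<dots> \<le> b + (a - b) / 2" using assms by (intro add_left_mono divide_left_mono) auto
  finally show ?thesis by (simp add: field_simps)
qed

lemma diag_mean_abs:
  fixes g :: "nat \<Rightarrow> nat \<Rightarrow> real"
  assumes "2 \<le> d" "\<And>i. i < d \<Longrightarrow> \<bar>g i i - (b + a)\<bar> \<le> x"
    "\<And>i j. i < d \<Longrightarrow> j < d \<Longrightarrow> i \<noteq> j \<Longrightarrow> \<bar>g i j - b\<bar> \<le> x"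
  shows "\<bar>(\<Sum>i<d. \<Sum>j<d. g i j) / (real d * real d) - (b + a / real d)\<bar> \<le> x"
proof -
  have "\<bar>(\<Sum>i<d. \<Sum>j<d. g i j - (if i = j then b + a else b)) / (real d * real d) - 0\<bar> \<le> x"
    by (rule abs_mean_mean_le) (use assms in auto)
  moreover have "(\<Sum>i<d. \<Sum>j<d. if i = j then b + a else b) / (real d * real d) = b + a / real d"
    unfolding sum_diag_offdiag using assms(1) by (simp add: field_simps)
  ultimately show ?thesis by (simp add: sum_subtractf diff_divide_distrib)
qed

lemma mean_const: "0 < card X \<Longrightarrow> (\<Sum>x\<in>X. c) / real (card X) = (c::real)"
  by auto

lemma mean_close:
  fixes x :: "'b \<Rightarrow> real"
  assumes "finite I" "i \<in> I" "\<And>j. j \<in> I \<Longrightarrow> \<bar>x i - x j\<bar> \<le> c"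
  shows "\<bar>x i - (\<Sum>j\<in>I. x j) / real (card I)\<bar> \<le> c"
proof -
  have c: "0 < real (card I)" using assms(1,2) by (auto simp: card_gt_0_iff)
  have "x i - (\<Sum>j\<in>I. x j) / real (card I) = (\<Sum>j\<in>I. x i - x j) / real (card I)"
    using c by (simp add: sum_subtractf field_simps)
  then have "\<bar>x i - (\<Sum>j\<in>I. x j) / real (card I)\<bar> = \<bar>\<Sum>j\<in>I. x i - x j\<bar> / real (card I)"
    by (simp only: abs_divide abs_of_nat)
  also have "\<dots> \<le> (\<Sum>j\<in>I. c) / real (card I)"
    by (rule divide_right_mono, rule order_trans[OF sum_abs sum_mono]) (use assms in auto)
  finally show ?thesis using c by simp
qed

text \<open>Weighted AM-GM, \<open>2 * x * y \<le> \<tau> * x^2 + y^2 / \<tau>\<close>. The leading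
  square must keep a coefficient close to one, so the large factor \<open>1 / \<tau>\<close> is
  charged to the small terms \<open>b\<close> and \<open>c\<close>. The uniform bound
  \<open>C0\<close> on \<open>D\<close> allows \<open>\<tau>\<close> to be fixed in advance.\<close>

lemma three_terms_square_le:
  fixes C0 D \<tau> \<delta> a b c \<epsilon> :: real
  assumes "a\<^sup>2 \<le> D + \<delta>" "b\<^sup>2 \<le> \<delta>" "c\<^sup>2 \<le> \<delta>" "D \<le> C0" "0 < \<tau>" "0 \<le> \<delta>"
    and "\<tau> * C0 \<le> \<epsilon> / 2" "\<delta> * (5 + \<tau> + 4 / \<tau>) \<le> \<epsilon> / 2"
  shows "(a + b + c)\<^sup>2 \<le> D + \<epsilon>"
proof -
  have "0 \<le> (\<tau> * a - (b + c))\<^sup>2" by simp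
  then have "2 * \<tau> * (a * (b + c)) \<le> \<tau>\<^sup>2 * a\<^sup>2 + (b + c)\<^sup>2"
    by (simp add: power2_eq_square algebra_simps)
  then have "2 * (a * (b + c)) \<le> (\<tau>\<^sup>2 * a\<^sup>2 + (b + c)\<^sup>2) / \<tau>"
    using assms(5) by (simp add: field_simps)
  also have "\<dots> = \<tau> * a\<^sup>2 + (b + c)\<^sup>2 / \<tau>" using assms(5) by (simp add: field_simps power2_eq_square)
  finally have "2 * (a * (b + c)) \<le> \<tau> * a\<^sup>2 + (b + c)\<^sup>2 / \<tau>" .
  moreover have "(a + b + c)\<^sup>2 = a\<^sup>2 + (b + c)\<^sup>2 + 2 * (a * (b + c))"
    by (simp add: power2_eq_square algebra_simps)
  moreover have "(1 + \<tau>) * a\<^sup>2 + (b + c)\<^sup>2 * (1 + 1 / \<tau>) = a\<^sup>2 + \<tau> * a\<^sup>2 + (b + c)\<^sup>2 + (b + c)\<^sup>2 / \<tau>"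
    by (simp only: distrib_left distrib_right mult_1_left mult_1_right times_divide_eq_right add.assoc)
  ultimately have 1: "(a + b + c)\<^sup>2 \<le> (1 + \<tau>) * a\<^sup>2 + (b + c)\<^sup>2 * (1 + 1 / \<tau>)"
    by linarith
  have "0 \<le> (b - c)\<^sup>2" by simp
  then have "(b + c)\<^sup>2 \<le> 2 * b\<^sup>2 + 2 * c\<^sup>2" by (simp add: power2_eq_square algebra_simps)
  then have 2: "(b + c)\<^sup>2 \<le> 4 * \<delta>" using assms(2,3) by linarith
  have "(1 + \<tau>) * a\<^sup>2 \<le> (1 + \<tau>) * (D + \<delta>)" using assms by (intro mult_left_mono) auto
  moreover have "(b + c)\<^sup>2 * (1 + 1 / \<tau>) \<le> (4 * \<delta>) * (1 + 1 / \<tau>)"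
    using 2 assms(5) by (intro mult_right_mono) auto
  moreover have "\<tau> * D \<le> \<tau> * C0" using assms by (intro mult_left_mono) auto
  moreover have "(1 + \<tau>) * (D + \<delta>) = D + \<delta> + \<tau> * D + \<delta> * \<tau>"
    by (simp add: algebra_simps)
  moreover have "(4 * \<delta>) * (1 + 1 / \<tau>) = 4 * \<delta> + 4 * (\<delta> / \<tau>)"
    by (simp add: algebra_simps)
  moreover have "\<delta> * (5 + \<tau> + 4 / \<tau>) = 5 * \<delta> + \<delta> * \<tau> + 4 * (\<delta> / \<tau>)"
    by (simp add: algebra_simps)
  ultimately show ?thesis using 1 assms(7,8) by linarith
qed

text \<open>Twice the total variation distance is an l1 distance, and Cauchy-Schwarz bounds an l1
  norm by \<open>sqrt n\<close> times the l2 norm. This is the origin of both the 4 and the factor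
  \<open>n\<close> of the theorem.\<close>

lemma tv_le:
  assumes "real n * (\<Sum>j<n. (\<mu> j - \<nu>1 j)\<^sup>2) \<le> a\<^sup>2" "real n * (\<Sum>j<n. (\<nu>1 j - \<nu>2 j)\<^sup>2) \<le> b\<^sup>2"
    "real n * (\<Sum>j<n. (\<nu>2 j - \<nu> j)\<^sup>2) \<le> c\<^sup>2" "0 \<le> a" "0 \<le> b" "0 \<le> c"
  shows "4 * (tv_dist n \<mu> \<nu>)\<^sup>2 \<le> (a + b + c)\<^sup>2"
proof -
  have L1: "(\<Sum>j<n. \<bar>f j\<bar>) \<le> x" if "real n * (\<Sum>j<n. (f j)\<^sup>2) \<le> x\<^sup>2" "0 \<le> x" for f :: "nat \<Rightarrow> real" and x
  proof -
    have "(\<Sum>j<n. 1 * \<bar>f j\<bar>)\<^sup>2 \<le> (\<Sum>j<n. 1\<^sup>2) * (\<Sum>j<n. \<bar>f j\<bar>\<^sup>2)"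
      by (rule Cauchy_Schwarz_ineq_sum)
    then have "(\<Sum>j<n. \<bar>f j\<bar>)\<^sup>2 \<le> x\<^sup>2" using that(1) by simp
    then show ?thesis using that(2) by (rule power2_le_imp_le)
  qed
  have "(\<Sum>j<n. \<bar>\<mu> j - \<nu> j\<bar>) \<le> (\<Sum>j<n. \<bar>\<mu> j - \<nu>1 j\<bar> + \<bar>\<nu>1 j - \<nu>2 j\<bar> + \<bar>\<nu>2 j - \<nu> j\<bar>)"
    by (rule sum_mono) linarith
  also have "\<dots> \<le> a + b + c"
    using L1[OF assms(1,4)] L1[OF assms(2,5)] L1[OF assms(3,6)] by (simp add: sum.distrib)
  finally have "(2 * tv_dist n \<mu> \<nu>)\<^sup>2 \<le> (a + b + c)\<^sup>2"
    by (intro power_mono) (auto simp: tv_dist_def sum_nonneg)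
  then show ?thesis by (simp add: power_mult_distrib)
qed

text \<open>Used to see that every tail of an unvisited vertex is still unrevealed after an arc
  leaving another vertex is revealed.\<close>

lemma notin_dom_upd: "fst g \<notin> fst ` dom \<rho> \<Longrightarrow> fst g \<noteq> fst e \<Longrightarrow> g \<notin> dom (\<rho>(e \<mapsto> f))"
  by (auto simp del: dom_fun_upd simp: dom_def image_iff split: if_splits)

subsection \<open>Partially revealed environments\<close>

locale config =
  fixes din dout :: "nat \<Rightarrow> nat" and n \<Delta> :: nat
  assumes din_ge: "i < n \<Longrightarrow> 2 \<le> din i" and dout_ge: "i < n \<Longrightarrow> 2 \<le> dout i"
    and din_le: "i < n \<Longrightarrow> din i \<le> \<Delta>" and dout_le: "i < n \<Longrightarrow> dout i \<le> \<Delta>"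
    and edges_eq: "num_edges din n = num_edges dout n"
    and n_pos: "0 < n"
begin

abbreviation A where "A \<equiv> tails dout n"
abbreviation B where "B \<equiv> heads din n"
abbreviation m where "m \<equiv> num_edges din n"

lemma finite_A [simp]: "finite A" and finite_B [simp]: "finite B"
  by (auto simp: tails_def heads_def)

lemma card_A: "card A = m" and card_B: "card B = m"
  using edges_eq by (auto simp: tails_def heads_def num_edges_def)

lemma A_iff: "(i, k) \<in> A \<longleftrightarrow> i < n \<and> k < dout i"
  by (auto simp: tails_def)

lemma fst_A: "e \<in> A \<Longrightarrow> fst e < n" and fst_B: "f \<in> B \<Longrightarrow> fst f < n"
  by (auto simp: tails_def heads_def)

lemma sum_A: "(\<Sum>e\<in>A. F e) = (\<Sum>i<n. \<Sum>k<dout i. F (i, k))"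
  by (simp add: tails_def sum.Sigma)

lemma sum_B: "(\<Sum>f\<in>B. F f) = (\<Sum>i<n. \<Sum>k<din i. F (i, k))"
  by (simp add: heads_def sum.Sigma)

lemma m_ge: "2 * n \<le> m"
proof -
  have "(\<Sum>i<n. 2) \<le> (\<Sum>i<n. din i)" by (rule sum_mono) (simp add: din_ge)
  then show ?thesis by (simp add: num_edges_def)
qed

lemma m_le: "m \<le> \<Delta> * n"
proof -
  have "(\<Sum>i<n. din i) \<le> (\<Sum>i<n. \<Delta>)" by (rule sum_mono) (simp add: din_le)
  then show ?thesis by (simp add: num_edges_def mult.commute)
qed

lemma m_pos: "0 < m"
  using m_ge n_pos by linarith

lemma finite_envs: "finite (envs din dout n)"
proof (rule finite_subset)
  show "envs din dout n \<subseteq> A \<rightarrow>\<^sub>E B"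
    by (auto simp: envs_def PiE_def bij_betw_def)
qed (auto intro: finite_PiE)

lemma env_B: "\<omega> \<in> envs din dout n \<Longrightarrow> e \<in> A \<Longrightarrow> \<omega> e \<in> B"
  by (auto simp: envs_def bij_betw_def)

definition valid :: "(nat \<times> nat \<rightharpoonup> nat \<times> nat) \<Rightarrow> bool" where
  "valid \<rho> \<longleftrightarrow> dom \<rho> \<subseteq> A \<and> ran \<rho> \<subseteq> B \<and> inj_on \<rho> (dom \<rho>)"

definition extensions :: "(nat \<times> nat \<rightharpoonup> nat \<times> nat) \<Rightarrow> (nat \<times> nat \<Rightarrow> nat \<times> nat) set" where
  "extensions \<rho> = {\<omega> \<in> envs din dout n. \<forall>e\<in>dom \<rho>. \<rho> e = Some (\<omega> e)}"

text \<open>Expectation conditioned on the revealed arcs \<open>\<rho>\<close>.\<close>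
definition cexp :: "(nat \<times> nat \<rightharpoonup> nat \<times> nat) \<Rightarrow> ((nat \<times> nat \<Rightarrow> nat \<times> nat) \<Rightarrow> real) \<Rightarrow> real" where
  "cexp \<rho> F = (\<Sum>\<omega>\<in>extensions \<rho>. F \<omega>) / real (card (extensions \<rho>))"

lemma finite_extensions [simp]: "finite (extensions \<rho>)"
  using finite_envs by (simp add: extensions_def)

lemma extensions_envs: "\<omega> \<in> extensions \<rho> \<Longrightarrow> \<omega> \<in> envs din dout n"
  by (simp add: extensions_def)

lemma valid_empty [simp]: "valid Map.empty"
  by (simp add: valid_def)

lemma valid_finite_dom: "valid \<rho> \<Longrightarrow> finite (dom \<rho>)"
  unfolding valid_def using finite_subset[OF _ finite_A] by blast

lemma valid_ran_card: "valid \<rho> \<Longrightarrow> card (ran \<rho>) = card (dom \<rho>)"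
proof -
  assume v: "valid \<rho>"
  have "Some ` ran \<rho> = \<rho> ` dom \<rho>"
    by (simp add: ran_def dom_def image_def set_eq_iff) (metis option.exhaust)
  then have "card (Some ` ran \<rho>) = card (\<rho> ` dom \<rho>)" by simp
  then show ?thesis using v by (simp add: card_image valid_def)
qed

lemma valid_finite_ran: "valid \<rho> \<Longrightarrow> finite (ran \<rho>)"
  by (auto simp: valid_def intro: finite_subset)

lemma card_free: "valid \<rho> \<Longrightarrow> card (B - ran \<rho>) = m - card (dom \<rho>)"
  by (simp add: card_Diff_subset valid_finite_ran valid_ran_card card_B valid_def)

lemma valid_card_le: "valid \<rho> \<Longrightarrow> card (dom \<rho>) \<le> m"
  by (metis card_A card_mono finite_A valid_def)

lemma valid_upd:
  assumes "valid \<rho>" "e \<in> A" "e \<notin> dom \<rho>" "f \<in> B - ran \<rho>"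
  shows "valid (\<rho>(e \<mapsto> f))"
proof -
  have "ran (\<rho>(e \<mapsto> f)) = insert f (ran \<rho>)"
    using assms(3) by (simp add: domIff)
  moreover have "inj_on (\<rho>(e \<mapsto> f)) (insert e (dom \<rho>))"
    using assms by (auto simp: valid_def inj_on_def intro: ranI)
  ultimately show ?thesis using assms by (auto simp: valid_def)
qed

lemma card_dom_upd: "valid \<rho> \<Longrightarrow> e \<notin> dom \<rho> \<Longrightarrow> card (dom (\<rho>(e \<mapsto> f))) = Suc (card (dom \<rho>))"
  by (simp add: valid_finite_dom)

lemma extensions_split:
  assumes v: "valid \<rho>" and e: "e \<in> A" "e \<notin> dom \<rho>"
  shows "extensions \<rho> = (\<Union>f\<in>B - ran \<rho>. extensions (\<rho>(e \<mapsto> f)))"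
proof -
  have "\<omega> \<in> (\<Union>f\<in>B - ran \<rho>. extensions (\<rho>(e \<mapsto> f)))" if w: "\<omega> \<in> extensions \<rho>" for \<omega>
  proof -
    have inj: "inj_on \<omega> A" using w by (auto simp: extensions_def envs_def bij_betw_def)
    have "\<omega> e \<notin> ran \<rho>"
    proof
      assume "\<omega> e \<in> ran \<rho>"
      then obtain e' where e': "\<rho> e' = Some (\<omega> e)" by (auto simp: ran_def)
      then have d: "e' \<in> dom \<rho>" by auto
      then have "\<omega> e' = \<omega> e" using w e' by (auto simp: extensions_def)
      moreover have "e' \<in> A" using d v by (auto simp: valid_def)
      ultimately have "e' = e" using inj e by (auto dest: inj_onD)
      then show False using d e by simp
    qed
    moreover have "\<omega> e \<in> B" using w e env_B by (auto simp: extensions_def)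
    moreover have "\<omega> \<in> extensions (\<rho>(e \<mapsto> \<omega> e))" using w by (auto simp: extensions_def)
    ultimately show ?thesis by blast
  qed
  moreover have "\<omega> \<in> extensions \<rho>" if "\<omega> \<in> extensions (\<rho>(e \<mapsto> f))" for \<omega> f
  proof -
    have "\<rho> x = Some (\<omega> x)" if "x \<in> dom \<rho>" for x
    proof -
      have "(\<rho>(e \<mapsto> f)) x = Some (\<omega> x)"
        using \<open>\<omega> \<in> extensions (\<rho>(e \<mapsto> f))\<close> that unfolding extensions_def
        by (simp del: fun_upd_apply)
      moreover have "x \<noteq> e" using \<open>x \<in> dom \<rho>\<close> e by auto
      ultimately show ?thesis by simp
    qed
    then show ?thesis using that by (simp add: extensions_def)
  qed
  ultimately show ?thesis by blast
qed

lemma extensions_disjoint: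
  "f \<noteq> f' \<Longrightarrow> extensions (\<rho>(e \<mapsto> f)) \<inter> extensions (\<rho>(e \<mapsto> f')) = {}"
  by (auto simp: extensions_def)

text \<open>Induction on the number of missing arcs, splitting by the head of one unrevealed tail.
  That the count depends on \<open>\<rho>\<close> only through its number of arcs is what makes the
  next head uniform.\<close>

lemma card_extensions:
  "valid \<rho> \<Longrightarrow> card (extensions \<rho>) = fact (m - card (dom \<rho>))"
proof (induction "m - card (dom \<rho>)" arbitrary: \<rho>)
  case 0
  then have "card (dom \<rho>) = card A" using valid_card_le[of \<rho>] by (simp add: card_A)
  then have dom: "dom \<rho> = A" using 0(2) by (metis card_subset_eq finite_A valid_def)
  have "card (ran \<rho>) = card B" using valid_ran_card[OF 0(2)] dom by (simp add: card_A card_B)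
  then have ran: "ran \<rho> = B" using 0(2) by (metis card_subset_eq finite_B valid_def)
  \<comment> \<open>Nothing is left to choose: the single extension is \<open>\<rho>\<close> itself,
    with \<open>undefined\<close> outside \<open>A\<close> to make it extensional.\<close>
  define \<omega> where "\<omega> = (\<lambda>e. if e \<in> A then the (\<rho> e) else undefined)"
  have inj: "inj_on \<rho> A" using 0(2) dom by (simp add: valid_def)
  have some: "\<rho> e = Some (\<omega> e)" if "e \<in> A" for e
    using that dom by (cases "\<rho> e") (auto simp: \<omega>_def domIff)
  have "\<omega> ` A = B"
  proof -
    have "\<omega> ` A = ran \<rho>"
    proof (intro equalityI subsetI)
      fix f assume "f \<in> ran \<rho>"
      then obtain e where e: "\<rho> e = Some f" by (auto simp: ran_def)
      then have "e \<in> A" using dom by auto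
      then show "f \<in> \<omega> ` A" using some e by (metis image_eqI option.inject)
    next
      fix f assume "f \<in> \<omega> ` A"
      then show "f \<in> ran \<rho>" using some by (metis imageE ranI)
    qed
    then show ?thesis using ran by simp
  qed
  moreover have "inj_on \<omega> A"
    using inj some by (auto simp: inj_on_def)
  ultimately have "\<omega> \<in> envs din dout n"
    by (auto simp: envs_def bij_betw_def \<omega>_def extensional_def)
  then have "\<omega> \<in> extensions \<rho>"
    using some dom by (auto simp: extensions_def)
  moreover have "\<omega>' = \<omega>" if "\<omega>' \<in> extensions \<rho>" for \<omega>'
  proof (rule extensionalityI[where A = A])
    show "\<omega>' \<in> extensional A" using that by (simp add: extensions_def envs_def)
    show "\<omega> \<in> extensional A" by (simp add: \<omega>_def extensional_def)
    fix e assume "e \<in> A"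
    then show "\<omega>' e = \<omega> e" using that some[of e] dom by (auto simp: extensions_def)
  qed
  ultimately have "extensions \<rho> = {\<omega>}" by blast
  then show ?case using 0 by (simp flip: 0(1))
next
  case (Suc k)
  then have "card (dom \<rho>) < card A" by (simp add: card_A)
  moreover have "dom \<rho> \<subseteq> A" using Suc by (simp add: valid_def)
  ultimately obtain e where e: "e \<in> A" "e \<notin> dom \<rho>" by (metis less_irrefl subsetI subset_antisym)
  have fin: "finite (dom \<rho>)" using Suc valid_finite_dom by simp
  have "card (extensions \<rho>) = (\<Sum>f\<in>B - ran \<rho>. card (extensions (\<rho>(e \<mapsto> f))))"
    unfolding extensions_split[OF Suc(3) e]
    by (rule card_UN_disjoint) (auto simp: extensions_disjoint)
  also have "\<dots> = (\<Sum>f\<in>B - ran \<rho>. fact k)"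
  proof (rule sum.cong)
    fix f assume f: "f \<in> B - ran \<rho>"
    have k: "k = m - card (dom (\<rho>(e \<mapsto> f)))"
      using Suc(2) card_dom_upd[OF Suc(3) e(2), of f] by simp
    show "card (extensions (\<rho>(e \<mapsto> f))) = fact k"
      using Suc(1)[OF k valid_upd[OF Suc(3) e f]] k by simp
  qed simp
  also have "\<dots> = card (B - ran \<rho>) * fact k" by simp
  also have "\<dots> = fact (m - card (dom \<rho>))"
    using Suc(2) by (simp add: card_free[OF Suc(3)] flip: Suc(2))
  finally show ?case .
qed

lemma extensions_card_pos: "valid \<rho> \<Longrightarrow> 0 < card (extensions \<rho>)"
  by (simp add: card_extensions)

text \<open>Deferred decisions: the classes \<open>extensions (\<rho>(e \<mapsto> f))\<close> all
  have the same size, so given \<open>\<rho>\<close> the head of a fresh tail is uniform over the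
  free heads.\<close>

lemma reveal:
  assumes v: "valid \<rho>" and e: "e \<in> A" "e \<notin> dom \<rho>"
  shows "cexp \<rho> F = (\<Sum>f\<in>B - ran \<rho>. cexp (\<rho>(e \<mapsto> f)) F) / real (card (B - ran \<rho>))"
proof -
  have "card (dom \<rho>) < card A"
    using v e by (metis finite_A psubset_card_mono psubsetI valid_def)
  then have lt: "card (dom \<rho>) < m" by (simp add: card_A)
  define N where "N = m - Suc (card (dom \<rho>))"
  have N: "m - card (dom \<rho>) = Suc N" using lt by (simp add: N_def)
  have c: "card (extensions (\<rho>(e \<mapsto> f))) = fact N" if "f \<in> B - ran \<rho>" for f
    using card_extensions[OF valid_upd[OF v e that]] card_dom_upd[OF v e(2), of f]
    by (simp add: N_def)
  have "(\<Sum>\<omega>\<in>extensions \<rho>. F \<omega>) = (\<Sum>f\<in>B - ran \<rho>. \<Sum>\<omega>\<in>extensions (\<rho>(e \<mapsto> f)). F \<omega>)"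
    unfolding extensions_split[OF v e]
    by (rule sum.UNION_disjoint) (auto simp: extensions_disjoint)
  also have "\<dots> = (\<Sum>f\<in>B - ran \<rho>. fact N * cexp (\<rho>(e \<mapsto> f)) F)"
    by (rule sum.cong) (simp_all add: cexp_def c del: fun_upd_apply)
  also have "\<dots> = fact N * (\<Sum>f\<in>B - ran \<rho>. cexp (\<rho>(e \<mapsto> f)) F)"
    by (simp only: sum_distrib_left)
  finally have *: "(\<Sum>\<omega>\<in>extensions \<rho>. F \<omega>) = fact N * (\<Sum>f\<in>B - ran \<rho>. cexp (\<rho>(e \<mapsto> f)) F)" .
  have "real (card (extensions \<rho>)) = real (Suc N) * fact N"
    by (simp add: card_extensions[OF v] N algebra_simps)
  then show ?thesis
    unfolding cexp_def[of \<rho>] * card_free[OF v] N by simp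
qed

lemma cexp_cong: "(\<And>\<omega>. \<omega> \<in> extensions \<rho> \<Longrightarrow> F \<omega> = F' \<omega>) \<Longrightarrow> cexp \<rho> F = cexp \<rho> F'"
  by (simp add: cexp_def)

lemma cexp_mono: "(\<And>\<omega>. \<omega> \<in> extensions \<rho> \<Longrightarrow> F \<omega> \<le> F' \<omega>) \<Longrightarrow> cexp \<rho> F \<le> cexp \<rho> F'"
  by (auto simp: cexp_def intro!: divide_right_mono sum_mono)

lemma cexp_const: "valid \<rho> \<Longrightarrow> cexp \<rho> (\<lambda>_. c) = c"
  using extensions_card_pos[of \<rho>] by (auto simp add: cexp_def)

lemma cexp_sum: "cexp \<rho> (\<lambda>\<omega>. \<Sum>i\<in>I. F i \<omega>) = (\<Sum>i\<in>I. cexp \<rho> (F i))"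
  by (simp add: cexp_def sum.swap[of _ _ I] sum_divide_distrib)

lemma cexp_divide: "cexp \<rho> (\<lambda>\<omega>. F \<omega> / c) = cexp \<rho> F / c"
  by (simp add: cexp_def sum_divide_distrib[symmetric] divide_divide_eq_left mult.commute)

lemma cexp_cmult: "cexp \<rho> (\<lambda>\<omega>. c * F \<omega>) = c * cexp \<rho> F"
  by (simp add: cexp_def sum_distrib_left[symmetric])

lemma cexp_add: "cexp \<rho> (\<lambda>\<omega>. F \<omega> + F' \<omega>) = cexp \<rho> F + cexp \<rho> F'"
  by (simp add: cexp_def sum.distrib add_divide_distrib)

lemma cexp_diff: "cexp \<rho> (\<lambda>\<omega>. F \<omega> - F' \<omega>) = cexp \<rho> F - cexp \<rho> F'"
  by (simp add: cexp_def sum_subtractf diff_divide_distrib)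

text \<open>Law after \<open>T\<close> steps of the walk whose first step is along the tail \<open>e\<close>; hence \<open>\<pi>\<^sub>s\<close> is the mean over
  all tails of \<open>walk \<omega> (Suc s)\<close>, because a uniform tail leads to a uniform head.\<close>
primrec walk :: "(nat \<times> nat \<Rightarrow> nat \<times> nat) \<Rightarrow> nat \<Rightarrow> nat \<times> nat \<Rightarrow> nat \<Rightarrow> real" where
  "walk \<omega> 0 e j = of_bool (fst e = j)"
| "walk \<omega> (Suc T) e j = (\<Sum>k<dout (fst (\<omega> e)). walk \<omega> T (fst (\<omega> e), k) j) / real (dout (fst (\<omega> e)))"

text \<open>Given the environment, this is the probability that two independent walkers, leaving
  along \<open>e\<close> and \<open>e'\<close>, share a vertex after \<open>T\<close> steps.\<close>

definition meet :: "nat \<Rightarrow> nat \<times> nat \<Rightarrow> nat \<times> nat \<Rightarrow> (nat \<times> nat \<Rightarrow> nat \<times> nat) \<Rightarrow> real" where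
  "meet T e e' \<omega> = (\<Sum>j<n. walk \<omega> T e j * walk \<omega> T e' j)"

lemma walk_nonneg: "0 \<le> walk \<omega> T e j"
  by (induction T arbitrary: e) (auto intro!: divide_nonneg_nonneg sum_nonneg)

lemma walk_sum:
  assumes "\<omega> \<in> envs din dout n" "e \<in> A"
  shows "(\<Sum>j<n. walk \<omega> T e j) = 1"
  using assms(2)
proof (induction T arbitrary: e)
  case 0
  then show ?case using fst_A[OF 0] by (simp add: of_bool_def)
next
  case (Suc T)
  let ?v = "fst (\<omega> e)"
  have v: "?v < n" using env_B[OF assms(1) Suc(2)] fst_B by blast
  then have d: "0 < dout ?v" using dout_ge[OF v] by linarith
  have "(\<Sum>j<n. walk \<omega> (Suc T) e j) = (\<Sum>k<dout ?v. \<Sum>j<n. walk \<omega> T (?v, k) j) / real (dout ?v)"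
    by (simp add: sum_divide_distrib[symmetric] sum.swap[of _ "{..<n}"])
  also have "\<dots> = 1" using d by (simp add: Suc(1) A_iff v)
  finally show ?case .
qed

lemma walk_le_1: "\<omega> \<in> envs din dout n \<Longrightarrow> e \<in> A \<Longrightarrow> j < n \<Longrightarrow> walk \<omega> T e j \<le> 1"
  using member_le_sum[of j "{..<n}" "walk \<omega> T e"] walk_sum[of \<omega> e T] walk_nonneg by auto

lemma meet_nonneg: "0 \<le> meet T e e' \<omega>"
  by (auto simp: meet_def intro!: sum_nonneg mult_nonneg_nonneg walk_nonneg)

lemma meet_commute: "meet T e e' = meet T e' e"
  by (auto simp: meet_def mult.commute)

lemma meet_le_1:
  assumes "\<omega> \<in> envs din dout n" "e \<in> A" "e' \<in> A" shows "meet T e e' \<omega> \<le> 1"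
proof -
  have "meet T e e' \<omega> \<le> (\<Sum>j<n. walk \<omega> T e j * 1)"
    unfolding meet_def
    by (intro sum_mono mult_left_mono walk_nonneg walk_le_1 assms) auto
  then show ?thesis using walk_sum[OF assms(1,2)] by simp
qed

definition vmeet :: "nat \<Rightarrow> nat \<Rightarrow> nat \<Rightarrow> (nat \<times> nat \<Rightarrow> nat \<times> nat) \<Rightarrow> real" where
  "vmeet T v v' \<omega> = (\<Sum>k<dout v. \<Sum>k'<dout v'. meet T (v, k) (v', k') \<omega>) / (real (dout v) * real (dout v'))"

lemma meet_Suc: "meet (Suc T) e e' \<omega> = vmeet T (fst (\<omega> e)) (fst (\<omega> e')) \<omega>"
proof -
  let ?v = "fst (\<omega> e)" and ?w = "fst (\<omega> e')"
  have "meet (Suc T) e e' \<omega> = (\<Sum>j<n. (\<Sum>k<dout ?v. \<Sum>k'<dout ?w.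
     walk \<omega> T (?v, k) j * walk \<omega> T (?w, k') j) / (real (dout ?v) * real (dout ?w)))"
    by (simp add: meet_def sum_product)
  also have "\<dots> = (\<Sum>j<n. \<Sum>k<dout ?v. \<Sum>k'<dout ?w.
     walk \<omega> T (?v, k) j * walk \<omega> T (?w, k') j) / (real (dout ?v) * real (dout ?w))"
    by (simp add: sum_divide_distrib)
  also have "\<dots> = vmeet T ?v ?w \<omega>"
    by (simp add: vmeet_def meet_def sum.swap[of _ "{..<n}"])
  finally show ?thesis .
qed

section \<open>Meeting probabilities averaged over the unrevealed arcs\<close>

definition cmeet :: "(nat \<times> nat \<rightharpoonup> nat \<times> nat) \<Rightarrow> nat \<Rightarrow> nat \<times> nat \<Rightarrow> nat \<times> nat \<Rightarrow> real" where
  "cmeet \<rho> T e e' = cexp \<rho> (meet T e e')"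

definition cvmeet :: "(nat \<times> nat \<rightharpoonup> nat \<times> nat) \<Rightarrow> nat \<Rightarrow> nat \<Rightarrow> nat \<Rightarrow> real" where
  "cvmeet \<rho> T v v' = (\<Sum>k<dout v. \<Sum>k'<dout v'. cmeet \<rho> T (v, k) (v', k')) / (real (dout v) * real (dout v'))"

lemma cmeet_commute: "cmeet \<rho> T e e' = cmeet \<rho> T e' e"
  by (simp add: cmeet_def meet_commute)

lemma cmeet_nonneg: "0 \<le> cmeet \<rho> T e e'"
  by (auto simp: cmeet_def cexp_def meet_nonneg intro!: divide_nonneg_nonneg sum_nonneg)

lemma cmeet_le_1: "valid \<rho> \<Longrightarrow> e \<in> A \<Longrightarrow> e' \<in> A \<Longrightarrow> cmeet \<rho> T e e' \<le> 1"
  unfolding cmeet_def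
  by (metis (no_types, lifting) cexp_const cexp_mono extensions_envs meet_le_1)

text \<open>Both first heads are constant on \<open>extensions \<rho>\<close>, so the first-step
  recursion passes through the conditional expectation. Revealing the first arcs and then applying
  this drives the inductions on \<open>T\<close> below.\<close>

lemma cmeet_Suc_known:
  assumes "\<rho> e = Some f" "\<rho> e' = Some f'"
  shows "cmeet \<rho> (Suc T) e e' = cvmeet \<rho> T (fst f) (fst f')"
proof -
  have "cmeet \<rho> (Suc T) e e' = cexp \<rho> (vmeet T (fst f) (fst f'))"
    unfolding cmeet_def
  proof (rule cexp_cong)
    fix \<omega> assume "\<omega> \<in> extensions \<rho>"
    then have "\<rho> e = Some (\<omega> e)" "\<rho> e' = Some (\<omega> e')"
      using assms by (auto simp: extensions_def dom_def)
    then show "meet (Suc T) e e' \<omega> = vmeet T (fst f) (fst f') \<omega>"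
      using assms by (simp add: meet_Suc)
  qed
  then show ?thesis by (simp add: vmeet_def[abs_def] cvmeet_def cmeet_def cexp_divide cexp_sum)
qed

lemma cmeet_reveal:
  assumes "valid \<rho>" "e \<in> A" "e \<notin> dom \<rho>"
  shows "cmeet \<rho> T x y = (\<Sum>f\<in>B - ran \<rho>. cmeet (\<rho>(e \<mapsto> f)) T x y) / real (card (B - ran \<rho>))"
  unfolding cmeet_def by (rule reveal[OF assms])

lemma cvmeet_le:
  assumes "v < n" "v' < n"
    and "\<And>k k'. (v, k) \<in> A \<Longrightarrow> (v', k') \<in> A \<Longrightarrow> cmeet \<rho> T (v, k) (v', k') \<le> x"
  shows "cvmeet \<rho> T v v' \<le> x"
  unfolding cvmeet_def
  by (rule mean_mean_le) (use assms dout_ge[OF assms(1)] dout_ge[OF assms(2)] A_iff in auto)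

lemma cvmeet_abs:
  assumes "v < n" "v' < n"
    and "\<And>k k'. (v, k) \<in> A \<Longrightarrow> (v', k') \<in> A \<Longrightarrow> \<bar>cmeet \<rho> T (v, k) (v', k') - c\<bar> \<le> x"
  shows "\<bar>cvmeet \<rho> T v v' - c\<bar> \<le> x"
  unfolding cvmeet_def
  by (rule abs_mean_mean_le) (use assms dout_ge[OF assms(1)] dout_ge[OF assms(2)] A_iff in auto)

lemma cvmeet_diag_le:
  assumes "v < n" "b \<le> a"
    and "\<And>k. (v, k) \<in> A \<Longrightarrow> cmeet \<rho> T (v, k) (v, k) \<le> a"
    and "\<And>k k'. (v, k) \<in> A \<Longrightarrow> (v, k') \<in> A \<Longrightarrow> k \<noteq> k' \<Longrightarrow> cmeet \<rho> T (v, k) (v, k') \<le> b"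
  shows "cvmeet \<rho> T v v \<le> (a + b) / 2"
  unfolding cvmeet_def
  by (rule diag_mean_le) (use assms dout_ge[OF assms(1)] A_iff in auto)

lemma cvmeet_diag_abs:
  assumes "v < n"
    and "\<And>k. (v, k) \<in> A \<Longrightarrow> \<bar>cmeet \<rho> T (v, k) (v, k) - (b + a)\<bar> \<le> x"
    and "\<And>k k'. (v, k) \<in> A \<Longrightarrow> (v, k') \<in> A \<Longrightarrow> k \<noteq> k' \<Longrightarrow> \<bar>cmeet \<rho> T (v, k) (v, k') - b\<bar> \<le> x"
  shows "\<bar>cvmeet \<rho> T v v - (b + a / real (dout v))\<bar> \<le> x"
  unfolding cvmeet_def
  by (rule diag_mean_abs) (use assms dout_ge[OF assms(1)] A_iff in auto)

lemma cvmeet_nonneg: "0 \<le> cvmeet \<rho> T v v'"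
  by (auto simp: cvmeet_def cmeet_nonneg intro!: divide_nonneg_nonneg sum_nonneg)

lemma cvmeet_le_1: "valid \<rho> \<Longrightarrow> v < n \<Longrightarrow> v' < n \<Longrightarrow> cvmeet \<rho> T v v' \<le> 1"
  by (rule cvmeet_le) (auto intro: cmeet_le_1)

lemma Delta_ge: "2 \<le> \<Delta>"
  using din_ge[OF n_pos] din_le[OF n_pos] by linarith

lemma card_heads_at: "finite Z \<Longrightarrow> card {f \<in> B. fst f \<in> Z} \<le> \<Delta> * card Z"
proof -
  assume "finite Z"
  moreover have "{f \<in> B. fst f \<in> Z} \<subseteq> Z \<times> {..<\<Delta>}"
    using din_le by (fastforce simp: heads_def)
  ultimately have "card {f \<in> B. fst f \<in> Z} \<le> card (Z \<times> {..<\<Delta>})"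
    by (intro card_mono) auto
  then show ?thesis by (simp add: card_cartesian_product mult.commute)
qed

lemma sum_heads_at:
  assumes "finite Z" "F \<subseteq> B"
  shows "(\<Sum>f\<in>F. of_bool (fst f \<in> Z)) \<le> real \<Delta> * real (card Z)"
proof -
  have "finite F" by (rule finite_subset[OF assms(2) finite_B])
  then have "(\<Sum>f\<in>F. of_bool (fst f \<in> Z)) = real (card {f \<in> F. fst f \<in> Z})"
    by (simp add: of_bool_def sum.If_cases Int_def)
  also have "\<dots> \<le> real (card {f \<in> B. fst f \<in> Z})"
    using assms(2) by (intro of_nat_mono card_mono) auto
  also have "\<dots> \<le> real (\<Delta> * card Z)"
    using card_heads_at[OF assms(1)] by (intro of_nat_mono)
  finally show ?thesis by simp
qed

end

subsection \<open>Meeting probabilities of two walkers\<close>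

text \<open>While at most \<open>R\<close> arcs are revealed, a new arc hits a given set of \<open>R + 2\<close> vertices with
  probability at most \<open>\<eta>\<close>.\<close>
locale config_bounds = config +
  fixes R :: nat and \<eta> :: real
  assumes R_less: "R + 2 < m"
    and eta_ge: "real \<Delta> * (real R + 3) \<le> \<eta> * (real m - real R - 1)"
    and eta_le: "\<eta> \<le> 1 / 6"
begin

lemma eta_pos: "0 < \<eta>"
proof -
  have "0 < real \<Delta> * (real R + 3)" using Delta_ge by (intro mult_pos_pos) auto
  then have "0 < \<eta> * (real m - real R - 1)" using eta_ge by linarith
  moreover have "0 < real m - real R - 1" using R_less by linarith
  ultimately show ?thesis by (simp add: zero_less_mult_iff)
qed

lemma eta_mult_ge: "real m - real R - 1 \<le> x \<Longrightarrow> real \<Delta> * (real R + 3) \<le> \<eta> * x"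
  using eta_ge mult_left_mono[of "real m - real R - 1" x \<eta>] eta_pos by linarith

lemma eta_card:
  assumes "card Z \<le> R + 2" "real m - real R - 1 \<le> x"
  shows "real \<Delta> * real (card Z) \<le> \<eta> * x"
proof -
  have "real \<Delta> * real (card Z) \<le> real \<Delta> * (real R + 3)"
    using assms(1) by (intro mult_left_mono) auto
  then show ?thesis using eta_mult_ge[OF assms(2)] by linarith
qed

text \<open>At most a fraction \<open>\<eta>\<close> of the free heads lies at \<open>Z\<close>, so
  the surcharge \<open>y\<close> is paid with that weight only.\<close>

lemma mean_free_le:
  assumes v: "valid \<rho>" "card (dom \<rho>) \<le> R" and Z: "finite Z" "card Z \<le> R + 2"
    and good: "\<And>f. f \<in> B - ran \<rho> \<Longrightarrow> fst f \<notin> Z \<Longrightarrow> X f \<le> x"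
    and all: "\<And>f. f \<in> B - ran \<rho> \<Longrightarrow> X f \<le> x + y" and y: "0 \<le> y"
  shows "(\<Sum>f\<in>B - ran \<rho>. X f) / real (card (B - ran \<rho>)) \<le> x + \<eta> * y"
proof -
  let ?M = "real (card (B - ran \<rho>))"
  have M: "real m - real R - 1 \<le> ?M" "0 < ?M"
    using card_free[OF v(1)] v(2) R_less by auto
  have "(\<Sum>f\<in>B - ran \<rho>. X f) \<le> (\<Sum>f\<in>B - ran \<rho>. x + y * of_bool (fst f \<in> Z))"
    by (intro sum_mono) (use good all in auto)
  also have "\<dots> = ?M * x + y * (\<Sum>f\<in>B - ran \<rho>. of_bool (fst f \<in> Z))"
    by (simp add: sum.distrib sum_distrib_left)
  also have "\<dots> \<le> ?M * x + y * (\<eta> * ?M)"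
    using sum_heads_at[of Z "B - ran \<rho>"] Z eta_card[OF Z(2) M(1)] y
    by (intro add_left_mono mult_left_mono) auto
  also have "\<dots> = (x + \<eta> * y) * ?M" by (simp add: algebra_simps)
  finally show ?thesis using M by (simp add: divide_le_eq)
qed

lemma mean_free_abs:
  assumes v: "valid \<rho>" "card (dom \<rho>) \<le> R" and Z: "finite Z" "card Z \<le> R + 2"
    and good: "\<And>f. f \<in> B - ran \<rho> \<Longrightarrow> fst f \<notin> Z \<Longrightarrow> \<bar>X f - c f\<bar> \<le> x"
    and all: "\<And>f. f \<in> B - ran \<rho> \<Longrightarrow> \<bar>X f - c f\<bar> \<le> x + y" and y: "0 \<le> y"
  shows "\<bar>(\<Sum>f\<in>B - ran \<rho>. X f) / real (card (B - ran \<rho>))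
           - (\<Sum>f\<in>B - ran \<rho>. c f) / real (card (B - ran \<rho>))\<bar> \<le> x + \<eta> * y"
proof -
  have "\<bar>(\<Sum>f\<in>B - ran \<rho>. X f) / real (card (B - ran \<rho>))
           - (\<Sum>f\<in>B - ran \<rho>. c f) / real (card (B - ran \<rho>))\<bar>
      = \<bar>\<Sum>f\<in>B - ran \<rho>. X f - c f\<bar> / real (card (B - ran \<rho>))"
    by (simp add: sum_subtractf flip: diff_divide_distrib)
  also have "\<dots> \<le> (\<Sum>f\<in>B - ran \<rho>. \<bar>X f - c f\<bar>) / real (card (B - ran \<rho>))"
    by (intro divide_right_mono sum_abs) auto
  also have "\<dots> \<le> x + \<eta> * y"
    by (rule mean_free_le[OF v Z good all y])
  finally show ?thesis .
qed

lemma mean_free_const: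
  assumes "valid \<rho>" "card (dom \<rho>) \<le> R"
  shows "(\<Sum>f\<in>B - ran \<rho>. c) / real (card (B - ran \<rho>)) = c"
proof -
  have "card (B - ran \<rho>) \<noteq> 0" using card_free[OF assms(1)] assms(2) R_less by linarith
  then show ?thesis by (metis nonzero_mult_div_cancel_left of_nat_eq_0_iff sum_constant)
qed

lemma mean_free_le_const:
  assumes v: "valid \<rho>" "card (dom \<rho>) \<le> R"
    and all: "\<And>f. f \<in> B - ran \<rho> \<Longrightarrow> X f \<le> x"
  shows "(\<Sum>f\<in>B - ran \<rho>. X f) / real (card (B - ran \<rho>)) \<le> x"
  using mean_free_le[OF v, of "{}" X x 0] all by simp

text \<open>Dropping \<open>r\<close> of the \<open>m\<close> heads moves a mean of values in [0, 1]
  by at most \<open>r / (m - r)\<close>, which is below \<open>\<eta>\<close> while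
  \<open>r \<le> R\<close>.\<close>

lemma mean_free_close:
  assumes v: "valid \<rho>" "card (dom \<rho>) \<le> R"
    and c: "\<And>f. f \<in> B \<Longrightarrow> 0 \<le> c f" "\<And>f. f \<in> B \<Longrightarrow> c f \<le> 1"
  shows "\<bar>(\<Sum>f\<in>B - ran \<rho>. c f) / real (card (B - ran \<rho>)) - (\<Sum>f\<in>B. c f) / real m\<bar> \<le> \<eta>"
proof -
  let ?M = "real (card (B - ran \<rho>))" and ?r = "real (card (dom \<rho>))"
  have M: "real m - real R - 1 \<le> ?M" "0 < ?M" "?M = real m - ?r"
    using card_free[OF v(1)] v(2) R_less by auto
  have rB: "ran \<rho> \<subseteq> B" using v by (simp add: valid_def)
  define S where "S = (\<Sum>f\<in>B. c f)"
  define s where "s = (\<Sum>f\<in>ran \<rho>. c f)"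
  have "s \<le> (\<Sum>f\<in>ran \<rho>. 1)" unfolding s_def using rB c by (intro sum_mono) auto
  then have s: "s \<le> ?r" using v by (simp add: valid_ran_card)
  have s0: "0 \<le> s" unfolding s_def using rB c by (intro sum_nonneg) auto
  have "S \<le> (\<Sum>f\<in>B. 1)" unfolding S_def using c by (intro sum_mono) auto
  then have S: "S \<le> real m" by (simp add: card_B)
  have S0: "0 \<le> S" unfolding S_def using c by (intro sum_nonneg) auto
  have d: "(\<Sum>f\<in>B - ran \<rho>. c f) = S - s"
    unfolding S_def s_def using rB by (simp add: sum_diff)
  have "(S - s) / ?M - S / real m = ((S - s) * real m - S * ?M) / (?M * real m)"
    using M(2) m_pos by (intro diff_frac_eq) linarith+
  also have "?M * real m = real m * ?M" by (rule mult.commute)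
  also have "(S - s) * real m - S * ?M = ?r * S - real m * s"
    unfolding M(3) by (simp add: algebra_simps)
  finally have eq: "(S - s) / ?M - S / real m = (?r * S - real m * s) / (real m * ?M)" .
  have bd: "\<bar>?r * S - real m * s\<bar> \<le> real m * ?r"
  proof -
    have "?r * S \<le> ?r * real m" "real m * s \<le> real m * ?r" "0 \<le> ?r * S" "0 \<le> real m * s"
      using S S0 s s0 by (auto intro: mult_left_mono)
    then show ?thesis unfolding abs_le_iff by (simp only: mult.commute[of ?r "real m"]) linarith
  qed
  have "0 \<le> real m * ?M" by simp
  then have "\<bar>(S - s) / ?M - S / real m\<bar> \<le> (real m * ?r) / (real m * ?M)"
    unfolding eq abs_divide abs_of_nonneg[OF \<open>0 \<le> real m * ?M\<close>] by (rule divide_right_mono[OF bd])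
  also have "\<dots> = ?r / ?M" using m_pos by simp
  also have "\<dots> \<le> \<eta>"
  proof -
    have "1 * ?r \<le> real \<Delta> * (real R + 3)" using v(2) Delta_ge by (intro mult_mono) auto
    then show ?thesis using eta_mult_ge[OF M(1)] M(2) by (simp add: divide_le_eq)
  qed
  finally show ?thesis by (simp add: d S_def)
qed

text \<open>Only the second walker needs a fresh tail; the first may follow revealed arcs. Except
  with probability \<open>\<eta>\<close>, the arc of \<open>e'\<close> ends at an unvisited vertex
  different from the end of the first walker's arc, and the situation repeats. At most two arcs per
  step explain the budget \<open>2 * T\<close>. For \<open>T = 0\<close> no step remains that could
  separate two tails of one vertex, hence the extra premise.\<close>

lemma cmeet_distinct:
  assumes "valid \<rho>" "e \<in> A" "e' \<in> A" "e \<noteq> e'" "e' \<notin> dom \<rho>"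
    and "T = 0 \<Longrightarrow> fst e \<noteq> fst e'" "card (dom \<rho>) + 2 * T \<le> R"
  shows "cmeet \<rho> T e e' \<le> real T * \<eta>"
  using assms
proof (induction T arbitrary: \<rho> e e')
  case 0
  then have "meet 0 e e' = (\<lambda>_. 0)" by (auto simp: meet_def)
  then show ?case by (simp add: cmeet_def cexp_def)
next
  case (Suc T)
  \<comment> \<open>The case where the first walker's arc is known; a fresh \<open>e\<close> reduces
    to it by revealing \<open>e\<close>.\<close>
  have K: "cmeet \<rho> (Suc T) e e' \<le> real (Suc T) * \<eta>"
    if \<rho>: "valid \<rho>" "\<rho> e = Some f" and e': "e' \<in> A" "e' \<notin> dom \<rho>"
      and c: "card (dom \<rho>) + 2 * T + 1 \<le> R" for \<rho> e e' f
  proof -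
    have fB: "f \<in> B" using \<rho> by (auto simp: valid_def intro: ranI)
    have ee: "e \<noteq> e'" using \<rho> e' by auto
    \<comment> \<open>\<open>fst f\<close> keeps the walkers apart; \<open>fst e'\<close> is
      included because \<open>e'\<close> itself is about to be revealed.\<close>
    define Z where "Z = insert (fst f) (insert (fst e') (fst ` dom \<rho>))"
    have fin: "finite (dom \<rho>)" by (rule valid_finite_dom[OF \<rho>(1)])
    have "card Z \<le> Suc (Suc (card (fst ` dom \<rho>)))"
      using fin by (simp add: Z_def card_insert_if)
    then have cZ: "card Z \<le> R + 2" using card_image_le[OF fin, of fst] c by linarith
    have known: "cmeet (\<rho>(e' \<mapsto> f')) (Suc T) e e' = cvmeet (\<rho>(e' \<mapsto> f')) T (fst f) (fst f')" for f'
      by (rule cmeet_Suc_known) (use \<rho> ee in auto)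
    have "(\<Sum>f'\<in>B - ran \<rho>. cvmeet (\<rho>(e' \<mapsto> f')) T (fst f) (fst f')) / real (card (B - ran \<rho>))
        \<le> real T * \<eta> + \<eta> * 1"
    proof (rule mean_free_le[OF \<rho>(1) _ _ cZ])
      show "card (dom \<rho>) \<le> R" using c by simp
      show "finite Z" using fin by (simp add: Z_def)
    next
      fix f' assume f': "f' \<in> B - ran \<rho>" "fst f' \<notin> Z"
      have v': "valid (\<rho>(e' \<mapsto> f'))" by (rule valid_upd[OF \<rho>(1) e' f'(1)])
      show "cvmeet (\<rho>(e' \<mapsto> f')) T (fst f) (fst f') \<le> real T * \<eta>"
      proof (rule cvmeet_le)
        fix k k' assume k: "(fst f, k) \<in> A" "(fst f', k') \<in> A"
        show "cmeet (\<rho>(e' \<mapsto> f')) T (fst f, k) (fst f', k') \<le> real T * \<eta>"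
        proof (rule Suc.IH[OF v' k])
          show "(fst f', k') \<notin> dom (\<rho>(e' \<mapsto> f'))"
            using f'(2) by (intro notin_dom_upd) (auto simp: Z_def)
          show "card (dom (\<rho>(e' \<mapsto> f'))) + 2 * T \<le> R"
            using card_dom_upd[OF \<rho>(1) e'(2)] c by simp
        qed (use f'(2) in \<open>auto simp: Z_def\<close>)
      qed (use fB f' fst_B in auto)
    next
      fix f' assume f': "f' \<in> B - ran \<rho>"
      have "cvmeet (\<rho>(e' \<mapsto> f')) T (fst f) (fst f') \<le> 1"
        by (rule cvmeet_le_1[OF valid_upd[OF \<rho>(1) e' f']]) (use fB f' fst_B in auto)
      then show "cvmeet (\<rho>(e' \<mapsto> f')) T (fst f) (fst f') \<le> real T * \<eta> + 1"
        using eta_pos by (simp add: add_increasing)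
    qed simp
    then show ?thesis
      unfolding cmeet_reveal[OF \<rho>(1) e', of "Suc T"] known by (simp add: algebra_simps)
  qed
  show ?case
  proof (cases "e \<in> dom \<rho>")
    case True
    then obtain f where "\<rho> e = Some f" by auto
    then show ?thesis by (rule K[OF Suc.prems(1)]) (use Suc.prems in auto)
  next
    case False
    have "(\<Sum>f\<in>B - ran \<rho>. cmeet (\<rho>(e \<mapsto> f)) (Suc T) e e') / real (card (B - ran \<rho>)) \<le> real (Suc T) * \<eta>"
    proof (rule mean_free_le_const[OF Suc.prems(1)])
      fix f assume f: "f \<in> B - ran \<rho>"
      show "cmeet (\<rho>(e \<mapsto> f)) (Suc T) e e' \<le> real (Suc T) * \<eta>"
      proof (rule K[OF valid_upd[OF Suc.prems(1,2) False f]])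
        show "card (dom (\<rho>(e \<mapsto> f))) + 2 * T + 1 \<le> R"
          using card_dom_upd[OF Suc.prems(1) False] Suc.prems(7) by simp
      qed (use Suc.prems in auto)
    qed (use Suc.prems in auto)
    then show ?thesis unfolding cmeet_reveal[OF Suc.prems(1,2) False, of "Suc T"] .
  qed
qed

end

section \<open>Leading-order constants and the target bound\<close>

context config begin

abbreviation rr where "rr \<equiv> varrho din dout n"

text \<open>Up to \<open>O(\<eta>\<^sup>2)\<close>, \<open>kap\<close> is the probability that two unrevealed tails lead to the same vertex, \<open>coal\<close> that
  the walkers then also continue along the same tail, and \<open>base T\<close> that walkers starting from
  distinct fresh tails meet at time \<open>Suc T\<close>; from the same fresh tail it is
  \<open>base T + rr ^ T\<close>, but only up to \<open>O(\<eta>)\<close>.\<close>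
definition kap :: "real" where
  "kap = (\<Sum>v<n. real (din v) * (real (din v) - 1)) / (real m)\<^sup>2"

definition coal :: "real" where
  "coal = (\<Sum>v<n. real (din v) * (real (din v) - 1) / real (dout v)) / (real m)\<^sup>2"

definition base :: "nat \<Rightarrow> real" where
  "base T = kap + coal * (\<Sum>s<T. rr ^ s)"

text \<open>In this form \<open>rr\<close> is the probability that two walkers entering a vertex
  together through a uniform head also leave it along the same tail.\<close>

lemma varrho_heads: "rr = (\<Sum>f\<in>B. 1 / real (dout (fst f))) / real m"
  by (simp add: varrho_def sum_B)

lemma varrho_nonneg: "0 \<le> rr"
  by (auto simp: varrho_def intro!: divide_nonneg_nonneg sum_nonneg)

lemma varrho_le: "rr \<le> 1 / 2"
proof -
  have "(\<Sum>f\<in>B. 1 / real (dout (fst f))) \<le> (\<Sum>f\<in>B. 1 / 2)"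
    by (intro sum_mono divide_left_mono) (use dout_ge fst_B in fastforce)+
  then show ?thesis using m_pos unfolding varrho_heads
    by (simp add: card_B field_simps)
qed

lemma base_0: "base 0 = kap" and base_Suc: "base (Suc T) = base T + coal * rr ^ T"
  by (simp_all add: base_def algebra_simps)

lemma kap_nonneg: "0 \<le> kap" and coal_nonneg: "0 \<le> coal"
  using din_ge by (fastforce simp: kap_def coal_def intro!: divide_nonneg_nonneg sum_nonneg mult_nonneg_nonneg)+

lemma kap_le: "kap \<le> real \<Delta> / real m"
proof -
  have "(\<Sum>v<n. real (din v) * (real (din v) - 1)) \<le> (\<Sum>v<n. real (din v) * real \<Delta>)"
    using din_le by (intro sum_mono mult_left_mono) force+
  also have "\<dots> = real m * real \<Delta>" by (simp add: num_edges_def sum_distrib_right)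
  finally have "kap \<le> real m * real \<Delta> / (real m)\<^sup>2" unfolding kap_def by (intro divide_right_mono) auto
  then show ?thesis using m_pos by (simp add: power2_eq_square)
qed

lemma coal_le: "coal \<le> kap / 2"
proof -
  have "(\<Sum>v<n. real (din v) * (real (din v) - 1) / real (dout v)) \<le> (\<Sum>v<n. real (din v) * (real (din v) - 1) / 2)"
  proof (rule sum_mono)
    fix v assume "v \<in> {..<n}"
    then have "2 \<le> dout v" "2 \<le> din v" using dout_ge din_ge by auto
    then show "real (din v) * (real (din v) - 1) / real (dout v) \<le> real (din v) * (real (din v) - 1) / 2"
      by (intro divide_left_mono mult_nonneg_nonneg) auto
  qed
  also have "\<dots> = (\<Sum>v<n. real (din v) * (real (din v) - 1)) / 2"
    by (simp add: sum_divide_distrib)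
  finally have "coal \<le> (\<Sum>v<n. real (din v) * (real (din v) - 1)) / 2 / (real m)\<^sup>2"
    unfolding coal_def by (intro divide_right_mono) auto
  then show ?thesis by (simp add: kap_def)
qed

lemma geo_rr: "(\<Sum>s<T. rr ^ s) \<le> 2"
proof -
  have "(\<Sum>s<T. rr ^ s) = (1 - rr ^ T) / (1 - rr)"
    using sum_gp_strict[of rr T] varrho_le by simp
  also have "\<dots> \<le> 1 / (1 / 2)"
    using varrho_le varrho_nonneg by (intro frac_le) auto
  finally show ?thesis by simp
qed

lemma base_nonneg: "0 \<le> base T"
  by (auto simp: base_def intro!: add_nonneg_nonneg mult_nonneg_nonneg kap_nonneg coal_nonneg sum_nonneg zero_le_power varrho_nonneg)

lemma base_le: "base T \<le> 2 * kap"
proof -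
  have "coal * (\<Sum>s<T. rr ^ s) \<le> (kap / 2) * 2"
    by (intro mult_mono coal_le geo_rr) (auto intro!: sum_nonneg zero_le_power varrho_nonneg kap_nonneg divide_nonneg_nonneg)
  then show ?thesis by (simp add: base_def)
qed

lemma power_rr_le: "rr ^ T \<le> (1 / 2) ^ T"
  by (intro power_mono varrho_le varrho_nonneg)

lemma power_rr_le_1: "rr ^ T \<le> 1"
  using varrho_le varrho_nonneg by (intro power_le_one) auto

lemma cmeet_diag_1:
  assumes "valid \<rho>" "e \<in> A"
  shows "cmeet \<rho> (Suc 0) e e = 1"
proof -
  have "cmeet \<rho> (Suc 0) e e = cexp \<rho> (\<lambda>_. 1)"
    unfolding cmeet_def
  proof (rule cexp_cong)
    fix \<omega> assume "\<omega> \<in> extensions \<rho>"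
    then have "\<omega> \<in> envs din dout n" by (rule extensions_envs)
    then have v: "fst (\<omega> e) < n" using env_B assms fst_B by blast
    then have d: "0 < dout (fst (\<omega> e))" using dout_ge[OF v] by linarith
    have "walk \<omega> (Suc 0) e j = of_bool (fst (\<omega> e) = j)" for j
      using d by simp
    then have "meet (Suc 0) e e \<omega> = (\<Sum>j<n. if j = fst (\<omega> e) then 1 else 0)"
      unfolding meet_def by (intro sum.cong) auto
    then show "meet (Suc 0) e e \<omega> = 1" using v by simp
  qed
  then show ?thesis using assms by (simp add: cexp_const)
qed

lemma card_Z:
  assumes "valid \<rho>"
  shows "card (insert v (fst ` dom \<rho>)) \<le> card (dom \<rho>) + 1"
    "card (insert u (insert v (fst ` dom \<rho>))) \<le> card (dom \<rho>) + 2"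
    "finite (fst ` dom \<rho>)"
  using card_image_le[OF valid_finite_dom[OF assms], of fst] valid_finite_dom[OF assms]
  by (auto simp: card_insert_if)

lemma row_same:
  assumes "F \<subseteq> B"
  shows "(\<Sum>f'\<in>F. of_bool (fst f = fst f')) \<le> real \<Delta>"
  using sum_heads_at[of "{fst f}" F] assms by (simp add: eq_commute)

text \<open>A vertex \<open>v\<close> owns \<open>din v * (din v - 1)\<close> ordered pairs of
  distinct heads. With \<open>C v = 1\<close> and \<open>C v = 1 / dout v\<close> the sum is the
  numerator of \<open>kap\<close> and of \<open>coal\<close>.\<close>

lemma sum_same_heads:
  "(\<Sum>f\<in>B. \<Sum>f'\<in>B - {f}. of_bool (fst f = fst f') * C (fst f)) =
   (\<Sum>v<n. real (din v) * (real (din v) - 1) * C v)"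
proof -
  have "(\<Sum>f'\<in>B - {f}. of_bool (fst f = fst f') * C (fst f)) = (real (din (fst f)) - 1) * C (fst f)"
    if "f \<in> B" for f
  proof -
    have v: "fst f < n" using that fst_B by blast
    have "(\<Sum>f'\<in>B. of_bool (fst f = fst f') :: real) = (\<Sum>i<n. \<Sum>k<din i. if i = fst f then 1 else 0)"
      unfolding sum_B by (intro sum.cong) auto
    also have "\<dots> = real (din (fst f))"
      using v by (simp add: if_distrib cong: if_cong)
    finally have "(\<Sum>f'\<in>B - {f}. of_bool (fst f = fst f') :: real) = real (din (fst f)) - 1"
      using that by (simp add: sum_diff1 del: sum_of_bool_eq)
    then show ?thesis by (simp flip: sum_distrib_right)
  qed
  then have "(\<Sum>f\<in>B. \<Sum>f'\<in>B - {f}. of_bool (fst f = fst f') * C (fst f)) = (\<Sum>f\<in>B. (real (din (fst f)) - 1) * C (fst f))"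
    by (rule sum.cong[OF refl])
  then show ?thesis by (simp add: sum_B mult.assoc)
qed

abbreviation gam where "gam \<equiv> gamma_deg din dout n"

lemma coal_eq: "coal = (gam - rr) / real m"
proof -
  have "(\<Sum>v<n. real (din v) * (real (din v) - 1) / real (dout v))
     = (\<Sum>v<n. real (din v) ^ 2 / real (dout v)) - (\<Sum>v<n. real (din v) / real (dout v))"
    by (simp add: algebra_simps power2_eq_square diff_divide_distrib sum_subtractf)
  then show ?thesis
    using m_pos by (simp add: coal_def gamma_deg_def varrho_def power2_eq_square diff_divide_distrib)
qed

text \<open>Expand the nonnegative \<open>(din v - dout v)^2 / dout v\<close> and use that
  in-degrees and out-degrees both sum to \<open>m\<close>.\<close>

lemma gamma_ge_1: "1 \<le> gam"
proof -
  have "0 \<le> (\<Sum>v<n. (real (din v) - real (dout v))\<^sup>2 / real (dout v))"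
    by (intro sum_nonneg) simp
  also have "\<dots> = (\<Sum>v<n. real (din v) ^ 2 / real (dout v) - 2 * real (din v) + real (dout v))"
  proof (rule sum.cong)
    fix v assume "v \<in> {..<n}"
    then have "0 < dout v" using dout_ge[of v] by simp
    then show "(real (din v) - real (dout v))\<^sup>2 / real (dout v) = real (din v) ^ 2 / real (dout v) - 2 * real (din v) + real (dout v)"
      by (simp add: field_simps power2_eq_square)
  qed simp
  also have "\<dots> = (\<Sum>v<n. real (din v) ^ 2 / real (dout v)) - 2 * real m + real (num_edges dout n)"
    by (simp add: sum.distrib sum_subtractf num_edges_def sum_distrib_left)
  also have "\<dots> = (\<Sum>v<n. real (din v) ^ 2 / real (dout v)) - real m"
    using edges_eq by simp
  finally show ?thesis using m_pos by (simp add: gamma_deg_def field_simps)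
qed

definition bound :: "nat \<Rightarrow> real" where
  "bound t = real n * (gam - 1) / (real m * (1 - rr)) * rr ^ t"

text \<open>Since \<open>m \<ge> 2 * n\<close> and \<open>rr \<le> 1 / 2\<close>, the prefactor
  \<open>n / (m * (1 - rr))\<close> is at most one. Uniformity in \<open>n\<close> is what matters:
  it fixes \<open>\<tau>\<close>, and later \<open>h\<close>, before \<open>n\<close>.\<close>

lemma bound_le: "bound t \<le> real \<Delta> * (1 / 2) ^ t"
proof -
  have "(\<Sum>v<n. (real (din v))\<^sup>2 / real (dout v)) \<le> (\<Sum>v<n. real (din v) * real \<Delta>)"
  proof (rule sum_mono)
    fix v assume "v \<in> {..<n}"
    then have d: "1 \<le> real (dout v)" "real (din v) \<le> real \<Delta>" using dout_ge[of v] din_le[of v] by auto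
    have "(real (din v))\<^sup>2 / real (dout v) \<le> (real (din v))\<^sup>2 / 1"
      using d by (intro divide_left_mono) auto
    also have "\<dots> \<le> real (din v) * real \<Delta>" using d by (simp add: power2_eq_square mult_left_mono)
    finally show "(real (din v))\<^sup>2 / real (dout v) \<le> real (din v) * real \<Delta>" .
  qed
  also have "\<dots> = real m * real \<Delta>" by (simp add: num_edges_def sum_distrib_right)
  finally have g: "gam \<le> real \<Delta>" using m_pos by (simp add: gamma_deg_def divide_le_eq mult.commute)
  have d: "real n \<le> real m * (1 - rr)"
  proof -
    have "real n \<le> real m * (1 / 2)" using m_ge by simp
    also have "\<dots> \<le> real m * (1 - rr)" using varrho_le by (intro mult_left_mono) auto
    finally show ?thesis .
  qed
  have n0: "0 < real n" using n_pos by simp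
  have eq: "bound t = (gam - 1) * (real n / (real m * (1 - rr))) * rr ^ t" by (simp add: bound_def)
  have q: "0 \<le> real n / (real m * (1 - rr))" "real n / (real m * (1 - rr)) \<le> 1"
    using d n0 by auto
  have "(gam - 1) * (real n / (real m * (1 - rr))) \<le> real \<Delta> * 1"
    using g q gamma_ge_1 by (intro mult_mono) auto
  then show ?thesis
    unfolding eq using power_rr_le[of t] varrho_nonneg by (intro mult_mono) auto
qed

end

context config_bounds begin

lemma kap_eta: "kap \<le> \<eta>"
proof -
  have "real \<Delta> * 1 \<le> real \<Delta> * (real R + 3)" by (intro mult_left_mono) auto
  then have "real \<Delta> \<le> \<eta> * real m" using eta_mult_ge[of "real m"] by simp
  then have "real \<Delta> / real m \<le> \<eta>" using m_pos by (simp add: divide_le_eq)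
  then show ?thesis using kap_le by linarith
qed

lemma coal_eta: "coal \<le> \<eta>"
  using coal_le kap_eta kap_nonneg by linarith

lemma base_eta: "base T \<le> (real T + 1) * \<eta>"
proof (cases T)
  case 0
  then show ?thesis using kap_eta by (simp add: base_0)
next
  case (Suc k)
  have "base T \<le> 2 * \<eta>" using base_le[of T] kap_eta by linarith
  also have "\<dots> \<le> (real T + 1) * \<eta>" using eta_pos Suc by (intro mult_right_mono) auto
  finally show ?thesis .
qed

lemma base_half: "base T \<le> 1 / 2"
  using base_le[of T] kap_eta eta_le by linarith

text \<open>One fresh tail is enough here. The second claim needs no expansion: the meeting
  probability and \<open>base T\<close> both lie between 0 and
  \<open>(T + 1) * \<eta>\<close>.\<close>

lemma cmeet_crude:
  assumes "valid \<rho>" "e \<in> A" "e' \<in> A" "e \<noteq> e'" "e \<notin> dom \<rho> \<or> e' \<notin> dom \<rho>"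
    and "card (dom \<rho>) + 2 * Suc T \<le> R"
  shows "cmeet \<rho> (Suc T) e e' \<le> (real T + 1) * \<eta>"
    and "\<bar>cmeet \<rho> (Suc T) e e' - base T\<bar> \<le> (real T + 1) * \<eta>"
proof -
  show *: "cmeet \<rho> (Suc T) e e' \<le> (real T + 1) * \<eta>"
  proof (cases "e' \<in> dom \<rho>")
    case False
    then show ?thesis using cmeet_distinct[of \<rho> e e' "Suc T"] assms by (simp add: add.commute)
  next
    case True
    then show ?thesis using cmeet_distinct[of \<rho> e' e "Suc T"] assms
      by (simp add: add.commute cmeet_commute)
  qed
  show "\<bar>cmeet \<rho> (Suc T) e e' - base T\<bar> \<le> (real T + 1) * \<eta>"
    using * cmeet_nonneg[of \<rho> "Suc T" e e'] base_nonneg[of T] base_eta[of T] by linarith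
qed

text \<open>The common arc ends at a fresh vertex, where the walkers stay together with probability
  \<open>1 / dout\<close>, which averages to \<open>rr\<close>. Each step costs three errors of size
  at most \<open>\<eta>\<close>: a visited vertex, the revealed heads missing from that average, and
  the increment \<open>coal * rr ^ T\<close> of \<open>base\<close>.\<close>

lemma cmeet_diag:
  assumes "valid \<rho>" "e \<in> A" "e \<notin> dom \<rho>" "card (dom \<rho>) + 2 * Suc T \<le> R"
  shows "\<bar>cmeet \<rho> (Suc T) e e - (base T + rr ^ T)\<bar> \<le> 3 * (real T + 1) * \<eta>"
  using assms
proof (induction T arbitrary: \<rho> e)
  case 0
  then show ?case using cmeet_diag_1[of \<rho> e] kap_eta kap_nonneg eta_pos by (simp add: base_0)
next
  case (Suc T)
  define Z where "Z = insert (fst e) (fst ` dom \<rho>)"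
  let ?M = "real (card (B - ran \<rho>))"
  have r: "card (dom \<rho>) \<le> R" using Suc.prems by simp
  have known: "cmeet (\<rho>(e \<mapsto> f)) (Suc (Suc T)) e e = cvmeet (\<rho>(e \<mapsto> f)) (Suc T) (fst f) (fst f)" for f
    by (rule cmeet_Suc_known) auto
  have 1: "\<bar>cmeet \<rho> (Suc (Suc T)) e e - (\<Sum>f\<in>B - ran \<rho>. base T + rr ^ T / real (dout (fst f))) / ?M\<bar>
     \<le> 3 * (real T + 1) * \<eta> + \<eta> * 1"
    unfolding cmeet_reveal[OF Suc.prems(1-3), of "Suc (Suc T)"] known
  proof (rule mean_free_abs[OF Suc.prems(1) r, of Z])
    show "finite Z" "card Z \<le> R + 2" using card_Z(1)[OF Suc.prems(1), of "fst e"] card_Z(3)[OF Suc.prems(1)] r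
      by (auto simp: Z_def)
  next
    fix f assume f: "f \<in> B - ran \<rho>" "fst f \<notin> Z"
    have v': "valid (\<rho>(e \<mapsto> f))" by (rule valid_upd[OF Suc.prems(1-3) f(1)])
    have nd: "(fst f, k) \<notin> dom (\<rho>(e \<mapsto> f))" for k
      using f(2) by (intro notin_dom_upd) (auto simp: Z_def)
    have c: "card (dom (\<rho>(e \<mapsto> f))) + 2 * Suc T \<le> R"
      using card_dom_upd[OF Suc.prems(1,3)] Suc.prems(4) by simp
    show "\<bar>cvmeet (\<rho>(e \<mapsto> f)) (Suc T) (fst f) (fst f) - (base T + rr ^ T / real (dout (fst f)))\<bar>
        \<le> 3 * (real T + 1) * \<eta>"
    proof (rule cvmeet_diag_abs)
      show "fst f < n" using f fst_B by auto
    next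
      fix k assume "(fst f, k) \<in> A"
      then show "\<bar>cmeet (\<rho>(e \<mapsto> f)) (Suc T) (fst f, k) (fst f, k) - (base T + rr ^ T)\<bar> \<le> 3 * (real T + 1) * \<eta>"
        using Suc.IH[OF v' _ nd c] by blast
    next
      fix k k' assume k: "(fst f, k) \<in> A" "(fst f, k') \<in> A" "k \<noteq> k'"
      have "\<bar>cmeet (\<rho>(e \<mapsto> f)) (Suc T) (fst f, k) (fst f, k') - base T\<bar> \<le> (real T + 1) * \<eta>"
        by (rule cmeet_crude(2)[OF v' k(1,2) _ _ c]) (use k(3) nd in auto)
      also have "\<dots> \<le> 3 * (real T + 1) * \<eta>" using eta_pos by simp
      finally show "\<bar>cmeet (\<rho>(e \<mapsto> f)) (Suc T) (fst f, k) (fst f, k') - base T\<bar> \<le> 3 * (real T + 1) * \<eta>" .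
    qed
  next
    fix f assume f: "f \<in> B - ran \<rho>"
    then have v: "fst f < n" using fst_B by auto
    have v': "valid (\<rho>(e \<mapsto> f))" by (rule valid_upd[OF Suc.prems(1-3) f(1)])
    have "rr ^ T / real (dout (fst f)) \<le> 1 / 2"
      using dout_ge[OF v] power_rr_le_1[of T] by (intro frac_le) auto
    moreover have "0 \<le> rr ^ T / real (dout (fst f))" using varrho_nonneg by simp
    ultimately have "\<bar>cvmeet (\<rho>(e \<mapsto> f)) (Suc T) (fst f) (fst f) - (base T + rr ^ T / real (dout (fst f)))\<bar> \<le> 1"
      using cvmeet_nonneg[of "\<rho>(e \<mapsto> f)" "Suc T" "fst f" "fst f"] cvmeet_le_1[OF v' v v, of "Suc T"]
        base_half[of T] base_nonneg[of T] by linarith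
    then show "\<bar>cvmeet (\<rho>(e \<mapsto> f)) (Suc T) (fst f) (fst f) - (base T + rr ^ T / real (dout (fst f)))\<bar>
        \<le> 3 * (real T + 1) * \<eta> + 1" using eta_pos by (simp add: add_increasing)
  qed simp
  have 2: "(\<Sum>f\<in>B - ran \<rho>. base T + rr ^ T / real (dout (fst f))) / ?M
     = base T + rr ^ T * ((\<Sum>f\<in>B - ran \<rho>. 1 / real (dout (fst f))) / ?M)"
    using mean_free_const[OF Suc.prems(1) r, of "base T"]
    by (simp add: sum.distrib add_divide_distrib sum_distrib_left)
  have "\<bar>(\<Sum>f\<in>B - ran \<rho>. 1 / real (dout (fst f))) / ?M - rr\<bar> \<le> \<eta>"
    unfolding varrho_heads
  proof (rule mean_free_close[OF Suc.prems(1) r])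
    fix f assume "f \<in> B"
    then have "2 \<le> dout (fst f)" using fst_B dout_ge by blast
    then show "1 / real (dout (fst f)) \<le> 1" by simp
  qed simp
  then have "\<bar>rr ^ T * ((\<Sum>f\<in>B - ran \<rho>. 1 / real (dout (fst f))) / ?M - rr)\<bar> \<le> 1 * \<eta>"
    unfolding abs_mult using power_rr_le_1[of T] varrho_nonneg by (intro mult_mono) auto
  then have 3: "\<bar>rr ^ T * ((\<Sum>f\<in>B - ran \<rho>. 1 / real (dout (fst f))) / ?M) - rr ^ Suc T\<bar> \<le> \<eta>"
    by (simp add: algebra_simps)
  have 4: "0 \<le> coal * rr ^ T" using coal_nonneg varrho_nonneg by simp
  have 5: "coal * rr ^ T \<le> \<eta> * 1"
    by (rule mult_mono) (use varrho_nonneg coal_eta power_rr_le_1[of T] eta_pos in auto)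
  show ?case
    using 1 3 4 5 unfolding 2 base_Suc by (simp add: algebra_simps)
qed

lemma eta_m: "1 / real m \<le> \<eta>" "(real R + 1) / real m \<le> \<eta>"
proof -
  have "1 * (real R + 1) \<le> real \<Delta> * (real R + 3)" using Delta_ge by (intro mult_mono) auto
  then have *: "real R + 1 \<le> \<eta> * real m" using eta_mult_ge[of "real m"] by simp
  then show "(real R + 1) / real m \<le> \<eta>" using m_pos by (simp add: divide_le_eq)
  show "1 / real m \<le> \<eta>" using * m_pos by (simp add: divide_le_eq)
qed

text \<open>A head shares its vertex with fewer than \<open>\<Delta>\<close> others, so such pairs
  have frequency \<open>O(1 / m)\<close>. Removing at most \<open>R\<close> heads changes this by a
  relative amount of order \<open>R / m\<close>, hence only to second order.\<close>

lemma same_pairs_close: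
  assumes v: "valid \<rho>" "card (dom \<rho>) \<le> R"
    and C: "\<And>v. v < n \<Longrightarrow> 0 \<le> C v" "\<And>v. v < n \<Longrightarrow> C v \<le> 1"
  defines "M \<equiv> real (card (B - ran \<rho>))"
  shows "\<bar>(\<Sum>f\<in>B - ran \<rho>. \<Sum>f'\<in>B - ran \<rho> - {f}. of_bool (fst f = fst f') * C (fst f)) / (M * (M - 1))
     - (\<Sum>v<n. real (din v) * (real (din v) - 1) * C v) / (real m)\<^sup>2\<bar> \<le> 4 * \<eta>\<^sup>2"
proof -
  let ?F = "B - ran \<rho>"
  let ?c = "\<lambda>f f'. of_bool (fst f = fst f') * C (fst f)"
  let ?r = "real (card (dom \<rho>))"
  let ?D = "real \<Delta> * (real R + 3)"
  have M: "real m - real R - 1 \<le> M - 1" "0 < M - 1" "M = real m - ?r"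
    using card_free[OF v(1)] v(2) R_less by (auto simp: M_def)
  have eM: "?D \<le> \<eta> * (M - 1)" using eta_mult_ge[OF M(1)] .
  have D0: "0 \<le> ?D" by simp
  have rB: "ran \<rho> \<subseteq> B" using v by (simp add: valid_def)
  have frB: "finite (ran \<rho>)" by (rule valid_finite_ran[OF v(1)])
  define SB where "SB = (\<Sum>f\<in>B. \<Sum>f'\<in>B - {f}. ?c f f')"
  define SF where "SF = (\<Sum>f\<in>?F. \<Sum>f'\<in>?F - {f}. ?c f f')"
  have c0: "0 \<le> ?c f f'" if "f \<in> B" for f f' using C(1) fst_B[OF that] by simp
  have c1: "?c f f' \<le> of_bool (fst f = fst f')" if "f \<in> B" for f f'
    using C(2) fst_B[OF that] by simp
  have row: "(\<Sum>f'\<in>G. ?c f f') \<le> real \<Delta>" if "f \<in> B" "G \<subseteq> B" for f G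
    using sum_mono[of G "?c f" "\<lambda>f'. of_bool (fst f = fst f')"] c1[OF that(1)] row_same[OF that(2), of f] by force
  have SB0: "0 \<le> SB" unfolding SB_def by (intro sum_nonneg c0) auto
  have SF0: "0 \<le> SF" unfolding SF_def by (intro sum_nonneg c0) auto
  have "SB \<le> (\<Sum>f\<in>B. real \<Delta>)" unfolding SB_def by (intro sum_mono row) auto
  then have SBle: "SB \<le> real m * real \<Delta>" by (simp add: card_B)
  have split: "SB = (\<Sum>f\<in>?F. \<Sum>f'\<in>B - {f}. ?c f f') + (\<Sum>f\<in>ran \<rho>. \<Sum>f'\<in>B - {f}. ?c f f')"
    unfolding SB_def using rB by (intro sum.subset_diff) auto
  have "(\<Sum>f\<in>ran \<rho>. \<Sum>f'\<in>B - {f}. ?c f f') \<le> (\<Sum>f\<in>ran \<rho>. real \<Delta>)"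
    using rB by (intro sum_mono row) auto
  then have t1: "(\<Sum>f\<in>ran \<rho>. \<Sum>f'\<in>B - {f}. ?c f f') \<le> ?r * real \<Delta>"
    by (simp add: valid_ran_card[OF v(1)])
  have t1': "0 \<le> (\<Sum>f\<in>ran \<rho>. \<Sum>f'\<in>B - {f}. ?c f f')"
    using rB by (intro sum_nonneg c0) auto
  have "(\<Sum>f\<in>?F. \<Sum>f'\<in>B - {f}. ?c f f') = (\<Sum>f\<in>?F. (\<Sum>f'\<in>?F - {f}. ?c f f') + (\<Sum>f'\<in>ran \<rho>. ?c f f'))"
  proof (rule sum.cong)
    fix f assume f: "f \<in> ?F"
    have "B - {f} = (?F - {f}) \<union> ran \<rho>" using f rB by auto
    show "(\<Sum>f'\<in>B - {f}. ?c f f') = (\<Sum>f'\<in>?F - {f}. ?c f f') + (\<Sum>f'\<in>ran \<rho>. ?c f f')"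
      unfolding \<open>B - {f} = (?F - {f}) \<union> ran \<rho>\<close>
      by (rule sum.union_disjoint) (use frB in auto)
  qed simp
  then have split2: "(\<Sum>f\<in>?F. \<Sum>f'\<in>B - {f}. ?c f f') = SF + (\<Sum>f\<in>?F. \<Sum>f'\<in>ran \<rho>. ?c f f')"
    by (simp add: sum.distrib SF_def)
  have "(\<Sum>f\<in>?F. \<Sum>f'\<in>ran \<rho>. ?c f f') \<le> (\<Sum>f\<in>?F. \<Sum>f'\<in>ran \<rho>. of_bool (fst f' = fst f))"
    by (intro sum_mono order_trans[OF c1]) auto
  also have "\<dots> = (\<Sum>f'\<in>ran \<rho>. \<Sum>f\<in>?F. of_bool (fst f' = fst f))" by (rule sum.swap)
  also have "\<dots> \<le> (\<Sum>f'\<in>ran \<rho>. real \<Delta>)" by (intro sum_mono row_same) auto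
  finally have t2: "(\<Sum>f\<in>?F. \<Sum>f'\<in>ran \<rho>. ?c f f') \<le> ?r * real \<Delta>"
    by (simp add: valid_ran_card[OF v(1)])
  have t2': "0 \<le> (\<Sum>f\<in>?F. \<Sum>f'\<in>ran \<rho>. ?c f f')"
    by (intro sum_nonneg c0) auto
  have diff: "SF \<le> SB" "SB - SF \<le> 2 * ?r * real \<Delta>"
    using split split2 t1 t1' t2 t2' by linarith+
  have MM: "0 < M * (M - 1)" "M * (M - 1) \<le> (real m)\<^sup>2" "(M - 1)\<^sup>2 \<le> M * (M - 1)"
    using M by (auto simp: power2_eq_square intro!: mult_mono)
  have D2: "?D * ?D \<le> \<eta>\<^sup>2 * (M * (M - 1))"
  proof -
    have "?D * ?D \<le> (\<eta> * (M - 1)) * (\<eta> * (M - 1))"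
      by (rule mult_mono[OF eM eM]) (use D0 eta_pos M(2) in auto)
    also have "\<dots> = \<eta>\<^sup>2 * (M - 1)\<^sup>2" by (simp add: power2_eq_square)
    also have "\<dots> \<le> \<eta>\<^sup>2 * (M * (M - 1))" using MM by (intro mult_left_mono) auto
    finally show ?thesis .
  qed
  have rD: "(?r + 1) * real \<Delta> \<le> ?D" using v(2) mult_left_mono[of "?r + 1" "real R + 3" "real \<Delta>"] by (simp add: mult.commute)
  \<comment> \<open>This turns a bound linear in \<open>?D\<close> into one in
    \<open>?D * ?D\<close>, which \<open>D2\<close> compares with \<open>\<eta>^2\<close>.\<close>
  have "1 \<le> ?D" using mult_mono[of 1 "real \<Delta>" 1 "real R + 3"] Delta_ge by simp
  then have DD: "?D \<le> ?D * ?D" using D0 mult_left_mono[of 1 ?D ?D] by simp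
  have small: "2 * ((?r + 1) * real \<Delta>) \<le> (4 * \<eta>\<^sup>2) * (M * (M - 1))"
    using rD DD D2 D0 by linarith
  have up: "SF / (M * (M - 1)) - SB / (real m)\<^sup>2 \<le> 4 * \<eta>\<^sup>2"
  proof -
    have "SF / (M * (M - 1)) - SB / (real m)\<^sup>2 \<le> SB / (M * (M - 1)) - SB / (real m)\<^sup>2"
      using diff MM by (intro diff_right_mono divide_right_mono) auto
    also have "\<dots> = (SB * (real m)\<^sup>2 - SB * (M * (M - 1))) / ((M * (M - 1)) * (real m)\<^sup>2)"
      using MM m_pos by (intro diff_frac_eq) auto
    also have "\<dots> = (SB * ((real m)\<^sup>2 - M * (M - 1))) / ((M * (M - 1)) * (real m)\<^sup>2)"
      by (simp add: algebra_simps)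
    also have "\<dots> \<le> ((real m * real \<Delta>) * (2 * real m * (?r + 1))) / ((M * (M - 1)) * (real m)\<^sup>2)"
    proof (intro divide_right_mono mult_mono SBle)
      have "(real m)\<^sup>2 - M * (M - 1) = real m * (2 * ?r + 1) - ?r * (?r + 1)"
        unfolding M(3) by (simp add: power2_eq_square algebra_simps)
      also have "\<dots> \<le> real m * (2 * ?r + 1)" by simp
      also have "\<dots> \<le> 2 * real m * (?r + 1)" by (simp add: algebra_simps)
      finally show "(real m)\<^sup>2 - M * (M - 1) \<le> 2 * real m * (?r + 1)" .
    qed (use MM in auto)
    also have "(real m * real \<Delta>) * (2 * real m * (?r + 1)) = (2 * ((?r + 1) * real \<Delta>)) * (real m)\<^sup>2"
      by (simp add: power2_eq_square algebra_simps)
    also have "(2 * ((?r + 1) * real \<Delta>)) * (real m)\<^sup>2 / ((M * (M - 1)) * (real m)\<^sup>2) = (2 * ((?r + 1) * real \<Delta>)) / (M * (M - 1))"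
      using m_pos by (intro mult_divide_mult_cancel_right) simp
    also have "\<dots> \<le> 4 * \<eta>\<^sup>2"
      using small MM(1) by (simp add: divide_le_eq)
    finally show ?thesis .
  qed
  have lo: "SB / (real m)\<^sup>2 - SF / (M * (M - 1)) \<le> 4 * \<eta>\<^sup>2"
  proof -
    have "SF / (real m)\<^sup>2 \<le> SF / (M * (M - 1))"
      using SF0 MM m_pos by (intro divide_left_mono) auto
    then have "SB / (real m)\<^sup>2 - SF / (M * (M - 1)) \<le> (SB - SF) / (real m)\<^sup>2"
      by (simp add: diff_divide_distrib)
    also have "\<dots> \<le> (2 * ((?r + 1) * real \<Delta>)) / (real m)\<^sup>2"
      using diff(2) by (intro divide_right_mono) (auto simp: algebra_simps)
    also have "\<dots> \<le> (2 * ((?r + 1) * real \<Delta>)) / (M * (M - 1))"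
      using MM m_pos by (intro divide_left_mono) auto
    also have "\<dots> \<le> 4 * \<eta>\<^sup>2"
      using small MM(1) by (simp add: divide_le_eq)
    finally show ?thesis .
  qed
  show ?thesis
    using up lo unfolding SF_def SB_def sum_same_heads by linarith
qed

text \<open>Two arcs revealed in turn: \<open>Z\<close> is the set of visited vertices, \<open>x1\<close> bounds the error for two fresh
  distinct vertices, \<open>x2\<close> that for a collision at a fresh vertex (probability at most \<open>\<eta>\<close>), \<open>x3\<close> that for
  one visited vertex (probability at most \<open>2 * \<eta>\<close>).\<close>
lemma pair_mean_close:
  assumes v: "valid \<rho>" "card (dom \<rho>) \<le> R" and Z: "finite Z" "card Z \<le> R + 2"
    and C: "\<And>v. v < n \<Longrightarrow> 0 \<le> C v" "\<And>v. v < n \<Longrightarrow> C v \<le> 1"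
    and x: "0 \<le> x1" "0 \<le> x2" "0 \<le> x3"
  defines "F \<equiv> B - ran \<rho>"
  assumes X1: "\<And>f f'. \<lbrakk>f \<in> F; f' \<in> F - {f}; fst f \<noteq> fst f'; fst f \<notin> Z; fst f' \<notin> Z\<rbrakk> \<Longrightarrow> \<bar>X f f' - b\<bar> \<le> x1"
    and X2: "\<And>f f'. \<lbrakk>f \<in> F; f' \<in> F - {f}; fst f = fst f'; fst f \<notin> Z\<rbrakk> \<Longrightarrow> \<bar>X f f' - (b + C (fst f))\<bar> \<le> x2"
    and X3: "\<And>f f'. \<lbrakk>f \<in> F; f' \<in> F - {f}; fst f \<noteq> fst f'; fst f \<notin> Z \<or> fst f' \<notin> Z\<rbrakk> \<Longrightarrow> \<bar>X f f' - b\<bar> \<le> x3"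
    and X4: "\<And>f f'. \<lbrakk>f \<in> F; f' \<in> F - {f}\<rbrakk> \<Longrightarrow> \<bar>X f f' - b\<bar> \<le> 1"
  shows "\<bar>(\<Sum>f\<in>F. (\<Sum>f'\<in>F - {f}. X f f') / real (card (F - {f}))) / real (card F)
     - (b + (\<Sum>v<n. real (din v) * (real (din v) - 1) * C v) / (real m)\<^sup>2)\<bar>
     \<le> x1 + \<eta> * x2 + 2 * \<eta> * x3 + 6 * \<eta>\<^sup>2"
proof -
  define M where "M = real (card F)"
  define D where "D = real \<Delta> * real (card Z)"
  have M: "real m - real R - 1 \<le> M - 1" "0 < M - 1"
    using card_free[OF v(1)] v(2) R_less by (auto simp: M_def F_def)
  have finF: "finite F" by (simp add: F_def)
  have FB: "F \<subseteq> B" by (auto simp: F_def)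
  have cF: "real (card (F - {f})) = M - 1" if "f \<in> F" for f
  proof -
    have "0 < card F" using that finF by (auto simp: card_gt_0_iff)
    then show ?thesis using that finF by (simp add: M_def of_nat_diff)
  qed
  have eD: "D \<le> \<eta> * (M - 1)" unfolding D_def by (rule eta_card[OF Z(2) M(1)])
  have eDel: "real \<Delta> \<le> \<eta> * (M - 1)"
  proof -
    have "real \<Delta> * 1 \<le> real \<Delta> * (real R + 3)" by (intro mult_left_mono) auto
    then show ?thesis using eta_mult_ge[OF M(1)] by simp
  qed
  have D0: "0 \<le> D" by (simp add: D_def)
  define z where "z f = (of_bool (fst f \<in> Z) :: real)" for f :: "nat \<times> nat"
  define same where "same f f' = (of_bool (fst f = fst f') :: real)" for f f' :: "nat \<times> nat"
  define Y where "Y f f' = X f f' - b - same f f' * C (fst f)" for f f'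
  have z01: "0 \<le> z f" "z f \<le> 1" for f by (auto simp: z_def)
  \<comment> \<open>The last term is the case of two visited vertices: only the trivial bound 2 (1
    from \<open>X4\<close>, 1 from \<open>C\<close>) is available, but its weight is at most
    \<open>\<eta>^2\<close>. With \<open>4 * \<eta>^2\<close> from \<open>same_pairs_close\<close>
    this makes the final \<open>6 * \<eta>^2\<close>.\<close>
  have Yb: "\<bar>Y f f'\<bar> \<le> x1 + x2 * same f f' + x3 * (z f + z f') + 2 * (z f * z f')"
    if f: "f \<in> F" "f' \<in> F - {f}" for f f'
  proof -
    have vn: "fst f < n" using f FB fst_B by blast
    show ?thesis
    proof (cases "fst f = fst f'")
      case True
      show ?thesis
      proof (cases "fst f \<in> Z")
        case False
        then show ?thesis using X2[OF f True False] x True by (simp add: Y_def same_def z_def diff_diff_eq)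
      next
        case zz: True
        have "\<bar>Y f f'\<bar> \<le> 2" using X4[OF f] C[OF vn] True by (simp add: Y_def same_def abs_le_iff)
        then show ?thesis using True zz x by (simp add: same_def z_def)
      qed
    next
      case False
      show ?thesis
      proof (cases "fst f \<notin> Z \<or> fst f' \<notin> Z")
        case True
        then show ?thesis using X1[OF f False] X3[OF f False] x False
          by (cases "fst f \<in> Z"; cases "fst f' \<in> Z") (simp_all add: Y_def same_def z_def)
      next
        case zz: False
        then show ?thesis using X4[OF f] False x by (simp add: Y_def same_def z_def)
      qed
    qed
  qed
  have zsum: "(\<Sum>f\<in>G. z f) \<le> D" if "G \<subseteq> B" for G
    unfolding z_def D_def by (rule sum_heads_at[OF Z(1) that])
  have inner: "(\<Sum>f'\<in>F - {f}. \<bar>Y f f'\<bar>) / (M - 1) \<le> x1 + \<eta> * x2 + \<eta> * x3 + (x3 + 2 * \<eta>) * z f"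
    if f: "f \<in> F" for f
  proof -
    have "(\<Sum>f'\<in>F - {f}. \<bar>Y f f'\<bar>)
       \<le> (\<Sum>f'\<in>F - {f}. (x1 + x3 * z f) + x2 * same f f' + (x3 + 2 * z f) * z f')"
      by (intro sum_mono order_trans[OF Yb[OF f]]) (auto simp: algebra_simps)
    also have "\<dots> = (M - 1) * (x1 + x3 * z f) + x2 * (\<Sum>f'\<in>F - {f}. same f f') + (x3 + 2 * z f) * (\<Sum>f'\<in>F - {f}. z f')"
      by (simp add: sum.distrib sum_distrib_left[symmetric] cF[OF f])
    also have "\<dots> \<le> (M - 1) * (x1 + x3 * z f) + x2 * (\<eta> * (M - 1)) + (x3 + 2 * z f) * (\<eta> * (M - 1))"
    proof (intro add_mono mult_left_mono order_refl)
      show "(\<Sum>f'\<in>F - {f}. same f f') \<le> \<eta> * (M - 1)"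
        unfolding same_def using row_same[of "F - {f}" f] FB eDel by fastforce
      show "(\<Sum>f'\<in>F - {f}. z f') \<le> \<eta> * (M - 1)"
        using zsum[of "F - {f}"] FB eD by fastforce
    qed (use x z01[of f] M(2) in auto)
    also have "\<dots> = (x1 + \<eta> * x2 + \<eta> * x3 + (x3 + 2 * \<eta>) * z f) * (M - 1)"
      by (simp add: algebra_simps)
    finally show ?thesis using M(2) by (simp add: divide_le_eq)
  qed
  have outer: "(\<Sum>f\<in>F. (\<Sum>f'\<in>F - {f}. \<bar>Y f f'\<bar>) / (M - 1)) / M \<le> x1 + \<eta> * x2 + 2 * \<eta> * x3 + 2 * \<eta>\<^sup>2"
  proof -
    have "(\<Sum>f\<in>F. (\<Sum>f'\<in>F - {f}. \<bar>Y f f'\<bar>) / (M - 1)) \<le> (\<Sum>f\<in>F. (x1 + \<eta> * x2 + \<eta> * x3) + (x3 + 2 * \<eta>) * z f)"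
      by (intro sum_mono) (use inner in auto)
    also have "\<dots> = M * (x1 + \<eta> * x2 + \<eta> * x3) + (x3 + 2 * \<eta>) * (\<Sum>f\<in>F. z f)"
      by (simp add: sum.distrib sum_distrib_left[symmetric] M_def)
    also have "\<dots> \<le> M * (x1 + \<eta> * x2 + \<eta> * x3) + (x3 + 2 * \<eta>) * (\<eta> * M)"
    proof (intro add_mono mult_left_mono order_refl)
      have "\<eta> * (M - 1) \<le> \<eta> * M" using eta_pos by simp
      then show "(\<Sum>f\<in>F. z f) \<le> \<eta> * M" using zsum[OF FB] eD by linarith
    qed (use x eta_pos M(2) in auto)
    also have "\<dots> = (x1 + \<eta> * x2 + 2 * \<eta> * x3 + 2 * \<eta>\<^sup>2) * M"
      by (simp add: algebra_simps power2_eq_square)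
    finally show ?thesis using M(2) by (simp add: divide_le_eq)
  qed
  have "(\<Sum>f\<in>F. (\<Sum>f'\<in>F - {f}. X f f') / real (card (F - {f}))) / real (card F)
     = (\<Sum>f\<in>F. (\<Sum>f'\<in>F - {f}. Y f f' + b + same f f' * C (fst f)) / (M - 1)) / M"
    by (simp add: cF Y_def M_def[symmetric] del: card_Diff_insert card_Diff_singleton card_Diff_singleton_if)
  also have "\<dots> = (\<Sum>f\<in>F. (\<Sum>f'\<in>F - {f}. Y f f') / (M - 1) + b + (\<Sum>f'\<in>F - {f}. same f f' * C (fst f)) / (M - 1)) / M"
    using M(2) by (intro arg_cong[of _ _ "\<lambda>x. x / M"] sum.cong)
      (simp_all add: sum.distrib add_divide_distrib cF del: card_Diff_insert card_Diff_singleton card_Diff_singleton_if)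
  also have "\<dots> = (\<Sum>f\<in>F. (\<Sum>f'\<in>F - {f}. Y f f') / (M - 1)) / M + b
      + (\<Sum>f\<in>F. \<Sum>f'\<in>F - {f}. same f f' * C (fst f)) / (M * (M - 1))"
    using M(2) by (simp add: sum.distrib add_divide_distrib sum_divide_distrib[symmetric] M_def[symmetric] mult.commute)
  finally have eq: "(\<Sum>f\<in>F. (\<Sum>f'\<in>F - {f}. X f f') / real (card (F - {f}))) / real (card F)
     = (\<Sum>f\<in>F. (\<Sum>f'\<in>F - {f}. Y f f') / (M - 1)) / M + b
      + (\<Sum>f\<in>F. \<Sum>f'\<in>F - {f}. same f f' * C (fst f)) / (M * (M - 1))" .
  have "\<bar>(\<Sum>f\<in>F. (\<Sum>f'\<in>F - {f}. Y f f') / (M - 1)) / M\<bar> \<le> (\<Sum>f\<in>F. (\<Sum>f'\<in>F - {f}. \<bar>Y f f'\<bar>) / (M - 1)) / M"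
  proof -
    have "\<bar>\<Sum>f\<in>F. (\<Sum>f'\<in>F - {f}. Y f f') / (M - 1)\<bar> \<le> (\<Sum>f\<in>F. (\<Sum>f'\<in>F - {f}. \<bar>Y f f'\<bar>) / (M - 1))"
    proof (rule order_trans[OF sum_abs], rule sum_mono)
      fix f
      show "\<bar>(\<Sum>f'\<in>F - {f}. Y f f') / (M - 1)\<bar> \<le> (\<Sum>f'\<in>F - {f}. \<bar>Y f f'\<bar>) / (M - 1)"
        using M(2) by (simp add: abs_divide divide_right_mono sum_abs)
    qed
    then show ?thesis using M(2) by (simp add: abs_divide divide_right_mono)
  qed
  then have 1: "\<bar>(\<Sum>f\<in>F. (\<Sum>f'\<in>F - {f}. Y f f') / (M - 1)) / M\<bar> \<le> x1 + \<eta> * x2 + 2 * \<eta> * x3 + 2 * \<eta>\<^sup>2"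
    using outer by linarith
  have 2: "\<bar>(\<Sum>f\<in>F. \<Sum>f'\<in>F - {f}. same f f' * C (fst f)) / (M * (M - 1))
     - (\<Sum>v<n. real (din v) * (real (din v) - 1) * C v) / (real m)\<^sup>2\<bar> \<le> 4 * \<eta>\<^sup>2"
    using same_pairs_close[OF v C] unfolding same_def F_def M_def by simp
  show ?thesis unfolding eq using 1 2 by linarith
qed

lemma cmeet_reveal2:
  assumes v: "valid \<rho>" and e: "e \<in> A" "e' \<in> A" "e \<noteq> e'" "e \<notin> dom \<rho>" "e' \<notin> dom \<rho>"
  defines "F \<equiv> B - ran \<rho>"
  shows "cmeet \<rho> T x y = (\<Sum>f\<in>F. (\<Sum>f'\<in>F - {f}. cmeet (\<rho>(e \<mapsto> f, e' \<mapsto> f')) T x y)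
      / real (card (F - {f}))) / real (card F)"
proof -
  have "cmeet (\<rho>(e \<mapsto> f)) T x y = (\<Sum>f'\<in>F - {f}. cmeet (\<rho>(e \<mapsto> f, e' \<mapsto> f')) T x y) / real (card (F - {f}))"
    if "f \<in> F" for f
  proof -
    have "ran (\<rho>(e \<mapsto> f)) = insert f (ran \<rho>)" using e by (simp add: domIff)
    then have r: "B - ran (\<rho>(e \<mapsto> f)) = F - {f}" by (auto simp: F_def)
    have "valid (\<rho>(e \<mapsto> f))" using valid_upd[OF v e(1,4)] that by (simp add: F_def)
    then show ?thesis
      using cmeet_reveal[of "\<rho>(e \<mapsto> f)" e' T x y] e unfolding r by simp
  qed
  then show ?thesis
    unfolding cmeet_reveal[OF v e(1,4)] F_def[symmetric] by simp
qed

text \<open>After both arcs are revealed, distinct fresh vertices reproduce the claim for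
  \<open>T\<close>. A collision at a fresh vertex contributes \<open>coal * rr ^ T\<close>, exactly
  the increment of \<open>base\<close>, with the error of \<open>cmeet_diag\<close> damped by
  \<open>\<eta>\<close>; a single visited vertex costs the error of \<open>cmeet_crude\<close>,
  damped by \<open>2 * \<eta>\<close>. Going from \<open>T\<close> to \<open>Suc T\<close> adds
  \<open>(5 * T + 11) * \<eta>^2\<close>, which the quadratic bound absorbs.\<close>

lemma cmeet_offdiag:
  assumes "valid \<rho>" "e \<in> A" "e' \<in> A" "e \<noteq> e'" "e \<notin> dom \<rho>" "e' \<notin> dom \<rho>"
    "card (dom \<rho>) + 2 * Suc T \<le> R"
  shows "\<bar>cmeet \<rho> (Suc T) e e' - base T\<bar> \<le> 11 * (real T + 1)\<^sup>2 * \<eta>\<^sup>2"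
  using assms
proof (induction T arbitrary: \<rho> e e')
  case (0 \<rho> e e')
  note p = 0
  define F where "F = B - ran \<rho>"
  have r: "card (dom \<rho>) \<le> R" using p by simp
  let ?u = "\<lambda>f f'. \<rho>(e \<mapsto> f, e' \<mapsto> f')"
  have known: "cmeet (?u f f') (Suc 0) e e' = cvmeet (?u f f') 0 (fst f) (fst f')" for f f'
    by (rule cmeet_Suc_known) (use p in auto)
  have val: "cvmeet (?u f f') 0 (fst f) (fst f') = of_bool (fst f = fst f')"
    if f: "f \<in> F" "f' \<in> F - {f}" for f f'
  proof -
    have v: "fst f < n" "fst f' < n" using f fst_B by (auto simp: F_def)
    have va: "valid (\<rho>(e \<mapsto> f))" using valid_upd[OF p(1,2,5)] f by (simp add: F_def)
    have "ran (\<rho>(e \<mapsto> f)) = insert f (ran \<rho>)" using p by (simp add: domIff)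
    then have va2: "valid (?u f f')" using valid_upd[OF va p(3), of f'] p f by (auto simp: F_def)
    have "meet 0 (fst f, k) (fst f', k') = (\<lambda>_. of_bool (fst f = fst f'))" for k k'
    proof
      fix \<omega>
      have "meet 0 (fst f, k) (fst f', k') \<omega> = (\<Sum>j<n. if j = fst f then of_bool (fst f = fst f') else 0)"
        unfolding meet_def by (intro sum.cong) auto
      then show "meet 0 (fst f, k) (fst f', k') \<omega> = of_bool (fst f = fst f')" using v by simp
    qed
    then have "\<bar>cmeet (?u f f') 0 (fst f, k) (fst f', k') - of_bool (fst f = fst f')\<bar> \<le> 0" for k k'
      by (simp add: cmeet_def cexp_const[OF va2])
    then have "\<bar>cvmeet (?u f f') 0 (fst f) (fst f') - of_bool (fst f = fst f')\<bar> \<le> 0"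
      by (intro cvmeet_abs[OF v]) auto
    then show ?thesis by simp
  qed
  have val2: "cvmeet (?u f f') 0 (fst f') (fst f') = 1"
    if "f \<in> F" "f' \<in> F" "f' \<noteq> f" "fst f = fst f'" for f f'
    using val[of f f'] that by simp
  \<comment> \<open>After one step the walkers stand at the two heads, so the value is exactly 0 or
    1. No vertex has to be excepted, hence \<open>Z = {}\<close>.\<close>
  have "\<bar>(\<Sum>f\<in>F. (\<Sum>f'\<in>F - {f}. cvmeet (?u f f') 0 (fst f) (fst f')) / real (card (F - {f}))) / real (card F)
     - (0 + (\<Sum>v<n. real (din v) * (real (din v) - 1) * 1) / (real m)\<^sup>2)\<bar>
     \<le> 0 + \<eta> * 0 + 2 * \<eta> * 0 + 6 * \<eta>\<^sup>2"
    unfolding F_def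
    by (rule pair_mean_close[OF p(1) r, where Z = "{}"], unfold F_def[symmetric])
       (simp_all add: val val2)
  then have "\<bar>cmeet \<rho> (Suc 0) e e' - base 0\<bar> \<le> 6 * \<eta>\<^sup>2"
    unfolding cmeet_reveal2[OF p(1-6)] F_def[symmetric] known by (simp add: base_0 kap_def)
  also have "\<dots> \<le> 11 * (real 0 + 1)\<^sup>2 * \<eta>\<^sup>2" by simp
  finally show ?case .
next
  case (Suc T \<rho> e e')
  note p = Suc.prems
  define F where "F = B - ran \<rho>"
  define Z where "Z = insert (fst e) (insert (fst e') (fst ` dom \<rho>))"
  have r: "card (dom \<rho>) \<le> R" using p by simp
  have Z: "finite Z" "card Z \<le> R + 2"
    using card_Z(2)[OF p(1), of "fst e" "fst e'"] card_Z(3)[OF p(1)] r by (auto simp: Z_def)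
  let ?u = "\<lambda>f f'. \<rho>(e \<mapsto> f, e' \<mapsto> f')"
  have known: "cmeet (?u f f') (Suc (Suc T)) e e' = cvmeet (?u f f') (Suc T) (fst f) (fst f')" for f f'
    by (rule cmeet_Suc_known) (use p in auto)
  have va: "valid (?u f f')" "card (dom (?u f f')) + 2 * Suc T \<le> R"
    if f: "f \<in> F" "f' \<in> F - {f}" for f f'
  proof -
    have va: "valid (\<rho>(e \<mapsto> f))" using valid_upd[OF p(1,2,5)] f by (simp add: F_def)
    have "ran (\<rho>(e \<mapsto> f)) = insert f (ran \<rho>)" using p by (simp add: domIff)
    then show "valid (?u f f')" using valid_upd[OF va p(3), of f'] p f by (auto simp: F_def)
    have "e' \<notin> dom (\<rho>(e \<mapsto> f))" using p by auto
    then show "card (dom (?u f f')) + 2 * Suc T \<le> R"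
      using card_dom_upd[OF va, of e' f'] card_dom_upd[OF p(1,5), of f] p(7) by simp
  qed
  have vn: "fst f < n" if "f \<in> F" for f using that fst_B by (auto simp: F_def)
  have nd: "(v, k) \<notin> dom (?u f f')" if "v \<notin> Z" for v k f f'
  proof -
    have "(v, k) \<notin> dom (\<rho>(e \<mapsto> f))" "(v, k) \<noteq> e'"
      using that notin_dom_upd[of "(v, k)" \<rho> e f] by (auto simp: Z_def simp del: dom_fun_upd)
    then show ?thesis by simp
  qed
  let ?E = "11 * (real T + 1)\<^sup>2 * \<eta>\<^sup>2"
  have "\<bar>(\<Sum>f\<in>F. (\<Sum>f'\<in>F - {f}. cvmeet (?u f f') (Suc T) (fst f) (fst f')) / real (card (F - {f}))) / real (card F)
     - (base T + (\<Sum>v<n. real (din v) * (real (din v) - 1) * (rr ^ T / real (dout v))) / (real m)\<^sup>2)\<bar>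
     \<le> ?E + \<eta> * (3 * (real T + 1) * \<eta>) + 2 * \<eta> * ((real T + 1) * \<eta>) + 6 * \<eta>\<^sup>2"
    unfolding F_def
  proof (rule pair_mean_close[OF p(1) r Z], unfold F_def[symmetric])
    fix v assume v: "v < n"
    show "0 \<le> rr ^ T / real (dout v)" using varrho_nonneg by simp
    have "rr ^ T / real (dout v) \<le> 1 / 1"
      using dout_ge[OF v] power_rr_le_1[of T] by (intro frac_le) auto
    then show "rr ^ T / real (dout v) \<le> 1" by simp
  next
    fix f f' assume f: "f \<in> F" "f' \<in> F - {f}" and d: "fst f \<noteq> fst f'" "fst f \<notin> Z" "fst f' \<notin> Z"
    show "\<bar>cvmeet (?u f f') (Suc T) (fst f) (fst f') - base T\<bar> \<le> ?E"
    proof (rule cvmeet_abs)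
      fix k k' assume k: "(fst f, k) \<in> A" "(fst f', k') \<in> A"
      show "\<bar>cmeet (?u f f') (Suc T) (fst f, k) (fst f', k') - base T\<bar> \<le> ?E"
        by (rule Suc.IH[OF va(1)[OF f] k _ nd nd va(2)[OF f]]) (use d in auto)
    qed (use f vn in auto)
  next
    fix f f' assume f: "f \<in> F" "f' \<in> F - {f}" and d: "fst f = fst f'" "fst f \<notin> Z"
    show "\<bar>cvmeet (?u f f') (Suc T) (fst f) (fst f') - (base T + rr ^ T / real (dout (fst f)))\<bar> \<le> 3 * (real T + 1) * \<eta>"
      unfolding d(1)[symmetric]
    proof (rule cvmeet_diag_abs[OF vn[OF f(1)]])
      fix k assume k: "(fst f, k) \<in> A"
      show "\<bar>cmeet (?u f f') (Suc T) (fst f, k) (fst f, k) - (base T + rr ^ T)\<bar> \<le> 3 * (real T + 1) * \<eta>"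
        by (rule cmeet_diag[OF va(1)[OF f] k nd[OF d(2)] va(2)[OF f]])
    next
      fix k k' assume k: "(fst f, k) \<in> A" "(fst f, k') \<in> A" "k \<noteq> k'"
      have "\<bar>cmeet (?u f f') (Suc T) (fst f, k) (fst f, k') - base T\<bar> \<le> (real T + 1) * \<eta>"
        by (rule cmeet_crude(2)[OF va(1)[OF f] k(1,2) _ _ va(2)[OF f]]) (use k(3) nd[OF d(2)] in auto)
      also have "\<dots> \<le> 3 * (real T + 1) * \<eta>" using eta_pos by simp
      finally show "\<bar>cmeet (?u f f') (Suc T) (fst f, k) (fst f, k') - base T\<bar> \<le> 3 * (real T + 1) * \<eta>" .
    qed
  next
    fix f f' assume f: "f \<in> F" "f' \<in> F - {f}" and d: "fst f \<noteq> fst f'" "fst f \<notin> Z \<or> fst f' \<notin> Z"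
    show "\<bar>cvmeet (?u f f') (Suc T) (fst f) (fst f') - base T\<bar> \<le> (real T + 1) * \<eta>"
    proof (rule cvmeet_abs)
      fix k k' assume k: "(fst f, k) \<in> A" "(fst f', k') \<in> A"
      show "\<bar>cmeet (?u f f') (Suc T) (fst f, k) (fst f', k') - base T\<bar> \<le> (real T + 1) * \<eta>"
        by (rule cmeet_crude(2)[OF va(1)[OF f] k _ _ va(2)[OF f]]) (use d nd in auto)
    qed (use f vn in auto)
  next
    fix f f' assume f: "f \<in> F" "f' \<in> F - {f}"
    show "\<bar>cvmeet (?u f f') (Suc T) (fst f) (fst f') - base T\<bar> \<le> 1"
      using cvmeet_nonneg[of "?u f f'" "Suc T" "fst f" "fst f'"]
        cvmeet_le_1[OF va(1)[OF f] vn vn, of f f' "Suc T"] f base_half[of T] base_nonneg[of T] by auto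
  qed (use eta_pos in auto)
  moreover have "(\<Sum>v<n. real (din v) * (real (din v) - 1) * (rr ^ T / real (dout v))) / (real m)\<^sup>2 = coal * rr ^ T"
    by (simp add: coal_def sum_distrib_right)
  ultimately have "\<bar>cmeet \<rho> (Suc (Suc T)) e e' - base (Suc T)\<bar>
     \<le> ?E + \<eta> * (3 * (real T + 1) * \<eta>) + 2 * \<eta> * ((real T + 1) * \<eta>) + 6 * \<eta>\<^sup>2"
    unfolding cmeet_reveal2[OF p(1-6)] F_def[symmetric] known base_Suc by simp
  also have "\<dots> = (11 * (real T + 1)\<^sup>2 + 5 * real T + 11) * \<eta>\<^sup>2"
    by (simp add: algebra_simps power2_eq_square)
  also have "\<dots> \<le> (11 * (real (Suc T) + 1)\<^sup>2) * \<eta>\<^sup>2"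
    by (intro mult_right_mono) (auto simp: algebra_simps power2_eq_square)
  finally show ?case .
qed

text \<open>With at most one revealed tail per vertex, a walker leaves the revealed arcs with probability at
  least \<open>1 / 2\<close> in each step.\<close>
lemma cmeet_simple:
  assumes "valid \<rho>" "inj_on fst (dom \<rho>)" "e \<in> A" "card (dom \<rho>) + 2 * Suc T \<le> R"
  shows "cmeet \<rho> (Suc T) e e \<le> (1 / 2) ^ T + 6 * (real T + 1) * \<eta>"
  using assms
proof (induction T arbitrary: e)
  case 0
  then show ?case using cmeet_le_1[of \<rho> e e "Suc 0"] eta_pos by simp
next
  case (Suc T)
  show ?case
  proof (cases "e \<in> dom \<rho>")
    case False
    have "\<bar>cmeet \<rho> (Suc (Suc T)) e e - (base (Suc T) + rr ^ Suc T)\<bar> \<le> 3 * (real (Suc T) + 1) * \<eta>"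
      by (rule cmeet_diag[OF Suc.prems(1,3) False Suc.prems(4)])
    moreover have "base (Suc T) \<le> (real (Suc T) + 1) * \<eta>" by (rule base_eta)
    moreover have "rr ^ Suc T \<le> (1 / 2) ^ Suc T" by (rule power_rr_le)
    moreover have "0 \<le> real T * \<eta>" using eta_pos by simp
    ultimately show ?thesis using eta_pos unfolding abs_le_iff by (simp add: algebra_simps)
  next
    case True
    then obtain f where f: "\<rho> e = Some f" by auto
    have "f \<in> B" using ranI[of \<rho> e f, OF f] Suc.prems(1) by (auto simp: valid_def)
    then have v: "fst f < n" by (rule fst_B)
    have "cvmeet \<rho> (Suc T) (fst f) (fst f) \<le> (((1 / 2) ^ T + 6 * (real T + 1) * \<eta>) + (real T + 1) * \<eta>) / 2"
    proof (rule cvmeet_diag_le[OF v])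
      have "(real T + 1) * \<eta> \<le> 6 * (real T + 1) * \<eta>" using eta_pos by simp
      then show "(real T + 1) * \<eta> \<le> (1 / 2) ^ T + 6 * (real T + 1) * \<eta>"
        by (simp add: add_increasing)
    next
      fix k assume "(fst f, k) \<in> A"
      then show "cmeet \<rho> (Suc T) (fst f, k) (fst f, k) \<le> (1 / 2) ^ T + 6 * (real T + 1) * \<eta>"
        using Suc by simp
    next
      fix k k' assume k: "(fst f, k) \<in> A" "(fst f, k') \<in> A" "k \<noteq> k'"
      have "(fst f, k) \<notin> dom \<rho> \<or> (fst f, k') \<notin> dom \<rho>"
        using inj_onD[OF Suc.prems(2), of "(fst f, k)" "(fst f, k')"] k(3) by auto
      then show "cmeet \<rho> (Suc T) (fst f, k) (fst f, k') \<le> (real T + 1) * \<eta>"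
        using cmeet_crude(1)[OF Suc.prems(1) k(1,2)] k(3) Suc.prems(4) by simp
    qed
    moreover have "(7 / 2 * (real T + 1)) * \<eta> \<le> (6 * (real (Suc T) + 1)) * \<eta>"
      using eta_pos by (intro mult_right_mono) auto
    ultimately show ?thesis
      unfolding cmeet_Suc_known[of \<rho> e f e f, OF f f] by (simp add: algebra_simps)
  qed
qed

text \<open>The spread sums this over \<open>m\<close> tails, so the non-decaying error must be
  \<open>O(\<eta>^2)\<close> up to powers of \<open>T\<close>, unlike in \<open>cmeet_diag\<close>;
  an upper bound with \<open>1 / 2\<close> in place of \<open>rr\<close> is enough. A visited
  vertex, of weight \<open>\<eta>\<close>, costs the bound of \<open>cmeet_simple\<close>, whose
  decaying part produces the factor \<open>1 + 2 * T * \<eta>\<close>. The constant solves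
  \<open>34 = 34 / 2 + 11 + 6\<close>: halving per step, \<open>cmeet_offdiag\<close>,
  \<open>cmeet_simple\<close>.\<close>

lemma cmeet_diag_upper:
  assumes "valid \<rho>" "inj_on fst (dom \<rho>)" "e \<in> A" "fst e \<notin> fst ` dom \<rho>" "card (dom \<rho>) + 2 * Suc T \<le> R"
  shows "cmeet \<rho> (Suc T) e e \<le> base T + (1 / 2) ^ T * (1 + 2 * real T * \<eta>) + 34 * (real T + 1)\<^sup>2 * \<eta>\<^sup>2"
  using assms
proof (induction T arbitrary: \<rho> e)
  case 0
  then have "cmeet \<rho> (Suc 0) e e \<le> base 0 + 1"
    using cmeet_le_1[of \<rho> e e "Suc 0"] base_nonneg[of 0] by simp
  also have "\<dots> \<le> base 0 + (1 / 2) ^ 0 * (1 + 2 * real 0 * \<eta>) + 34 * (real 0 + 1)\<^sup>2 * \<eta>\<^sup>2"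
    by simp
  finally show ?case .
next
  case (Suc T)
  note p = Suc.prems
  define Z where "Z = insert (fst e) (fst ` dom \<rho>)"
  have r: "card (dom \<rho>) \<le> R" using p by simp
  have ne: "e \<notin> dom \<rho>" using p by auto
  have known: "cmeet (\<rho>(e \<mapsto> f)) (Suc (Suc T)) e e = cvmeet (\<rho>(e \<mapsto> f)) (Suc T) (fst f) (fst f)" for f
    by (rule cmeet_Suc_known) auto
  define \<theta> where "\<theta> = (1 / 2) ^ T * (1 + 2 * real T * \<eta>) + 34 * (real T + 1)\<^sup>2 * \<eta>\<^sup>2"
  define E where "E = 11 * (real T + 1)\<^sup>2 * \<eta>\<^sup>2"
  define h where "h = (1 / 2) ^ T + 6 * (real T + 1) * \<eta>"
  have th0: "0 \<le> \<theta>" "E \<le> \<theta>" "0 \<le> E" "0 \<le> h"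
    using eta_pos unfolding \<theta>_def E_def h_def
    by (auto intro!: add_nonneg_nonneg mult_nonneg_nonneg add_increasing mult_right_mono)
  have "cmeet \<rho> (Suc (Suc T)) e e \<le> (base T + \<theta> / 2 + E) + \<eta> * h"
    unfolding cmeet_reveal[OF p(1,3) ne, of "Suc (Suc T)"] known
  proof (rule mean_free_le[OF p(1) r, of Z])
    show "finite Z" "card Z \<le> R + 2" using card_Z(1)[OF p(1), of "fst e"] card_Z(3)[OF p(1)] r
      by (auto simp: Z_def)
  next
    fix f assume f: "f \<in> B - ran \<rho>" "fst f \<notin> Z"
    have vn: "fst f < n" using f fst_B by auto
    have v': "valid (\<rho>(e \<mapsto> f))" by (rule valid_upd[OF p(1,3) ne f(1)])
    have c: "card (dom (\<rho>(e \<mapsto> f))) + 2 * Suc T \<le> R"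
      using card_dom_upd[OF p(1) ne] p(5) by simp
    \<comment> \<open>The new arc leaves a vertex with no revealed tail, so there is still at most
      one revealed tail per vertex.\<close>
    have simple: "inj_on fst (dom (\<rho>(e \<mapsto> f)))" using p(2,4) by auto
    have nd: "(fst f, k) \<notin> dom (\<rho>(e \<mapsto> f))" for k
      using f(2) notin_dom_upd[of "(fst f, k)" \<rho> e f] by (simp add: Z_def del: dom_fun_upd)
    have "cvmeet (\<rho>(e \<mapsto> f)) (Suc T) (fst f) (fst f) \<le> ((base T + \<theta>) + (base T + E)) / 2"
    proof (rule cvmeet_diag_le[OF vn])
      show "base T + E \<le> base T + \<theta>" using th0 by simp
    next
      fix k assume k: "(fst f, k) \<in> A"
      show "cmeet (\<rho>(e \<mapsto> f)) (Suc T) (fst f, k) (fst f, k) \<le> base T + \<theta>"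
        unfolding \<theta>_def add.assoc[symmetric]
        by (rule Suc.IH[OF v' simple k _ c]) (use f(2) in \<open>simp add: Z_def del: fun_upd_apply\<close>)
    next
      fix k k' assume k: "(fst f, k) \<in> A" "(fst f, k') \<in> A" "k \<noteq> k'"
      have "\<bar>cmeet (\<rho>(e \<mapsto> f)) (Suc T) (fst f, k) (fst f, k') - base T\<bar> \<le> E"
        unfolding E_def by (rule cmeet_offdiag[OF v' k(1,2) _ nd nd c]) (use k(3) in auto)
      then show "cmeet (\<rho>(e \<mapsto> f)) (Suc T) (fst f, k) (fst f, k') \<le> base T + E" by simp
    qed
    then show "cvmeet (\<rho>(e \<mapsto> f)) (Suc T) (fst f) (fst f) \<le> base T + \<theta> / 2 + E"
      using th0 by (simp add: field_simps)
  next
    fix f assume f: "f \<in> B - ran \<rho>"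
    have vn: "fst f < n" using f fst_B by auto
    have v': "valid (\<rho>(e \<mapsto> f))" by (rule valid_upd[OF p(1,3) ne f])
    have c: "card (dom (\<rho>(e \<mapsto> f))) + 2 * Suc T \<le> R"
      using card_dom_upd[OF p(1) ne] p(5) by simp
    have simple: "inj_on fst (dom (\<rho>(e \<mapsto> f)))" using p(2,4) by auto
    have "cvmeet (\<rho>(e \<mapsto> f)) (Suc T) (fst f) (fst f) \<le> h"
    proof (rule cvmeet_le[OF vn vn])
      fix k k' assume k: "(fst f, k) \<in> A" "(fst f, k') \<in> A"
      show "cmeet (\<rho>(e \<mapsto> f)) (Suc T) (fst f, k) (fst f, k') \<le> h"
      proof (cases "k = k'")
        case True
        then show ?thesis unfolding h_def using cmeet_simple[OF v' simple k(1) c] by simp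
      next
        case False
        have "(fst f, k) \<notin> dom (\<rho>(e \<mapsto> f)) \<or> (fst f, k') \<notin> dom (\<rho>(e \<mapsto> f))"
          using inj_onD[OF simple, of "(fst f, k)" "(fst f, k')"] False by auto
        then have "cmeet (\<rho>(e \<mapsto> f)) (Suc T) (fst f, k) (fst f, k') \<le> (real T + 1) * \<eta>"
          using cmeet_crude(1)[OF v' k _ _ c] False by simp
        also have "\<dots> \<le> 6 * (real T + 1) * \<eta>" using eta_pos by simp
        finally show ?thesis unfolding h_def by (simp add: add_increasing)
      qed
    qed
    then show "cvmeet (\<rho>(e \<mapsto> f)) (Suc T) (fst f) (fst f) \<le> base T + \<theta> / 2 + E + h"
      using th0 base_nonneg[of T] by linarith
  qed (rule th0)
  also have "\<dots> \<le> base (Suc T) + (1 / 2) ^ Suc T * (1 + 2 * real (Suc T) * \<eta>) + 34 * (real (Suc T) + 1)\<^sup>2 * \<eta>\<^sup>2"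
  proof -
    have "0 \<le> coal * rr ^ T" using coal_nonneg varrho_nonneg by simp
    moreover have "0 \<le> (1 / 2 :: real) ^ T * \<eta>" using eta_pos by simp
    moreover have "(17 * (real T + 1)\<^sup>2 + 11 * (real T + 1)\<^sup>2 + 6 * (real T + 1)) * \<eta>\<^sup>2 \<le> (34 * (real (Suc T) + 1)\<^sup>2) * \<eta>\<^sup>2"
      by (intro mult_right_mono) (auto simp: algebra_simps power2_eq_square)
    ultimately show ?thesis
      unfolding \<theta>_def E_def h_def base_Suc by (simp add: algebra_simps power2_eq_square)
  qed
  finally show ?case .
qed

end

section \<open>Unequal numbers of steps, and the link from walks to \<open>pit\<close> and invariant
  laws\<close>

context config begin

text \<open>The first walker starts from a uniform tail, which allows different numbers of steps.\<close>
definition umeet :: "nat \<Rightarrow> nat \<Rightarrow> nat \<times> nat \<Rightarrow> (nat \<times> nat \<Rightarrow> nat \<times> nat) \<Rightarrow> real" where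
  "umeet T s e' \<omega> = (\<Sum>e\<in>A. \<Sum>j<n. walk \<omega> T e j * walk \<omega> s e' j) / real m"

definition cumeet :: "(nat \<times> nat \<rightharpoonup> nat \<times> nat) \<Rightarrow> nat \<Rightarrow> nat \<Rightarrow> nat \<times> nat \<Rightarrow> real" where
  "cumeet \<rho> T s e' = cexp \<rho> (umeet T s e')"

lemma umeet_Suc:
  "umeet T (Suc s) e' \<omega> = (\<Sum>k<dout (fst (\<omega> e')). umeet T s (fst (\<omega> e'), k) \<omega>) / real (dout (fst (\<omega> e')))"
proof -
  let ?v = "fst (\<omega> e')"
  have "(\<Sum>e\<in>A. \<Sum>j<n. walk \<omega> T e j * walk \<omega> (Suc s) e' j)
      = (\<Sum>e\<in>A. \<Sum>j<n. \<Sum>k<dout ?v. walk \<omega> T e j * walk \<omega> s (?v, k) j) / real (dout ?v)"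
    by (simp add: sum_distrib_left sum_divide_distrib)
  also have "(\<Sum>e\<in>A. \<Sum>j<n. \<Sum>k<dout ?v. walk \<omega> T e j * walk \<omega> s (?v, k) j)
      = (\<Sum>k<dout ?v. \<Sum>e\<in>A. \<Sum>j<n. walk \<omega> T e j * walk \<omega> s (?v, k) j)"
    by (simp add: sum.swap[of _ "{..<dout ?v}"])
  finally show ?thesis
    by (simp add: umeet_def sum_divide_distrib[symmetric] mult.commute)
qed

lemma cumeet_known:
  assumes "\<rho> e' = Some f"
  shows "cumeet \<rho> T (Suc s) e' = (\<Sum>k<dout (fst f). cumeet \<rho> T s (fst f, k)) / real (dout (fst f))"
proof -
  have "cumeet \<rho> T (Suc s) e' = cexp \<rho> (\<lambda>\<omega>. (\<Sum>k<dout (fst f). umeet T s (fst f, k) \<omega>) / real (dout (fst f)))"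
    unfolding cumeet_def
  proof (rule cexp_cong)
    fix \<omega> assume "\<omega> \<in> extensions \<rho>"
    then have "\<rho> e' = Some (\<omega> e')" using assms by (auto simp: extensions_def dom_def)
    then show "umeet T (Suc s) e' \<omega> = (\<Sum>k<dout (fst f). umeet T s (fst f, k) \<omega>) / real (dout (fst f))"
      using assms by (simp add: umeet_Suc)
  qed
  then show ?thesis by (simp add: cexp_divide cexp_sum cumeet_def)
qed

lemma cumeet_reveal:
  assumes "valid \<rho>" "e \<in> A" "e \<notin> dom \<rho>"
  shows "cumeet \<rho> T s e' = (\<Sum>f\<in>B - ran \<rho>. cumeet (\<rho>(e \<mapsto> f)) T s e') / real (card (B - ran \<rho>))"
  unfolding cumeet_def by (rule reveal[OF assms])

lemma cumeet_same: "cumeet \<rho> T T e' = (\<Sum>e\<in>A. cmeet \<rho> T e e') / real m"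
  unfolding cumeet_def umeet_def cmeet_def meet_def by (simp only: cexp_divide cexp_sum)

lemma cumeet_nonneg: "0 \<le> cumeet \<rho> T s e'"
  by (auto simp: cumeet_def cexp_def umeet_def walk_nonneg intro!: divide_nonneg_nonneg sum_nonneg mult_nonneg_nonneg)

lemma sum_tails_mem: "(\<Sum>e\<in>A. of_bool (e \<in> W)) = real (card (A \<inter> W))"
  by simp

lemma mean_vertex_le:
  assumes "v < n" "\<And>k. (v, k) \<in> A \<Longrightarrow> g k \<le> (x::real)"
  shows "(\<Sum>k<dout v. g k) / real (dout v) \<le> x"
proof -
  have "(\<Sum>k<dout v. g k) \<le> (\<Sum>k<dout v. x)" using assms by (intro sum_mono) (auto simp: A_iff)
  then show ?thesis using dout_ge[OF assms(1)] by (simp add: divide_le_eq mult.commute)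
qed

lemma mean_vertex_abs:
  assumes "v < n" "\<And>k. (v, k) \<in> A \<Longrightarrow> \<bar>g k - c\<bar> \<le> (x::real)"
  shows "\<bar>(\<Sum>k<dout v. g k) / real (dout v) - c\<bar> \<le> x"
proof -
  have "(\<Sum>k<dout v. g k) / real (dout v) \<le> c + x"
    by (rule mean_vertex_le[OF assms(1)]) (use assms(2) in \<open>force simp: abs_le_iff\<close>)
  moreover have "(\<Sum>k<dout v. - g k) / real (dout v) \<le> x - c"
    by (rule mean_vertex_le[OF assms(1)]) (use assms(2) in \<open>force simp: abs_le_iff\<close>)
  ultimately show ?thesis by (simp add: sum_negf)
qed

text \<open>\<open>walk\<close> recurses on its first step while \<open>pit\<close> appends steps at
  the end. At least one step must precede the last one: \<open>walk \<omega> 0 e\<close> sits at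
  \<open>fst e\<close>, from where the next step is dictated by \<open>e\<close> and not by
  \<open>trans\<close>.\<close>

lemma walk_last:
  assumes "\<omega> \<in> envs din dout n"
  shows "e \<in> A \<Longrightarrow> walk \<omega> (Suc (Suc T)) e j = (\<Sum>i<n. walk \<omega> (Suc T) e i * trans dout \<omega> i j)"
proof (induction T arbitrary: e)
  case 0
  let ?v = "fst (\<omega> e)"
  have v: "?v < n" using env_B[OF assms 0] fst_B by blast
  then have d: "0 < dout ?v" using dout_ge[OF v] by linarith
  have one: "walk \<omega> (Suc 0) e' i = of_bool (fst (\<omega> e') = i)" if "e' \<in> A" for e' i
  proof -
    have "fst (\<omega> e') < n" using env_B[OF assms that] fst_B by blast
    then have "0 < dout (fst (\<omega> e'))" using dout_ge by fastforce
    then show ?thesis by simp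
  qed
  have "(\<Sum>i<n. walk \<omega> (Suc 0) e i * trans dout \<omega> i j) = (\<Sum>i<n. if i = ?v then trans dout \<omega> i j else 0)"
    by (intro sum.cong refl) (simp add: one[OF 0] del: walk.simps)
  also have "\<dots> = trans dout \<omega> ?v j" using v by simp
  also have "\<dots> = (\<Sum>k<dout ?v. walk \<omega> (Suc 0) (?v, k) j) / real (dout ?v)"
  proof -
    have "(\<Sum>k<dout ?v. walk \<omega> (Suc 0) (?v, k) j) = (\<Sum>k<dout ?v. of_bool (fst (\<omega> (?v, k)) = j))"
      by (intro sum.cong refl one) (simp add: A_iff v)
    also have "\<dots> = real (card {k. k < dout ?v \<and> fst (\<omega> (?v, k)) = j})"
      by (simp add: lessThan_def Int_def)
    finally show ?thesis by (simp add: trans_def)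
  qed
  finally show ?case by (simp only: walk.simps(2)[of \<omega> "Suc 0"])
next
  case (Suc T)
  let ?v = "fst (\<omega> e)"
  have v: "?v < n" using env_B[OF assms Suc.prems] fst_B by blast
  have "walk \<omega> (Suc (Suc (Suc T))) e j = (\<Sum>k<dout ?v. walk \<omega> (Suc (Suc T)) (?v, k) j) / real (dout ?v)"
    by (simp only: walk.simps(2)[of \<omega> "Suc (Suc T)"])
  also have "\<dots> = (\<Sum>k<dout ?v. \<Sum>i<n. walk \<omega> (Suc T) (?v, k) i * trans dout \<omega> i j) / real (dout ?v)"
    using Suc.IH v by (simp add: A_iff del: walk.simps)
  also have "\<dots> = (\<Sum>i<n. (\<Sum>k<dout ?v. walk \<omega> (Suc T) (?v, k) i) / real (dout ?v) * trans dout \<omega> i j)"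
    by (simp add: sum_divide_distrib sum_distrib_right sum.swap[of _ "{..<n}"] del: walk.simps)
  finally show ?case by (simp only: walk.simps(2)[of \<omega> "Suc T"])
qed

lemma walk_1:
  assumes "\<omega> \<in> envs din dout n" "e \<in> A"
  shows "walk \<omega> (Suc 0) e j = of_bool (fst (\<omega> e) = j)"
proof -
  have "fst (\<omega> e) < n" using env_B[OF assms] fst_B by blast
  then have "0 < dout (fst (\<omega> e))" using dout_ge by fastforce
  then show ?thesis by simp
qed

lemma card_heads_vertex: "j < n \<Longrightarrow> card {f \<in> B. fst f = j} = din j"
proof -
  assume "j < n"
  then have "{f \<in> B. fst f = j} = {j} \<times> {..<din j}" by (auto simp: heads_def)
  then show ?thesis by (simp add: card_cartesian_product)
qed

lemma sum_env:
  assumes "\<omega> \<in> envs din dout n" shows "(\<Sum>e\<in>A. F (\<omega> e)) = (\<Sum>f\<in>B. F f)"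
  using assms by (intro sum.reindex_bij_betw) (simp add: envs_def)

lemma pit_eq_walk:
  assumes "\<omega> \<in> envs din dout n" "j < n"
  shows "pit n din dout \<omega> s j = (\<Sum>e\<in>A. walk \<omega> (Suc s) e j) / real m"
  using assms(2)
proof (induction s arbitrary: j)
  case 0
  have "(\<Sum>e\<in>A. walk \<omega> (Suc 0) e j) = (\<Sum>e\<in>A. of_bool (fst (\<omega> e) = j))"
    by (intro sum.cong refl walk_1 assms)
  also have "\<dots> = (\<Sum>f\<in>B. of_bool (fst f = j))" by (rule sum_env[OF assms(1)])
  also have "\<dots> = real (din j)"
    using card_heads_vertex[OF 0] by (simp add: Int_def)
  finally show ?case by (simp add: pit_def pi0_def del: walk.simps)
next
  case (Suc s)
  have "pit n din dout \<omega> (Suc s) j = (\<Sum>i<n. pit n din dout \<omega> s i * trans dout \<omega> i j)"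
    by (simp add: pit_def step_def)
  also have "\<dots> = (\<Sum>i<n. (\<Sum>e\<in>A. walk \<omega> (Suc s) e i) / real m * trans dout \<omega> i j)"
    using Suc.IH by simp
  also have "\<dots> = (\<Sum>i<n. \<Sum>e\<in>A. walk \<omega> (Suc s) e i * trans dout \<omega> i j) / real m"
    by (simp add: sum_distrib_right sum_divide_distrib del: walk.simps)
  also have "(\<Sum>i<n. \<Sum>e\<in>A. walk \<omega> (Suc s) e i * trans dout \<omega> i j) = (\<Sum>e\<in>A. \<Sum>i<n. walk \<omega> (Suc s) e i * trans dout \<omega> i j)"
    by (rule sum.swap)
  also have "\<dots> = (\<Sum>e\<in>A. walk \<omega> (Suc (Suc s)) e j)"
    by (intro sum.cong refl walk_last[symmetric] assms)
  finally show ?case .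
qed

text \<open>Each tail of \<open>v\<close> carries the stationary flow \<open>p v / dout v\<close>.
  So \<open>p\<close> is a fixed point of the kernel from tails to vertices for every number of
  steps, and can be compared with \<open>pit\<close> at any \<open>s\<close>.\<close>

lemma invariant_walk:
  assumes "\<omega> \<in> envs din dout n" "invariant_prob n dout \<omega> p" "j < n"
  shows "p j = (\<Sum>e\<in>A. p (fst e) / real (dout (fst e)) * walk \<omega> (Suc s) e j)"
  using assms(3)
proof (induction s arbitrary: j)
  case 0
  have "p j = (\<Sum>i<n. p i * trans dout \<omega> i j)"
    using assms(2) 0 by (simp add: invariant_prob_def step_def)
  also have "\<dots> = (\<Sum>i<n. \<Sum>k<dout i. p i / real (dout i) * of_bool (fst (\<omega> (i, k)) = j))"
  proof (rule sum.cong)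
    fix i
    have "(\<Sum>k<dout i. p i / real (dout i) * of_bool (fst (\<omega> (i, k)) = j)) = p i / real (dout i) * (\<Sum>k<dout i. of_bool (fst (\<omega> (i, k)) = j))"
      by (simp only: sum_distrib_left)
    also have "(\<Sum>k<dout i. of_bool (fst (\<omega> (i, k)) = j)) = real (card {k. k < dout i \<and> fst (\<omega> (i, k)) = j})"
      by (simp add: lessThan_def Int_def)
    finally show "p i * trans dout \<omega> i j = (\<Sum>k<dout i. p i / real (dout i) * of_bool (fst (\<omega> (i, k)) = j))"
      by (simp add: trans_def)
  qed simp
  also have "\<dots> = (\<Sum>e\<in>A. p (fst e) / real (dout (fst e)) * of_bool (fst (\<omega> e) = j))"
    by (simp add: sum_A)
  also have "\<dots> = (\<Sum>e\<in>A. p (fst e) / real (dout (fst e)) * walk \<omega> (Suc 0) e j)"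
    by (intro sum.cong refl) (simp add: walk_1[OF assms(1)] del: walk.simps)
  finally show ?case .
next
  case (Suc s)
  have "p j = (\<Sum>i<n. p i * trans dout \<omega> i j)"
    using assms(2) Suc.prems by (simp add: invariant_prob_def step_def)
  also have "\<dots> = (\<Sum>i<n. (\<Sum>e\<in>A. p (fst e) / real (dout (fst e)) * walk \<omega> (Suc s) e i) * trans dout \<omega> i j)"
    using Suc.IH by (intro sum.cong refl arg_cong2[of _ _ _ _ "(*)"]) auto
  also have "\<dots> = (\<Sum>i<n. \<Sum>e\<in>A. p (fst e) / real (dout (fst e)) * (walk \<omega> (Suc s) e i * trans dout \<omega> i j))"
    by (simp only: sum_distrib_right mult.assoc)
  also have "\<dots> = (\<Sum>e\<in>A. \<Sum>i<n. p (fst e) / real (dout (fst e)) * (walk \<omega> (Suc s) e i * trans dout \<omega> i j))"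
    by (rule sum.swap)
  also have "\<dots> = (\<Sum>e\<in>A. p (fst e) / real (dout (fst e)) * walk \<omega> (Suc (Suc s)) e j)"
    by (intro sum.cong refl) (simp only: walk_last[OF assms(1)] sum_distrib_left)
  finally show ?case .
qed

definition overlap :: "nat \<Rightarrow> nat \<Rightarrow> (nat \<times> nat \<Rightarrow> nat \<times> nat) \<Rightarrow> real" where
  "overlap s s' \<omega> = (\<Sum>j<n. pit n din dout \<omega> s j * pit n din dout \<omega> s' j)"

lemma overlap_eq:
  assumes "\<omega> \<in> envs din dout n"
  shows "overlap s s' \<omega> = (\<Sum>e'\<in>A. umeet (Suc s) (Suc s') e' \<omega>) / real m"
proof -
  have "overlap s s' \<omega> = (\<Sum>j<n. (\<Sum>e\<in>A. walk \<omega> (Suc s) e j) / real m * ((\<Sum>e'\<in>A. walk \<omega> (Suc s') e' j) / real m))"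
    unfolding overlap_def by (intro sum.cong refl) (simp add: pit_eq_walk[OF assms] del: walk.simps)
  also have "\<dots> = (\<Sum>j<n. \<Sum>e\<in>A. \<Sum>e'\<in>A. walk \<omega> (Suc s) e j * walk \<omega> (Suc s') e' j) / real m / real m"
    by (simp add: sum_product sum_divide_distrib del: walk.simps)
  also have "(\<Sum>j<n. \<Sum>e\<in>A. \<Sum>e'\<in>A. walk \<omega> (Suc s) e j * walk \<omega> (Suc s') e' j)
     = (\<Sum>j<n. \<Sum>e'\<in>A. \<Sum>e\<in>A. walk \<omega> (Suc s) e j * walk \<omega> (Suc s') e' j)"
    by (intro sum.cong refl sum.swap)
  also have "(\<Sum>j<n. \<Sum>e'\<in>A. \<Sum>e\<in>A. walk \<omega> (Suc s) e j * walk \<omega> (Suc s') e' j)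
     = (\<Sum>e'\<in>A. \<Sum>e\<in>A. \<Sum>j<n. walk \<omega> (Suc s) e j * walk \<omega> (Suc s') e' j)"
    by (simp only: sum.swap[of _ "{..<n}"])
  finally show ?thesis by (simp only: umeet_def sum_divide_distrib)
qed

lemma cexp_overlap:
  "cexp Map.empty (overlap s s') = (\<Sum>e'\<in>A. cumeet Map.empty (Suc s) (Suc s') e') / real m"
proof -
  have "cexp Map.empty (overlap s s') = cexp Map.empty (\<lambda>\<omega>. (\<Sum>e'\<in>A. umeet (Suc s) (Suc s') e' \<omega>) / real m)"
    by (rule cexp_cong) (simp add: overlap_eq extensions_envs)
  then show ?thesis by (simp add: cexp_divide cexp_sum cumeet_def)
qed

lemma mean_tails_le:
  assumes "\<And>e. e \<in> A \<Longrightarrow> g e \<le> (x::real)" shows "(\<Sum>e\<in>A. g e) / real m \<le> x"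
proof -
  have "(\<Sum>e\<in>A. g e) \<le> (\<Sum>e\<in>A. x)" using assms by (intro sum_mono)
  then show ?thesis using m_pos by (simp add: divide_le_eq card_A mult.commute)
qed

definition sqdist :: "nat \<Rightarrow> nat \<Rightarrow> (nat \<times> nat \<Rightarrow> nat \<times> nat) \<Rightarrow> real" where
  "sqdist s s' \<omega> = (\<Sum>j<n. (pit n din dout \<omega> s j - pit n din dout \<omega> s' j)\<^sup>2)"

text \<open>Squared Hilbert-Schmidt norm of the kernel \<open>walk \<omega> (Suc s)\<close> minus its mean over the starting tail.\<close>
definition spread :: "nat \<Rightarrow> (nat \<times> nat \<Rightarrow> nat \<times> nat) \<Rightarrow> real" where
  "spread s \<omega> = (\<Sum>e\<in>A. \<Sum>j<n. (walk \<omega> (Suc s) e j - pit n din dout \<omega> s j)\<^sup>2)"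

text \<open>The variance identity, as \<open>pit\<close> is the mean of the rows
  \<open>walk \<omega> (Suc s) e\<close>. It reduces the spread to meeting probabilities.\<close>

lemma spread_eq:
  assumes "\<omega> \<in> envs din dout n"
  shows "spread s \<omega> = (\<Sum>e\<in>A. meet (Suc s) e e \<omega>) - real m * overlap s s \<omega>"
proof -
  have q: "(\<Sum>e\<in>A. walk \<omega> (Suc s) e j) = real m * pit n din dout \<omega> s j" if "j < n" for j
    using pit_eq_walk[OF assms that] m_pos by (simp del: walk.simps)
  have "spread s \<omega> = (\<Sum>j<n. \<Sum>e\<in>A. (walk \<omega> (Suc s) e j - pit n din dout \<omega> s j)\<^sup>2)"
    unfolding spread_def by (rule sum.swap)
  also have "\<dots> = (\<Sum>j<n. (\<Sum>e\<in>A. (walk \<omega> (Suc s) e j)\<^sup>2) - real m * (pit n din dout \<omega> s j)\<^sup>2)"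
  proof (rule sum.cong)
    fix j assume j: "j \<in> {..<n}"
    let ?p = "pit n din dout \<omega> s j"
    have "(\<Sum>e\<in>A. (walk \<omega> (Suc s) e j - ?p)\<^sup>2)
       = (\<Sum>e\<in>A. (walk \<omega> (Suc s) e j)\<^sup>2) + real m * ?p\<^sup>2 - 2 * ?p * (\<Sum>e\<in>A. walk \<omega> (Suc s) e j)"
      by (simp add: power2_diff sum.distrib sum_subtractf card_A sum_distrib_left mult_ac del: walk.simps)
    then show "(\<Sum>e\<in>A. (walk \<omega> (Suc s) e j - ?p)\<^sup>2) = (\<Sum>e\<in>A. (walk \<omega> (Suc s) e j)\<^sup>2) - real m * ?p\<^sup>2"
      using q[of j] j by (simp add: power2_eq_square algebra_simps del: walk.simps)
  qed simp
  also have "\<dots> = (\<Sum>e\<in>A. \<Sum>j<n. (walk \<omega> (Suc s) e j)\<^sup>2) - real m * (\<Sum>j<n. (pit n din dout \<omega> s j)\<^sup>2)"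
    by (simp only: sum_subtractf sum_distrib_left sum.swap[of _ "{..<n}"])
  finally show ?thesis
    by (simp add: meet_def overlap_def power2_eq_square del: walk.simps)
qed

text \<open>The weights \<open>wt\<close> sum to one, so \<open>p - ?q\<close> is a combination of
  centred rows, and Cauchy-Schwarz brings in the spread. Since \<open>dout \<ge> 2\<close>, the
  weights have a sum of squares at most half that of \<open>p\<close>, which in turn is controlled
  by the unknown distance \<open>x\<close> and the overlap. With spread at most \<open>1 / 2\<close>
  the resulting \<open>x\<close> is absorbed on the left.\<close>

lemma invariant_sqdist:
  assumes w: "\<omega> \<in> envs din dout n" and p: "invariant_prob n dout \<omega> p" and S: "spread s \<omega> \<le> 1 / 2"
  shows "(\<Sum>j<n. (p j - pit n din dout \<omega> s j)\<^sup>2) \<le> 2 * overlap s s \<omega> * spread s \<omega>"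
proof -
  let ?q = "pit n din dout \<omega> s"
  define wt where "wt e = p (fst e) / real (dout (fst e))" for e :: "nat \<times> nat"
  define x where "x = (\<Sum>j<n. (p j - ?q j)\<^sup>2)"
  have S0: "0 \<le> spread s \<omega>" by (auto simp: spread_def intro!: sum_nonneg)
  have sum_wt: "(\<Sum>e\<in>A. wt e) = 1"
  proof -
    have "(\<Sum>e\<in>A. wt e) = (\<Sum>i<n. real (dout i) * (p i / real (dout i)))" by (simp add: sum_A wt_def)
    also have "\<dots> = (\<Sum>i<n. p i)"
      by (rule sum.cong) (use dout_ge in fastforce)+
    finally show ?thesis using p by (simp add: invariant_prob_def)
  qed
  have sum_wt2: "(\<Sum>e\<in>A. (wt e)\<^sup>2) \<le> (\<Sum>j<n. (p j)\<^sup>2) / 2"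
  proof -
    have "(\<Sum>e\<in>A. (wt e)\<^sup>2) = (\<Sum>i<n. real (dout i) * (p i / real (dout i))\<^sup>2)" by (simp add: sum_A wt_def)
    also have "\<dots> \<le> (\<Sum>i<n. (p i)\<^sup>2 / 2)"
    proof (rule sum_mono)
      fix i assume "i \<in> {..<n}"
      then have d: "2 \<le> real (dout i)" using dout_ge[of i] by simp
      have "real (dout i) * (p i / real (dout i))\<^sup>2 = (p i)\<^sup>2 / real (dout i)"
        using d by (simp add: power2_eq_square)
      also have "\<dots> \<le> (p i)\<^sup>2 / 2" using d by (intro divide_left_mono) auto
      finally show "real (dout i) * (p i / real (dout i))\<^sup>2 \<le> (p i)\<^sup>2 / 2" .
    qed
    finally show ?thesis by (simp add: sum_divide_distrib)
  qed
  have "x \<le> (\<Sum>j<n. (\<Sum>e\<in>A. (wt e)\<^sup>2) * (\<Sum>e\<in>A. (walk \<omega> (Suc s) e j - ?q j)\<^sup>2))"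
    unfolding x_def
  proof (rule sum_mono)
    fix j assume j: "j \<in> {..<n}"
    have "p j - ?q j = (\<Sum>e\<in>A. wt e * walk \<omega> (Suc s) e j) - (\<Sum>e\<in>A. wt e) * ?q j"
      using invariant_walk[OF w p, of j s] j unfolding wt_def[symmetric] sum_wt by (simp del: walk.simps)
    also have "\<dots> = (\<Sum>e\<in>A. wt e * (walk \<omega> (Suc s) e j - ?q j))"
      by (simp only: sum_distrib_right sum_subtractf[symmetric] right_diff_distrib)
    finally show "(p j - ?q j)\<^sup>2 \<le> (\<Sum>e\<in>A. (wt e)\<^sup>2) * (\<Sum>e\<in>A. (walk \<omega> (Suc s) e j - ?q j)\<^sup>2)"
      by (simp only: Cauchy_Schwarz_ineq_sum)
  qed
  also have "\<dots> = (\<Sum>e\<in>A. (wt e)\<^sup>2) * spread s \<omega>"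
    unfolding spread_def by (simp only: sum_distrib_left[symmetric] sum.swap[of _ A])
  also have "\<dots> \<le> (\<Sum>j<n. (p j)\<^sup>2) / 2 * spread s \<omega>"
    by (rule mult_right_mono[OF sum_wt2 S0])
  also have "\<dots> \<le> (x + overlap s s \<omega>) * spread s \<omega>"
  proof (rule mult_right_mono[OF _ S0])
    have "(\<Sum>j<n. (p j)\<^sup>2) \<le> (\<Sum>j<n. 2 * (p j - ?q j)\<^sup>2 + 2 * (?q j * ?q j))"
    proof (rule sum_mono)
      fix j
      have "0 \<le> (p j - 2 * ?q j)\<^sup>2" by simp
      then show "(p j)\<^sup>2 \<le> 2 * (p j - ?q j)\<^sup>2 + 2 * (?q j * ?q j)"
        by (simp add: power2_eq_square algebra_simps)
    qed
    also have "\<dots> = 2 * x + 2 * overlap s s \<omega>"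
      by (simp add: x_def overlap_def sum.distrib sum_distrib_left)
    finally show "(\<Sum>j<n. (p j)\<^sup>2) / 2 \<le> x + overlap s s \<omega>" by simp
  qed
  also have "\<dots> = x * spread s \<omega> + overlap s s \<omega> * spread s \<omega>" by (rule distrib_right)
  also have "x * spread s \<omega> \<le> x * (1 / 2)"
    using S by (intro mult_left_mono) (auto simp: x_def intro!: sum_nonneg)
  finally show ?thesis unfolding x_def by linarith
qed

end

section \<open>Expected overlaps, squared distances and spread\<close>

context config_bounds begin

text \<open>The second walker first makes its \<open>k\<close> surplus steps alone. Once both have
  equally many left, the uniform tail of the first is unrevealed and different from that of the
  second, except with probability at most \<open>(R + 1) / m\<close>.\<close>

lemma cumeet_le:
  assumes "valid \<rho>" "e' \<in> A" "card (dom \<rho>) + k + 2 * Suc T \<le> R"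
  shows "cumeet \<rho> (Suc T) (Suc T + k) e' \<le> (real T + 2) * \<eta>"
  using assms
proof (induction k arbitrary: \<rho> e')
  case 0
  define x where "x = (real T + 1) * \<eta>"
  have x0: "0 \<le> x" using eta_pos by (simp add: x_def)
  define W where "W = insert e' (dom \<rho>)"
  have "(\<Sum>e\<in>A. cmeet \<rho> (Suc T) e e') \<le> (\<Sum>e\<in>A. x + of_bool (e \<in> W))"
  proof (rule sum_mono)
    fix e assume e: "e \<in> A"
    show "cmeet \<rho> (Suc T) e e' \<le> x + of_bool (e \<in> W)"
    proof (cases "e \<in> W")
      case True
      then show ?thesis using cmeet_le_1[OF 0(1) e 0(2), of "Suc T"] x0 by simp
    next
      case False
      then show ?thesis using cmeet_crude(1)[OF 0(1) e 0(2)] 0(3) by (simp add: x_def W_def)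
    qed
  qed
  also have "\<dots> = real m * x + real (card (A \<inter> W))"
    by (simp add: sum.distrib card_A)
  also have "\<dots> \<le> real m * x + (real R + 1)"
  proof -
    have "card (A \<inter> W) \<le> card (W)"
      using valid_finite_dom[OF 0(1)] unfolding W_def by (intro card_mono) auto
    also have "\<dots> \<le> card (dom \<rho>) + 1" using valid_finite_dom[OF 0(1)] by (simp add: card_insert_if W_def)
    finally show ?thesis using 0(3) by simp
  qed
  finally have "cumeet \<rho> (Suc T) (Suc T) e' \<le> (real m * x + (real R + 1)) / real m"
    unfolding cumeet_same by (intro divide_right_mono) auto
  also have "\<dots> = x + (real R + 1) / real m" using m_pos by (simp add: add_divide_distrib)
  also have "\<dots> \<le> x + \<eta>" using eta_m(2) by simp
  finally show ?case by (simp add: x_def algebra_simps)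
next
  case (Suc k)
  have K: "cumeet \<rho> (Suc T) (Suc T + Suc k) e' \<le> (real T + 2) * \<eta>"
    if \<rho>: "valid \<rho>" "\<rho> e' = Some f" "card (dom \<rho>) + k + 2 * Suc T \<le> R" for \<rho> f
  proof -
    have "f \<in> B" using ranI[of \<rho> e' f, OF \<rho>(2)] \<rho>(1) by (auto simp: valid_def)
    then have v: "fst f < n" by (rule fst_B)
    have "Suc T + Suc k = Suc (Suc T + k)" by simp
    then show ?thesis
      unfolding cumeet_known[of \<rho> e' f "Suc T" "Suc T + k", OF \<rho>(2), folded \<open>Suc T + Suc k = Suc (Suc T + k)\<close>]
      by (intro mean_vertex_le[OF v] Suc.IH \<rho>) auto
  qed
  show ?case
  proof (cases "e' \<in> dom \<rho>")
    case True
    then obtain f where "\<rho> e' = Some f" by auto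
    then show ?thesis using K[OF Suc.prems(1)] Suc.prems(3) by simp
  next
    case False
    show ?thesis
      unfolding cumeet_reveal[OF Suc.prems(1,2) False]
    proof (rule mean_free_le_const[OF Suc.prems(1)])
      fix f assume f: "f \<in> B - ran \<rho>"
      show "cumeet (\<rho>(e' \<mapsto> f)) (Suc T) (Suc T + Suc k) e' \<le> (real T + 2) * \<eta>"
        by (rule K[OF valid_upd[OF Suc.prems(1,2) False f]])
           (use card_dom_upd[OF Suc.prems(1) False] Suc.prems(3) in auto)
    qed (use Suc.prems in auto)
  qed
qed

text \<open>For \<open>k = 0\<close> the uniform tail coincides with \<open>e'\<close> with
  probability \<open>1 / m\<close>, which adds \<open>rr ^ T / m\<close>; coinciding and revealed
  tails have weight at most \<open>\<eta>\<close>, so first-order errors on them are harmless. Every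
  surplus step risks a visited vertex and so costs \<open>\<eta>\<close> times the bound of
  \<open>cumeet_le\<close>.\<close>

lemma cumeet_close:
  assumes "valid \<rho>" "e' \<in> A" "e' \<notin> dom \<rho>" "card (dom \<rho>) + k + 2 * Suc T \<le> R"
  shows "\<bar>cumeet \<rho> (Suc T) (Suc T + k) e' - (base T + rr ^ T / real m)\<bar>
    \<le> 11 * (real T + 1)\<^sup>2 * \<eta>\<^sup>2 + (real k + 4) * (real T + 2) * \<eta>\<^sup>2"
  using assms
proof (induction k arbitrary: \<rho> e')
  case 0
  define E where "E = 11 * (real T + 1)\<^sup>2 * \<eta>\<^sup>2"
  define x where "x = (real T + 1) * \<eta>"
  have x0: "0 \<le> x" "0 \<le> E" using eta_pos by (simp_all add: x_def E_def)
  have c: "card (dom \<rho>) + 2 * Suc T \<le> R" using 0(4) by simp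
  define c0 where "c0 = real (card (A \<inter> dom \<rho>))"
  have "card (A \<inter> dom \<rho>) \<le> card (dom \<rho>)"
    by (rule card_mono[OF valid_finite_dom[OF 0(1)]]) (rule Int_lower2)
  then have c0: "c0 \<le> real R + 1" using 0(4) unfolding c0_def by linarith
  have eq: "cumeet \<rho> (Suc T) (Suc T) e' - (base T + rr ^ T / real m)
     = (\<Sum>e\<in>A. cmeet \<rho> (Suc T) e e' - base T - (if e = e' then rr ^ T else 0)) / real m"
    unfolding cumeet_same using m_pos 0(2)
    by (simp add: sum_subtractf card_A diff_divide_distrib)
  have "\<bar>cumeet \<rho> (Suc T) (Suc T) e' - (base T + rr ^ T / real m)\<bar>
      \<le> (\<Sum>e\<in>A. E + 3 * x * of_bool (e = e') + x * of_bool (e \<in> dom \<rho>)) / real m"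
  proof -
    have "\<bar>cmeet \<rho> (Suc T) e e' - base T - (if e = e' then rr ^ T else 0)\<bar>
        \<le> E + 3 * x * of_bool (e = e') + x * of_bool (e \<in> dom \<rho>)" if e: "e \<in> A" for e
    proof (cases "e = e'")
      case True
      have "\<bar>cmeet \<rho> (Suc T) e' e' - base T - rr ^ T\<bar> \<le> 3 * x"
        using cmeet_diag[OF 0(1-3) c] by (simp only: x_def diff_diff_eq mult.assoc)
      also have "\<dots> \<le> E + 3 * x" using x0(2) by simp
      finally have "\<bar>cmeet \<rho> (Suc T) e' e' - base T - rr ^ T\<bar> \<le> E + 3 * x" .
      moreover have "(if e = e' then rr ^ T else 0) = rr ^ T" "of_bool (e = e') = (1::real)"
        "of_bool (e \<in> dom \<rho>) = (0::real)" using True 0(3) by auto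
      ultimately show ?thesis
        by (simp only: True mult_1_right mult_zero_right add_0_right)
    next
      case ne: False
      show ?thesis
      proof (cases "e \<in> dom \<rho>")
        case True
        then show ?thesis using cmeet_crude(2)[OF 0(1) e 0(2) ne _ c] 0(3) ne x0 by (simp add: x_def)
      next
        case False
        then show ?thesis using cmeet_offdiag[OF 0(1) e 0(2) ne False 0(3) c] ne by (simp add: E_def)
      qed
    qed
    then have "\<bar>\<Sum>e\<in>A. cmeet \<rho> (Suc T) e e' - base T - (if e = e' then rr ^ T else 0)\<bar>
        \<le> (\<Sum>e\<in>A. E + 3 * x * of_bool (e = e') + x * of_bool (e \<in> dom \<rho>))"
      by (rule order_trans[OF sum_abs sum_mono])
    then show ?thesis unfolding eq by (simp add: abs_divide divide_right_mono)
  qed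
  also have "\<dots> = E + (3 * x) * (1 / real m) + x * (c0 / real m)"
  proof -
    have "(\<Sum>e\<in>A. E + 3 * x * of_bool (e = e') + x * of_bool (e \<in> dom \<rho>))
        = real m * E + 3 * x * (\<Sum>e\<in>A. of_bool (e = e')) + x * (\<Sum>e\<in>A. of_bool (e \<in> dom \<rho>))"
      by (simp only: sum.distrib sum_distrib_left sum_constant card_A)
    also have "(\<Sum>e\<in>A. of_bool (e = e')) = (1::real)"
      using 0(2) by (simp add: of_bool_def)
    also have "(\<Sum>e\<in>A. of_bool (e \<in> dom \<rho>)) = c0"
      unfolding c0_def by (rule sum_tails_mem)
    finally have total: "(\<Sum>e\<in>A. E + 3 * x * of_bool (e = e') + x * of_bool (e \<in> dom \<rho>))
        = real m * E + 3 * x * 1 + x * c0" .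
    show ?thesis unfolding total using m_pos by (simp add: add_divide_distrib)
  qed
  also have "\<dots> \<le> E + (3 * x) * \<eta> + x * \<eta>"
  proof (intro add_mono mult_left_mono order_refl)
    show "1 / real m \<le> \<eta>" by (rule eta_m)
    have "c0 / real m \<le> (real R + 1) / real m"
      using c0 by (intro divide_right_mono) auto
    then show "c0 / real m \<le> \<eta>" using eta_m(2) by linarith
  qed (use x0 in auto)
  also have "\<dots> = E + 4 * (real T + 1) * \<eta>\<^sup>2" by (simp add: x_def power2_eq_square)
  also have "\<dots> \<le> E + (real 0 + 4) * (real T + 2) * \<eta>\<^sup>2"
    by (intro add_mono mult_right_mono) auto
  finally show ?case by (simp add: E_def)
next
  case (Suc k)
  note p = Suc.prems
  define E where "E = 11 * (real T + 1)\<^sup>2 * \<eta>\<^sup>2 + (real k + 4) * (real T + 2) * \<eta>\<^sup>2"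
  have E0: "0 \<le> E" unfolding E_def by simp
  define Z where "Z = insert (fst e') (fst ` dom \<rho>)"
  have r: "card (dom \<rho>) \<le> R" using p by simp
  have sk: "Suc T + Suc k = Suc (Suc T + k)" by simp
  have known: "cumeet (\<rho>(e' \<mapsto> f)) (Suc T) (Suc T + Suc k) e'
     = (\<Sum>i<dout (fst f). cumeet (\<rho>(e' \<mapsto> f)) (Suc T) (Suc T + k) (fst f, i)) / real (dout (fst f))" for f
    unfolding sk by (rule cumeet_known) simp
  have cd: "card (dom (\<rho>(e' \<mapsto> f))) + k + 2 * Suc T \<le> R" for f
    using card_dom_upd[OF p(1,3), of f] p(4) by linarith
  let ?c = "base T + rr ^ T / real m"
  have "rr ^ T / real m \<le> 1 / real m" using power_rr_le_1[of T] by (intro divide_right_mono) auto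
  then have c: "0 \<le> ?c" "?c \<le> (real T + 2) * \<eta>"
    using base_nonneg[of T] varrho_nonneg base_eta[of T] eta_m(1) by (auto simp: algebra_simps)
  have "\<bar>cumeet \<rho> (Suc T) (Suc T + Suc k) e' - (\<Sum>f\<in>B - ran \<rho>. ?c) / real (card (B - ran \<rho>))\<bar>
      \<le> E + \<eta> * ((real T + 2) * \<eta>)"
    unfolding cumeet_reveal[OF p(1-3)] known
  proof (rule mean_free_abs[OF p(1) r, of Z])
    show "finite Z" "card Z \<le> R + 2" using card_Z(1)[OF p(1), of "fst e'"] card_Z(3)[OF p(1)] r
      by (auto simp: Z_def)
  next
    fix f assume f: "f \<in> B - ran \<rho>" "fst f \<notin> Z"
    have vn: "fst f < n" using f fst_B by auto
    have nd: "(fst f, i) \<notin> dom (\<rho>(e' \<mapsto> f))" for i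
      using f(2) notin_dom_upd[of "(fst f, i)" \<rho> e' f] by (simp add: Z_def del: dom_fun_upd)
    show "\<bar>(\<Sum>i<dout (fst f). cumeet (\<rho>(e' \<mapsto> f)) (Suc T) (Suc T + k) (fst f, i)) / real (dout (fst f)) - ?c\<bar> \<le> E"
      unfolding E_def
      by (rule mean_vertex_abs[OF vn], rule Suc.IH[OF valid_upd[OF p(1-3) f(1)] _ nd cd])
  next
    fix f assume f: "f \<in> B - ran \<rho>"
    have vn: "fst f < n" using f fst_B by auto
    have "(\<Sum>i<dout (fst f). cumeet (\<rho>(e' \<mapsto> f)) (Suc T) (Suc T + k) (fst f, i)) / real (dout (fst f)) \<le> (real T + 2) * \<eta>"
      by (rule mean_vertex_le[OF vn], rule cumeet_le[OF valid_upd[OF p(1-3) f] _ cd])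
    moreover have "0 \<le> (\<Sum>i<dout (fst f). cumeet (\<rho>(e' \<mapsto> f)) (Suc T) (Suc T + k) (fst f, i)) / real (dout (fst f))"
      by (intro divide_nonneg_nonneg sum_nonneg cumeet_nonneg) simp
    ultimately show "\<bar>(\<Sum>i<dout (fst f). cumeet (\<rho>(e' \<mapsto> f)) (Suc T) (Suc T + k) (fst f, i)) / real (dout (fst f)) - ?c\<bar>
        \<le> E + (real T + 2) * \<eta>" using c E0 by linarith
  qed (use eta_pos in auto)
  then show ?case
    unfolding mean_free_const[OF p(1) r] E_def by (simp add: algebra_simps power2_eq_square)
qed

text \<open>One error for all times within the budget \<open>R\<close>: 11 comes from the first term
  of \<open>cumeet_close\<close>, and 2 from \<open>(k + 4) * (s + 2) \<le> 2 * (R + 2)^2\<close> in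
  the second.\<close>

definition err :: real where "err = 13 * (real R + 2)\<^sup>2 * \<eta>\<^sup>2"

lemma overlap_close:
  assumes "s \<le> s'" "2 * Suc s' \<le> R"
  shows "\<bar>cexp Map.empty (overlap s s') - (base s + rr ^ s / real m)\<bar> \<le> err"
proof -
  have 1: "\<bar>cumeet Map.empty (Suc s) (Suc s') e' - (base s + rr ^ s / real m)\<bar> \<le> err" if "e' \<in> A" for e'
  proof -
    define k where "k = s' - s"
    have s': "Suc s' = Suc s + k" using assms by (simp add: k_def)
    have "\<bar>cumeet Map.empty (Suc s) (Suc s') e' - (base s + rr ^ s / real m)\<bar>
       \<le> 11 * (real s + 1)\<^sup>2 * \<eta>\<^sup>2 + (real k + 4) * (real s + 2) * \<eta>\<^sup>2"
      unfolding s' by (rule cumeet_close) (use that assms in \<open>auto simp: k_def\<close>)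
    also have "\<dots> = (11 * (real s + 1)\<^sup>2 + (real k + 4) * (real s + 2)) * \<eta>\<^sup>2"
      by (simp add: algebra_simps)
    also have "\<dots> \<le> (13 * (real R + 2)\<^sup>2) * \<eta>\<^sup>2"
    proof (rule mult_right_mono)
      have "(real s + 1)\<^sup>2 \<le> (real R + 2)\<^sup>2" using assms by (intro power_mono) auto
      moreover have "(real k + 4) * (real s + 2) \<le> (2 * (real R + 2)) * (real R + 2)"
        using assms by (intro mult_mono) (auto simp: k_def)
      moreover have "(2 * (real R + 2)) * (real R + 2) = 2 * (real R + 2)\<^sup>2"
        by (simp add: power2_eq_square)
      ultimately show "11 * (real s + 1)\<^sup>2 + (real k + 4) * (real s + 2) \<le> 13 * (real R + 2)\<^sup>2"
        by linarith
    qed simp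
    finally show ?thesis by (simp add: err_def)
  qed
  have "(\<Sum>e'\<in>A. cumeet Map.empty (Suc s) (Suc s') e') / real m \<le> base s + rr ^ s / real m + err"
    by (rule mean_tails_le) (use 1 in \<open>force simp: abs_le_iff\<close>)
  moreover have "(\<Sum>e'\<in>A. - cumeet Map.empty (Suc s) (Suc s') e') / real m \<le> - (base s + rr ^ s / real m) + err"
    by (rule mean_tails_le) (use 1 in \<open>force simp: abs_le_iff\<close>)
  ultimately show ?thesis unfolding cexp_overlap by (simp add: sum_negf)
qed

lemma overlap_le:
  assumes "2 * Suc s \<le> R"
  shows "cexp Map.empty (overlap s s) \<le> (real s + 2) * \<eta>"
  unfolding cexp_overlap
  by (rule mean_tails_le, rule cumeet_le[where k = 0, simplified]) (use assms in auto)

text \<open>After expanding the square, the mixed overlap is governed by the smaller time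
  \<open>s\<close>, so \<open>kap\<close> cancels and the main part is
  \<open>(coal / (1 - rr) - 1 / m) * (rr ^ s - rr ^ s')\<close>. By \<open>coal_eq\<close> the first
  factor equals \<open>(gam - 1) / (m * (1 - rr))\<close>. The four errors come from the
  coefficients 1, 1 and 2.\<close>

lemma cexp_sqdist:
  assumes "s \<le> s'" "2 * Suc s' \<le> R"
  shows "cexp Map.empty (sqdist s s') \<le> (gam - 1) / (real m * (1 - rr)) * rr ^ s + 4 * err"
proof -
  have "sqdist s s' = (\<lambda>\<omega>. (overlap s s \<omega> + overlap s' s' \<omega>) - 2 * overlap s s' \<omega>)"
    unfolding sqdist_def overlap_def sum_distrib_left sum.distrib[symmetric] sum_subtractf[symmetric]
    by (intro ext sum.cong refl) (simp add: power2_eq_square algebra_simps)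
  then have "cexp Map.empty (sqdist s s') = cexp Map.empty (overlap s s) + cexp Map.empty (overlap s' s')
      - 2 * cexp Map.empty (overlap s s')"
    by (simp add: cexp_add cexp_diff cexp_cmult)
  also have "\<dots> \<le> (base s' + rr ^ s' / real m) - (base s + rr ^ s / real m) + 4 * err"
    using overlap_close[of s s] overlap_close[of s' s'] overlap_close[of s s'] assms
    unfolding abs_le_iff by simp
  also have "(base s' + rr ^ s' / real m) - (base s + rr ^ s / real m)
      = (gam - 1) / (real m * (1 - rr)) * (rr ^ s - rr ^ s')"
  proof -
    have geo: "(\<Sum>i<T. rr ^ i) = (1 - rr ^ T) / (1 - rr)" for T
      using sum_gp_strict[of rr T] varrho_le by simp
    have alg: "(c + ((g - 1) + z) / M * ((1 - y) / z) + y / M) - (c + ((g - 1) + z) / M * ((1 - x) / z) + x / M)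
        = (g - 1) / (M * z) * (x - y)" if "M \<noteq> 0" "z \<noteq> 0" for c g z M x y :: real
      using that by (simp add: field_simps)
    have "gam - rr = (gam - 1) + (1 - rr)" by simp
    then show ?thesis
      unfolding base_def geo coal_eq using alg[of "real m" "1 - rr"] m_pos varrho_le by simp
  qed
  also have "\<dots> \<le> (gam - 1) / (real m * (1 - rr)) * rr ^ s"
    using gamma_ge_1 varrho_le varrho_nonneg by (intro mult_left_mono) auto
  finally show ?thesis by simp
qed

text \<open>\<open>base s\<close> appears in both terms of \<open>spread_eq\<close> and cancels;
  what remains is geometric decay and second-order error.\<close>

lemma cexp_spread:
  assumes "2 * Suc s \<le> R"
  shows "cexp Map.empty (spread s) \<le> real m * ((1 / 2) ^ s * (1 + 2 * real s * \<eta>) + 34 * (real s + 1)\<^sup>2 * \<eta>\<^sup>2 + err)"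
proof -
  have "cexp Map.empty (spread s) = cexp Map.empty (\<lambda>\<omega>. (\<Sum>e\<in>A. meet (Suc s) e e \<omega>) - real m * overlap s s \<omega>)"
    by (rule cexp_cong) (simp add: spread_eq extensions_envs)
  also have "\<dots> = (\<Sum>e\<in>A. cmeet Map.empty (Suc s) e e) - real m * cexp Map.empty (overlap s s)"
    by (simp add: cexp_diff cexp_sum cexp_cmult cmeet_def)
  also have "\<dots> \<le> (\<Sum>e\<in>A. base s + (1 / 2) ^ s * (1 + 2 * real s * \<eta>) + 34 * (real s + 1)\<^sup>2 * \<eta>\<^sup>2)
      - real m * (base s + rr ^ s / real m - err)"
  proof (intro diff_mono sum_mono mult_left_mono)
    fix e assume "e \<in> A"
    then show "cmeet Map.empty (Suc s) e e \<le> base s + (1 / 2) ^ s * (1 + 2 * real s * \<eta>) + 34 * (real s + 1)\<^sup>2 * \<eta>\<^sup>2"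
      using assms by (intro cmeet_diag_upper) auto
  next
    show "base s + rr ^ s / real m - err \<le> cexp Map.empty (overlap s s)"
      using overlap_close[of s s] assms by (simp add: abs_le_iff)
  qed simp
  also have "\<dots> \<le> real m * ((1 / 2) ^ s * (1 + 2 * real s * \<eta>) + 34 * (real s + 1)\<^sup>2 * \<eta>\<^sup>2 + err)"
    using varrho_nonneg m_pos by (simp add: card_A algebra_simps)
  finally show ?thesis .
qed

end

subsection \<open>Concentration\<close>

context config begin

definition switch :: "nat \<times> nat \<Rightarrow> nat \<times> nat \<Rightarrow> (nat \<times> nat \<Rightarrow> nat \<times> nat) \<Rightarrow> nat \<times> nat \<Rightarrow> nat \<times> nat" where
  "switch f f' \<omega> = restrict (Transposition.transpose f f' \<circ> \<omega>) A"

text \<open>Two bijections cannot differ at a single tail, so the natural bounded-difference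
  condition compares environments that agree off two tails.\<close>

definition switch_lipschitz :: "real \<Rightarrow> ((nat \<times> nat \<Rightarrow> nat \<times> nat) \<Rightarrow> real) \<Rightarrow> bool" where
  "switch_lipschitz c F \<longleftrightarrow> (\<forall>\<omega>\<in>envs din dout n. \<forall>\<omega>'\<in>envs din dout n. \<forall>a\<in>A. \<forall>b\<in>A.
     (\<forall>e. e \<noteq> a \<longrightarrow> e \<noteq> b \<longrightarrow> \<omega> e = \<omega>' e) \<longrightarrow> \<bar>F \<omega> - F \<omega>'\<bar> \<le> c)"

text \<open>Because \<open>f\<close> and \<open>f'\<close> are both free, exchanging them touches no
  revealed arc; it changes only \<open>e\<close> and the tail \<open>b\<close> that led to
  \<open>f'\<close>. This is the coupling of the two conditional laws.\<close>

lemma switch_extensions: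
  assumes v: "valid \<rho>" and e: "e \<in> A" "e \<notin> dom \<rho>" and f: "f \<in> B - ran \<rho>" "f' \<in> B - ran \<rho>"
    and w: "\<omega> \<in> extensions (\<rho>(e \<mapsto> f))"
  shows "switch f f' \<omega> \<in> extensions (\<rho>(e \<mapsto> f'))" "switch f' f (switch f f' \<omega>) = \<omega>"
    "\<exists>b\<in>A. \<forall>x. x \<noteq> e \<longrightarrow> x \<noteq> b \<longrightarrow> \<omega> x = switch f f' \<omega> x"
proof -
  have wE: "\<omega> \<in> envs din dout n" using w by (rule extensions_envs)
  then have bij: "bij_betw \<omega> A B" and ext: "\<omega> \<in> extensional A" by (auto simp: envs_def)
  have inj: "inj_on \<omega> A" and im: "\<omega> ` A = B" using bij by (auto simp: bij_betw_def)
  have "\<omega> \<in> extensions \<rho>" unfolding extensions_split[OF v e] using w f(1) by blast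
  then have dom\<rho>: "\<rho> x = Some (\<omega> x)" if "x \<in> dom \<rho>" for x using that by (auto simp: extensions_def)
  have we: "\<omega> e = f" using w by (auto simp: extensions_def)
  have "bij_betw (Transposition.transpose f f') B B"
    using f by (auto intro!: bij_betwI[where g = "Transposition.transpose f f'"] simp: Transposition.transpose_def)
  then have "bij_betw (Transposition.transpose f f' \<circ> \<omega>) A B" by (rule bij_betw_trans[OF bij])
  moreover have "bij_betw (switch f f' \<omega>) A B = bij_betw (Transposition.transpose f f' \<circ> \<omega>) A B"
    by (rule bij_betw_cong) (simp add: switch_def)
  ultimately have sE: "switch f f' \<omega> \<in> envs din dout n"
    by (simp add: envs_def switch_def)
  have sd: "\<rho> x = Some (switch f f' \<omega> x)" if x: "x \<in> dom \<rho>" for x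
  proof -
    have "\<omega> x \<in> ran \<rho>" using dom\<rho>[OF x] by (rule ranI)
    then have "\<omega> x \<noteq> f" "\<omega> x \<noteq> f'" using f by auto
    moreover have "x \<in> A" using x v by (auto simp: valid_def)
    ultimately show ?thesis using dom\<rho>[OF x] by (simp add: switch_def)
  qed
  have se: "switch f f' \<omega> e = f'" using e we by (simp add: switch_def)
  show "switch f f' \<omega> \<in> extensions (\<rho>(e \<mapsto> f'))"
    unfolding extensions_def
  proof (intro CollectI conjI sE ballI)
    fix x assume "x \<in> dom (\<rho>(e \<mapsto> f'))"
    then show "(\<rho>(e \<mapsto> f')) x = Some (switch f f' \<omega> x)"
      using sd[of x] se by (cases "x = e") auto
  qed
  show "switch f' f (switch f f' \<omega>) = \<omega>"
  proof (rule extensionalityI[where A = A])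
    fix x assume "x \<in> A"
    then show "switch f' f (switch f f' \<omega>) x = \<omega> x"
      by (simp add: switch_def Transposition.transpose_def)
  qed (use ext in \<open>auto simp: switch_def\<close>)
  obtain b where b: "b \<in> A" "\<omega> b = f'" using im f by (metis DiffD1 imageE)
  show "\<exists>b\<in>A. \<forall>x. x \<noteq> e \<longrightarrow> x \<noteq> b \<longrightarrow> \<omega> x = switch f f' \<omega> x"
  proof (rule bexI[OF _ b(1)], intro allI impI)
    fix x assume x: "x \<noteq> e" "x \<noteq> b"
    show "\<omega> x = switch f f' \<omega> x"
    proof (cases "x \<in> A")
      case True
      then have "\<omega> x \<noteq> f" "\<omega> x \<noteq> f'" using x we b inj e(1) by (auto dest: inj_onD)
      then show ?thesis using True by (simp add: switch_def)
    next
      case False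
      then show ?thesis using ext by (simp add: switch_def extensional_def)
    qed
  qed
qed

lemma cexp_switch:
  assumes v: "valid \<rho>" and e: "e \<in> A" "e \<notin> dom \<rho>" and f: "f \<in> B - ran \<rho>" "f' \<in> B - ran \<rho>"
    and F: "switch_lipschitz c F"
  shows "\<bar>cexp (\<rho>(e \<mapsto> f)) F - cexp (\<rho>(e \<mapsto> f')) F\<bar> \<le> c"
proof -
  let ?X = "extensions (\<rho>(e \<mapsto> f))" and ?Y = "extensions (\<rho>(e \<mapsto> f'))"
  have bij: "bij_betw (switch f f') ?X ?Y"
    by (rule bij_betwI[where g = "switch f' f"])
       (use switch_extensions[OF v e f] switch_extensions[OF v e f(2) f(1)] in auto)
  have pos: "0 < card ?X" by (rule extensions_card_pos[OF valid_upd[OF v e f(1)]])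
  have "cexp (\<rho>(e \<mapsto> f')) F = (\<Sum>\<omega>\<in>?X. F (switch f f' \<omega>)) / real (card ?X)"
    unfolding cexp_def bij_betw_same_card[OF bij] sum.reindex_bij_betw[OF bij] ..
  then have "cexp (\<rho>(e \<mapsto> f)) F - cexp (\<rho>(e \<mapsto> f')) F = (\<Sum>\<omega>\<in>?X. F \<omega> - F (switch f f' \<omega>)) / real (card ?X)"
    by (simp only: cexp_def sum_subtractf diff_divide_distrib)
  then have "\<bar>cexp (\<rho>(e \<mapsto> f)) F - cexp (\<rho>(e \<mapsto> f')) F\<bar> = \<bar>\<Sum>\<omega>\<in>?X. F \<omega> - F (switch f f' \<omega>)\<bar> / real (card ?X)"
    by (simp only: abs_divide abs_of_nat)
  also have "\<dots> \<le> (\<Sum>\<omega>\<in>?X. c) / real (card ?X)"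
  proof (rule divide_right_mono, rule order_trans[OF sum_abs sum_mono])
    fix \<omega> assume w: "\<omega> \<in> ?X"
    show "\<bar>F \<omega> - F (switch f f' \<omega>)\<bar> \<le> c"
      using switch_extensions[OF v e f w] extensions_envs[OF w] extensions_envs F e(1)
      unfolding switch_lipschitz_def by blast
  qed simp
  also have "\<dots> = c" by (rule mean_const[OF pos])
  finally show ?thesis .
qed

text \<open>Law of total variance along successive revelations: by \<open>cexp_switch\<close> the
  conditional means for different heads of \<open>e\<close> differ by at most \<open>c\<close>, so
  each revelation adds at most \<open>c^2\<close>.\<close>

lemma cexp_variance:
  assumes F: "switch_lipschitz c F" and c: "0 \<le> c"
  shows "valid \<rho> \<Longrightarrow> cexp \<rho> (\<lambda>\<omega>. (F \<omega>)\<^sup>2) - (cexp \<rho> F)\<^sup>2 \<le> real (m - card (dom \<rho>)) * c\<^sup>2"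
proof (induction "m - card (dom \<rho>)" arbitrary: \<rho>)
  case 0
  then have "card (extensions \<rho>) = 1" by (simp add: card_extensions)
  then obtain \<omega> where "extensions \<rho> = {\<omega>}" by (auto simp: card_1_singleton_iff)
  then show ?case by (simp add: cexp_def)
next
  case (Suc k)
  then have "card (dom \<rho>) < card A" by (simp add: card_A)
  moreover have "dom \<rho> \<subseteq> A" using Suc by (simp add: valid_def)
  ultimately obtain e where e: "e \<in> A" "e \<notin> dom \<rho>" by (metis less_irrefl subsetI subset_antisym)
  let ?F = "B - ran \<rho>"
  define N where "N = real (card ?F)"
  define x where "x f = cexp (\<rho>(e \<mapsto> f)) F" for f
  define mu where "mu = (\<Sum>f\<in>?F. x f) / N"
  have N: "0 < N" using Suc(2) by (simp add: N_def card_free[OF Suc(3)])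
  have mu: "cexp \<rho> F = mu"
    unfolding reveal[OF Suc(3) e, of F] mu_def N_def x_def ..
  have "cexp \<rho> (\<lambda>\<omega>. (F \<omega>)\<^sup>2) = (\<Sum>f\<in>?F. cexp (\<rho>(e \<mapsto> f)) (\<lambda>\<omega>. (F \<omega>)\<^sup>2)) / N"
    unfolding N_def by (rule reveal[OF Suc(3) e])
  also have "\<dots> \<le> (\<Sum>f\<in>?F. (x f)\<^sup>2 + real k * c\<^sup>2) / N"
  proof (rule divide_right_mono, rule sum_mono)
    fix f assume f: "f \<in> ?F"
    have k: "k = m - card (dom (\<rho>(e \<mapsto> f)))"
      using Suc(2) card_dom_upd[OF Suc(3) e(2), of f] by simp
    show "cexp (\<rho>(e \<mapsto> f)) (\<lambda>\<omega>. (F \<omega>)\<^sup>2) \<le> (x f)\<^sup>2 + real k * c\<^sup>2"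
      using Suc(1)[OF k valid_upd[OF Suc(3) e f]] unfolding x_def k[symmetric] by linarith
  qed (use N in simp)
  also have "\<dots> = (\<Sum>f\<in>?F. (x f - mu)\<^sup>2) / N + mu\<^sup>2 + real k * c\<^sup>2"
  proof -
    have s: "(\<Sum>f\<in>?F. x f) = N * mu" using N by (simp add: mu_def)
    have "(\<Sum>f\<in>?F. (x f - mu)\<^sup>2) = (\<Sum>f\<in>?F. (x f)\<^sup>2) + N * mu\<^sup>2 - 2 * mu * (\<Sum>f\<in>?F. x f)"
      by (simp add: power2_diff sum.distrib sum_subtractf sum_distrib_left N_def mult_ac)
    also have "\<dots> = (\<Sum>f\<in>?F. (x f)\<^sup>2) - N * mu\<^sup>2" unfolding s by (simp add: power2_eq_square)
    finally have "(\<Sum>f\<in>?F. (x f)\<^sup>2) = (\<Sum>f\<in>?F. (x f - mu)\<^sup>2) + N * mu\<^sup>2" by simp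
    then show ?thesis using N by (simp add: sum.distrib add_divide_distrib N_def[symmetric])
  qed
  also have "(\<Sum>f\<in>?F. (x f - mu)\<^sup>2) / N \<le> (\<Sum>f\<in>?F. c\<^sup>2) / N"
  proof (rule divide_right_mono, rule sum_mono)
    fix f assume f: "f \<in> ?F"
    have "\<bar>x f - mu\<bar> \<le> c"
      unfolding mu_def N_def
      by (rule mean_close) (use f cexp_switch[OF Suc(3) e f _ F] in \<open>auto simp: x_def\<close>)
    then have "\<bar>x f - mu\<bar>\<^sup>2 \<le> c\<^sup>2" by (rule power_mono) simp
    then show "(x f - mu)\<^sup>2 \<le> c\<^sup>2" by simp
  qed (use N in simp)
  also have "(\<Sum>f\<in>?F. c\<^sup>2) / N = c\<^sup>2"
    unfolding N_def by (rule mean_const) (use N in \<open>simp add: N_def\<close>)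
  finally have "cexp \<rho> (\<lambda>\<omega>. (F \<omega>)\<^sup>2) \<le> c\<^sup>2 + mu\<^sup>2 + real k * c\<^sup>2" by simp
  then show ?case unfolding mu Suc(2)[symmetric] by (simp add: algebra_simps)
qed

definition prb :: "(nat \<times> nat \<Rightarrow> nat \<times> nat) set \<Rightarrow> real" where
  "prb S = measure_pmf.prob (env_pmf din dout n) S"

lemma prb_le_1: "prb S \<le> 1"
  by (simp add: prb_def)

lemma extensions_empty: "extensions Map.empty = envs din dout n"
  by (simp add: extensions_def)

lemma prb_eq: "prb S = cexp Map.empty (\<lambda>\<omega>. of_bool (\<omega> \<in> S))"
proof -
  have "envs din dout n \<noteq> {}"
    using extensions_card_pos[OF valid_empty] extensions_empty by auto
  then have "prb S = real (card (envs din dout n \<inter> S)) / real (card (envs din dout n))"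
    using finite_envs by (simp add: prb_def env_pmf_def measure_pmf_of_set)
  then show ?thesis using finite_envs by (simp add: cexp_def extensions_empty)
qed

lemma markov:
  assumes "0 < c" "\<And>\<omega>. \<omega> \<in> envs din dout n \<Longrightarrow> 0 \<le> F \<omega>"
  shows "prb {\<omega>. c < F \<omega>} \<le> cexp Map.empty F / c"
proof -
  have "cexp Map.empty (\<lambda>\<omega>. of_bool (\<omega> \<in> {\<omega>. c < F \<omega>})) \<le> cexp Map.empty (\<lambda>\<omega>. F \<omega> / c)"
    by (rule cexp_mono) (use assms extensions_envs in \<open>auto simp: of_bool_def field_simps\<close>)
  then show ?thesis by (simp only: prb_eq cexp_divide)
qed

lemma chebyshev:
  assumes F: "switch_lipschitz c F" and c: "0 \<le> c" and d: "0 < d"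
  shows "prb {\<omega>. cexp Map.empty F + d < F \<omega>} \<le> real m * c\<^sup>2 / d\<^sup>2"
proof -
  let ?mu = "cexp Map.empty F"
  have 1: "prb {\<omega>. ?mu + d < F \<omega>} \<le> cexp Map.empty (\<lambda>\<omega>. (F \<omega> - ?mu)\<^sup>2) / d\<^sup>2"
  proof -
    have "of_bool (\<omega> \<in> {\<omega>. ?mu + d < F \<omega>}) \<le> (F \<omega> - ?mu)\<^sup>2 / d\<^sup>2" for \<omega>
    proof (cases "?mu + d < F \<omega>")
      case True
      then have "d\<^sup>2 \<le> (F \<omega> - ?mu)\<^sup>2" using d by (intro power_mono) auto
      then show ?thesis using True d by (simp add: field_simps)
    qed simp
    then show ?thesis unfolding prb_eq cexp_divide[symmetric] by (intro cexp_mono)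
  qed
  have 2: "cexp Map.empty (\<lambda>\<omega>. (F \<omega> - ?mu)\<^sup>2) = cexp Map.empty (\<lambda>\<omega>. (F \<omega>)\<^sup>2) - ?mu\<^sup>2"
  proof -
    have "(\<lambda>\<omega>. (F \<omega> - ?mu)\<^sup>2) = (\<lambda>\<omega>. ((F \<omega>)\<^sup>2 + ?mu\<^sup>2) - (2 * ?mu) * F \<omega>)"
      by (simp add: power2_diff mult_ac)
    then have "cexp Map.empty (\<lambda>\<omega>. (F \<omega> - ?mu)\<^sup>2) = cexp Map.empty (\<lambda>\<omega>. (F \<omega>)\<^sup>2) + ?mu\<^sup>2 - (2 * ?mu) * ?mu"
      by (simp only: cexp_diff cexp_add cexp_cmult cexp_const[OF valid_empty])
    then show ?thesis by (simp add: power2_eq_square)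
  qed
  have 3: "(cexp Map.empty (\<lambda>\<omega>. (F \<omega>)\<^sup>2) - ?mu\<^sup>2) / d\<^sup>2 \<le> real m * c\<^sup>2 / d\<^sup>2"
    using cexp_variance[OF F c valid_empty] by (intro divide_right_mono) auto
  show ?thesis using 1 3 unfolding 2 by (rule order_trans)
qed

section \<open>Sensitivity of the laws \<open>pit\<close> to switching two arcs\<close>

lemma pit_nonneg: "\<omega> \<in> envs din dout n \<Longrightarrow> j < n \<Longrightarrow> 0 \<le> pit n din dout \<omega> s j"
  by (simp add: pit_eq_walk sum_nonneg walk_nonneg del: walk.simps)

lemma pit_Suc: "pit n din dout \<omega> (Suc s) j = (\<Sum>i<n. pit n din dout \<omega> s i * trans dout \<omega> i j)"
  by (simp add: pit_def step_def)

lemma trans_eq_sum: "trans dout \<omega> i j = (\<Sum>k<dout i. of_bool (fst (\<omega> (i, k)) = j)) / real (dout i)"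
proof -
  have "(\<Sum>k<dout i. of_bool (fst (\<omega> (i, k)) = j)) = real (card {k. k < dout i \<and> fst (\<omega> (i, k)) = j})"
    by (simp add: lessThan_def Int_def)
  then show ?thesis by (simp add: trans_def)
qed

lemma trans_nonneg: "0 \<le> trans dout \<omega> i j"
  by (simp add: trans_def)

lemma trans_row:
  assumes "\<omega> \<in> envs din dout n" "i < n"
  shows "(\<Sum>j<n. trans dout \<omega> i j) = 1"
proof -
  have "(\<Sum>j<n. trans dout \<omega> i j) = (\<Sum>k<dout i. \<Sum>j<n. of_bool (fst (\<omega> (i, k)) = j)) / real (dout i)"
    unfolding trans_eq_sum sum_divide_distrib[symmetric] by (simp only: sum.swap[of _ "{..<dout i}"])
  also have "(\<Sum>k<dout i. \<Sum>j<n. of_bool (fst (\<omega> (i, k)) = j)) = (\<Sum>k<dout i. 1 :: real)"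
  proof (rule sum.cong)
    fix k assume "k \<in> {..<dout i}"
    then have "fst (\<omega> (i, k)) < n" using env_B[OF assms(1)] fst_B assms(2) by (simp add: A_iff)
    then show "(\<Sum>j<n. of_bool (fst (\<omega> (i, k)) = j)) = (1 :: real)" by (simp add: of_bool_def)
  qed simp
  finally show ?thesis using dout_ge[OF assms(2)] by simp
qed

lemma trans_col:
  assumes "\<omega> \<in> envs din dout n" "j < n"
  shows "(\<Sum>i<n. trans dout \<omega> i j) \<le> real \<Delta>"
proof -
  have "(\<Sum>i<n. trans dout \<omega> i j) \<le> (\<Sum>i<n. \<Sum>k<dout i. of_bool (fst (\<omega> (i, k)) = j))"
  proof (rule sum_mono)
    fix i assume "i \<in> {..<n}"
    then have d: "1 \<le> real (dout i)" using dout_ge[of i] by simp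
    have "(\<Sum>k<dout i. of_bool (fst (\<omega> (i, k)) = j)) / real (dout i)
        \<le> (\<Sum>k<dout i. of_bool (fst (\<omega> (i, k)) = j)) / 1"
      using d by (intro divide_left_mono sum_nonneg) auto
    then show "trans dout \<omega> i j \<le> (\<Sum>k<dout i. of_bool (fst (\<omega> (i, k)) = j))"
      unfolding trans_eq_sum by simp
  qed
  also have "\<dots> = (\<Sum>e\<in>A. of_bool (fst (\<omega> e) = j))" by (simp only: sum_A)
  also have "\<dots> = (\<Sum>f\<in>B. of_bool (fst f = j))" by (rule sum_env[OF assms(1)])
  also have "\<dots> = real (din j)" using card_heads_vertex[OF assms(2)] by (simp add: Int_def)
  also have "\<dots> \<le> real \<Delta>" using din_le[OF assms(2)] by simp
  finally show ?thesis .
qed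

text \<open>The columns of the transition matrix sum to at most \<open>\<Delta>\<close>, so each
  step multiplies the maximum by at most \<open>\<Delta>\<close>. This is of order
  \<open>1 / m\<close> at fixed times.\<close>

lemma pit_le:
  assumes "\<omega> \<in> envs din dout n" "j < n"
  shows "pit n din dout \<omega> s j \<le> real \<Delta> ^ Suc s / real m"
  using assms(2)
proof (induction s arbitrary: j)
  case 0
  then show ?case using din_le by (simp add: pit_def pi0_def divide_right_mono)
next
  case (Suc s)
  have "pit n din dout \<omega> (Suc s) j \<le> (\<Sum>i<n. real \<Delta> ^ Suc s / real m * trans dout \<omega> i j)"
    unfolding pit_Suc using Suc.IH by (intro sum_mono mult_right_mono trans_nonneg) auto
  also have "\<dots> = real \<Delta> ^ Suc s / real m * (\<Sum>i<n. trans dout \<omega> i j)" by (rule sum_distrib_left[symmetric])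
  also have "\<dots> \<le> real \<Delta> ^ Suc s / real m * real \<Delta>"
    using trans_col[OF assms(1) Suc.prems] by (intro mult_left_mono) auto
  finally show ?case by (simp add: mult_ac)
qed

lemma Delta_ge_1: "1 \<le> real \<Delta>"
  using Delta_ge by simp

text \<open>Only the rows of \<open>fst a\<close> and \<open>fst b\<close> change, each by at most 2
  in l1, and each carries mass at most \<open>K\<close>. So a step adds at most \<open>4 * K\<close>
  to the distance already present, which the stochastic matrix does not enlarge.\<close>

lemma pit_switch_L1:
  assumes w: "\<omega> \<in> envs din dout n" "\<omega>' \<in> envs din dout n" and ab: "a \<in> A" "b \<in> A"
    and agree: "\<And>e. e \<noteq> a \<Longrightarrow> e \<noteq> b \<Longrightarrow> \<omega> e = \<omega>' e"
  shows "(\<Sum>j<n. \<bar>pit n din dout \<omega> s j - pit n din dout \<omega>' s j\<bar>) \<le> 4 * real s * real \<Delta> ^ Suc s / real m"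
proof (induction s)
  case 0
  then show ?case by (simp add: pit_def)
next
  case (Suc s)
  let ?p = "pit n din dout \<omega> s" and ?q = "pit n din dout \<omega>' s"
  let ?P = "trans dout \<omega>" and ?Q = "trans dout \<omega>'"
  define K where "K = real \<Delta> ^ Suc s / real m"
  have rowdiff: "(\<Sum>j<n. \<bar>?P i j - ?Q i j\<bar>) \<le> 2 * (of_bool (i = fst a) + of_bool (i = fst b))" if i: "i < n" for i
  proof (cases "i = fst a \<or> i = fst b")
    case True
    have "(\<Sum>j<n. \<bar>?P i j - ?Q i j\<bar>) \<le> (\<Sum>j<n. ?P i j + ?Q i j)"
    proof (rule sum_mono)
      fix j
      show "\<bar>?P i j - ?Q i j\<bar> \<le> ?P i j + ?Q i j"
        using trans_nonneg[of \<omega> i j] trans_nonneg[of \<omega>' i j] by linarith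
    qed
    also have "\<dots> = 2" using trans_row[OF w(1) i] trans_row[OF w(2) i] by (simp add: sum.distrib)
    also have "\<dots> \<le> 2 * (of_bool (i = fst a) + of_bool (i = fst b))" using True by auto
    finally show ?thesis .
  next
    case False
    then have "(i, k) \<noteq> a \<and> (i, k) \<noteq> b" for k by force
    then have "\<omega> (i, k) = \<omega>' (i, k)" for k using agree by blast
    then have "?P i j = ?Q i j" for j by (simp add: trans_def)
    then show ?thesis by simp
  qed
  have "(\<Sum>j<n. \<bar>pit n din dout \<omega> (Suc s) j - pit n din dout \<omega>' (Suc s) j\<bar>)
      \<le> (\<Sum>j<n. \<Sum>i<n. \<bar>?p i - ?q i\<bar> * ?P i j + ?q i * \<bar>?P i j - ?Q i j\<bar>)"
  proof (rule sum_mono)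
    fix j
    have eq: "pit n din dout \<omega> (Suc s) j - pit n din dout \<omega>' (Suc s) j
        = (\<Sum>i<n. (?p i - ?q i) * ?P i j + ?q i * (?P i j - ?Q i j))"
      unfolding pit_Suc sum_subtractf[symmetric] by (intro sum.cong refl) (simp add: algebra_simps)
    show "\<bar>pit n din dout \<omega> (Suc s) j - pit n din dout \<omega>' (Suc s) j\<bar>
        \<le> (\<Sum>i<n. \<bar>?p i - ?q i\<bar> * ?P i j + ?q i * \<bar>?P i j - ?Q i j\<bar>)"
      unfolding eq
    proof (rule order_trans[OF sum_abs sum_mono])
      fix i assume "i \<in> {..<n}"
      then have "0 \<le> ?q i" using pit_nonneg[OF w(2)] by simp
      then show "\<bar>(?p i - ?q i) * ?P i j + ?q i * (?P i j - ?Q i j)\<bar> \<le> \<bar>?p i - ?q i\<bar> * ?P i j + ?q i * \<bar>?P i j - ?Q i j\<bar>"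
        using abs_triangle_ineq[of "(?p i - ?q i) * ?P i j" "?q i * (?P i j - ?Q i j)"] trans_nonneg[of \<omega> i j]
        by (simp add: abs_mult)
    qed
  qed
  also have "\<dots> = (\<Sum>i<n. \<Sum>j<n. \<bar>?p i - ?q i\<bar> * ?P i j + ?q i * \<bar>?P i j - ?Q i j\<bar>)"
    by (rule sum.swap)
  also have "\<dots> = (\<Sum>i<n. \<bar>?p i - ?q i\<bar> * (\<Sum>j<n. ?P i j) + ?q i * (\<Sum>j<n. \<bar>?P i j - ?Q i j\<bar>))"
    by (simp only: sum.distrib sum_distrib_left)
  also have "\<dots> \<le> (\<Sum>i<n. \<bar>?p i - ?q i\<bar> * 1 + K * (2 * (of_bool (i = fst a) + of_bool (i = fst b))))"
  proof (rule sum_mono, rule add_mono)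
    fix i assume i: "i \<in> {..<n}"
    show "\<bar>?p i - ?q i\<bar> * (\<Sum>j<n. ?P i j) \<le> \<bar>?p i - ?q i\<bar> * 1" using trans_row[OF w(1)] i by simp
    show "?q i * (\<Sum>j<n. \<bar>?P i j - ?Q i j\<bar>) \<le> K * (2 * (of_bool (i = fst a) + of_bool (i = fst b)))"
      unfolding K_def using pit_le[OF w(2)] pit_nonneg[OF w(2)] rowdiff i
      by (intro mult_mono sum_nonneg) auto
  qed
  also have "\<dots> = (\<Sum>i<n. \<bar>?p i - ?q i\<bar>) + 4 * K"
    using fst_A[OF ab(1)] fst_A[OF ab(2)]
    by (simp add: sum.distrib sum_distrib_left[symmetric] of_bool_def)
  also have "\<dots> \<le> 4 * real s * K + 4 * K" using Suc.IH by (simp add: K_def)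
  also have "\<dots> = 4 * real (Suc s) * K" by (simp add: algebra_simps)
  also have "\<dots> \<le> 4 * real (Suc s) * (real \<Delta> ^ Suc (Suc s) / real m)"
    unfolding K_def using Delta_ge_1
    by (intro mult_left_mono divide_right_mono power_increasing) auto
  finally show ?case by simp
qed

text \<open>Factor the difference of squares: one factor is small in l1 by
  \<open>pit_switch_L1\<close>, the other pointwise by \<open>pit_le\<close>. For fixed
  \<open>h\<close> the constant is \<open>O(1 / m^2)\<close>, so \<open>n\<close> times this
  quantity has variance \<open>O(1 / m)\<close>. The 16 is \<open>(4 + 4) * 2\<close>.\<close>

lemma sqdist_lipschitz:
  assumes "t \<le> h"
  shows "switch_lipschitz (16 * real h * (real \<Delta> ^ Suc h)\<^sup>2 / (real m)\<^sup>2)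
    (\<lambda>\<omega>. \<Sum>j<n. (pit n din dout \<omega> t j - pit n din dout \<omega> h j)\<^sup>2)"
  unfolding switch_lipschitz_def
proof (intro ballI impI)
  fix \<omega> \<omega>' a b
  assume w: "\<omega> \<in> envs din dout n" "\<omega>' \<in> envs din dout n" and ab: "a \<in> A" "b \<in> A"
    and agree: "\<forall>e. e \<noteq> a \<longrightarrow> e \<noteq> b \<longrightarrow> \<omega> e = \<omega>' e"
  define K where "K = real \<Delta> ^ Suc h / real m"
  let ?x = "\<lambda>j. pit n din dout \<omega> t j - pit n din dout \<omega> h j"
  let ?y = "\<lambda>j. pit n din dout \<omega>' t j - pit n din dout \<omega>' h j"
  have L1: "(\<Sum>j<n. \<bar>pit n din dout \<omega> s j - pit n din dout \<omega>' s j\<bar>) \<le> 4 * real h * K" if "s \<le> h" for s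
  proof -
    have "(\<Sum>j<n. \<bar>pit n din dout \<omega> s j - pit n din dout \<omega>' s j\<bar>) \<le> 4 * real s * real \<Delta> ^ Suc s / real m"
      by (rule pit_switch_L1[OF w ab]) (use agree in auto)
    also have "\<dots> \<le> 4 * real h * real \<Delta> ^ Suc h / real m"
      using that Delta_ge_1 by (intro divide_right_mono mult_mono power_increasing) auto
    finally show ?thesis by (simp add: K_def)
  qed
  have bound: "\<bar>pit n din dout v t j - pit n din dout v h j\<bar> \<le> K" if "v \<in> envs din dout n" "j < n" for v j
  proof -
    have "pit n din dout v t j \<le> real \<Delta> ^ Suc t / real m" by (rule pit_le[OF that])
    also have "\<dots> \<le> K" unfolding K_def using assms Delta_ge_1
      by (intro divide_right_mono power_increasing) auto
    finally have "pit n din dout v t j \<le> K" .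
    moreover have "pit n din dout v h j \<le> K" unfolding K_def by (rule pit_le[OF that])
    ultimately show ?thesis using pit_nonneg[OF that, of t] pit_nonneg[OF that, of h] by linarith
  qed
  have "\<bar>(\<Sum>j<n. (?x j)\<^sup>2) - (\<Sum>j<n. (?y j)\<^sup>2)\<bar> = \<bar>\<Sum>j<n. (?x j - ?y j) * (?x j + ?y j)\<bar>"
    by (simp only: sum_subtractf[symmetric]) (simp add: power2_eq_square algebra_simps)
  also have "\<dots> \<le> (\<Sum>j<n. \<bar>?x j - ?y j\<bar> * (2 * K))"
  proof (rule order_trans[OF sum_abs sum_mono])
    fix j assume "j \<in> {..<n}"
    then have "\<bar>?x j + ?y j\<bar> \<le> 2 * K" using bound[OF w(1), of j] bound[OF w(2), of j] by simp
    then show "\<bar>(?x j - ?y j) * (?x j + ?y j)\<bar> \<le> \<bar>?x j - ?y j\<bar> * (2 * K)"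
      unfolding abs_mult by (intro mult_left_mono) auto
  qed
  also have "\<dots> = (\<Sum>j<n. \<bar>?x j - ?y j\<bar>) * (2 * K)" by (rule sum_distrib_right[symmetric])
  also have "\<dots> \<le> (8 * real h * K) * (2 * K)"
  proof (rule mult_right_mono)
    have "(\<Sum>j<n. \<bar>?x j - ?y j\<bar>) \<le> (\<Sum>j<n. \<bar>pit n din dout \<omega> t j - pit n din dout \<omega>' t j\<bar> + \<bar>pit n din dout \<omega> h j - pit n din dout \<omega>' h j\<bar>)"
      by (rule sum_mono) linarith
    also have "\<dots> \<le> 8 * real h * K"
      using L1[OF assms] L1[of h] by (simp add: sum.distrib)
    finally show "(\<Sum>j<n. \<bar>?x j - ?y j\<bar>) \<le> 8 * real h * K" .
    show "0 \<le> 2 * K" using Delta_ge_1 by (simp add: K_def)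
  qed
  also have "\<dots> = 16 * real h * (real \<Delta> ^ Suc h)\<^sup>2 / (real m)\<^sup>2"
    by (simp add: K_def power2_eq_square)
  finally show "\<bar>(\<Sum>j<n. (?x j)\<^sup>2) - (\<Sum>j<n. (?y j)\<^sup>2)\<bar> \<le> 16 * real h * (real \<Delta> ^ Suc h)\<^sup>2 / (real m)\<^sup>2" .
qed

end

section \<open>Union bound over the bad events\<close>

context config_bounds begin

lemma n_cexp_sqdist:
  assumes "s \<le> s'" "2 * Suc s' \<le> R"
  shows "real n * cexp Map.empty (sqdist s s') \<le> bound s + 4 * real n * err"
  using mult_left_mono[OF cexp_sqdist[OF assms], of "real n"] by (simp add: bound_def algebra_simps)

text \<open>One summand per bad event: Chebyshev for the distance from \<open>t\<close> to
  \<open>h\<close>, Markov for the distance from \<open>h\<close> to \<open>s\<close>, for the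
  spread, and for the overlap; the last two control the distance from \<open>s\<close> to every
  invariant law.\<close>

lemma good_probability:
  fixes t h s :: nat
  defines "c \<equiv> 16 * real h * (real \<Delta> ^ Suc h)\<^sup>2 / (real m)\<^sup>2"
  assumes ths: "t \<le> h" "h \<le> s" "2 * Suc s \<le> R"
    and pos: "0 < \<epsilon>" "0 < \<delta>" "0 < \<tau>"
    and small: "\<tau> * real \<Delta> \<le> \<epsilon> / 2" "\<delta> * (5 + \<tau> + 4 / \<tau>) \<le> \<epsilon> / 2"
    and err: "4 * real n * err \<le> \<delta> / 2" and n2: "2 \<le> sqrt (real n)"
  shows "1 - prb {\<omega>. \<forall>\<pi>. invariant_prob n dout \<omega> \<pi> \<longrightarrow> 4 * (tv_dist n (pit n din dout \<omega> t) \<pi>)\<^sup>2 \<le> bound t + \<epsilon>}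
    \<le> real m * (real n * c)\<^sup>2 / (\<delta> / 2)\<^sup>2 + (real \<Delta> * (1 / 2) ^ h + 4 * real n * err) / \<delta>
      + real m * ((1 / 2) ^ s * (1 + 2 * real s * \<eta>) + 34 * (real s + 1)\<^sup>2 * \<eta>\<^sup>2 + err) * sqrt (real n)
      + real n * ((real s + 2) * \<eta>) / (\<delta> * sqrt (real n) / 2)"
proof -
  define G where "G = {\<omega>. \<forall>\<pi>. invariant_prob n dout \<omega> \<pi> \<longrightarrow> 4 * (tv_dist n (pit n din dout \<omega> t) \<pi>)\<^sup>2 \<le> bound t + \<epsilon>}"
  have n0: "0 < real n" using n_pos by simp
  let ?V = "\<lambda>\<omega>. real n * sqdist t h \<omega>"
  let ?U = "\<lambda>\<omega>. real n * sqdist h s \<omega>"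
  let ?Y = "\<lambda>\<omega>. real n * overlap s s \<omega>"
  define E1 where "E1 = {\<omega>. cexp Map.empty ?V + \<delta> / 2 < ?V \<omega>}"
  define E2 where "E2 = {\<omega>. \<delta> < ?U \<omega>}"
  \<comment> \<open>The thresholds of \<open>E3\<close> and \<open>E4\<close> are tied together:
    twice their product is \<open>\<delta>\<close>, the bound required from
    \<open>invariant_sqdist\<close>. With the final choice of \<open>s\<close> and
    \<open>\<eta>\<close> the means are, up to logarithms, at most of order \<open>1 / n\<close> and
    1, so splitting by \<open>sqrt n\<close> leaves room on both sides.\<close>
  define E3 where "E3 = {\<omega>. 1 / sqrt (real n) < spread s \<omega>}"
  define E4 where "E4 = {\<omega>. \<delta> * sqrt (real n) / 2 < ?Y \<omega>}"
  have good: "\<omega> \<in> G" if w: "\<omega> \<in> envs din dout n" and nE: "\<omega> \<notin> E1" "\<omega> \<notin> E2" "\<omega> \<notin> E3" "\<omega> \<notin> E4" for \<omega>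
    unfolding G_def
  proof (intro CollectI allI impI)
    fix p assume p: "invariant_prob n dout \<omega> p"
    have "cexp Map.empty ?V \<le> bound t + 4 * real n * err"
      unfolding cexp_cmult using ths by (intro n_cexp_sqdist) auto
    then have V: "?V \<omega> \<le> bound t + \<delta>" using nE(1) err by (simp add: E1_def)
    have U: "?U \<omega> \<le> \<delta>" using nE(2) by (simp add: E2_def)
    have S: "spread s \<omega> \<le> 1 / sqrt (real n)" using nE(3) by (simp add: E3_def)
    have Y: "?Y \<omega> \<le> \<delta> * sqrt (real n) / 2" using nE(4) by (simp add: E4_def)
    have S0: "0 \<le> spread s \<omega>" by (auto simp: spread_def intro!: sum_nonneg)
    have Y0: "0 \<le> overlap s s \<omega>" by (auto simp: overlap_def intro!: sum_nonneg)
    have "1 / sqrt (real n) \<le> 1 / 2" using n2 n0 by (intro divide_left_mono) auto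
    then have S2: "spread s \<omega> \<le> 1 / 2" using S by linarith
    have "real n * (\<Sum>j<n. (p j - pit n din dout \<omega> s j)\<^sup>2) \<le> real n * (2 * overlap s s \<omega> * spread s \<omega>)"
      using invariant_sqdist[OF w p S2] by (intro mult_left_mono) auto
    also have "\<dots> = 2 * ?Y \<omega> * spread s \<omega>" by simp
    also have "\<dots> \<le> 2 * (\<delta> * sqrt (real n) / 2) * (1 / sqrt (real n))"
      using Y S S0 pos Y0 by (intro mult_mono) auto
    also have "\<dots> = \<delta>" using n0 by simp
    finally have X: "real n * (\<Sum>j<n. (pit n din dout \<omega> s j - p j)\<^sup>2) \<le> \<delta>"
      by (simp add: power2_commute)
    have V0: "0 \<le> ?V \<omega>" and U0: "0 \<le> ?U \<omega>" by (auto simp: sqdist_def intro!: mult_nonneg_nonneg sum_nonneg)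
    have "4 * (tv_dist n (pit n din dout \<omega> t) p)\<^sup>2 \<le> (sqrt (?V \<omega>) + sqrt (?U \<omega>) + sqrt \<delta>)\<^sup>2"
      by (rule tv_le[where ?\<nu>1.0 = "pit n din dout \<omega> h" and ?\<nu>2.0 = "pit n din dout \<omega> s"])
         (use V0 U0 X pos in \<open>auto simp: sqdist_def\<close>)
    also have "\<dots> \<le> bound t + \<epsilon>"
    proof (rule three_terms_square_le[OF _ _ _ _ pos(3) _ small])
      have "(1 / 2 :: real) ^ t \<le> 1" by (rule power_le_one) auto
      then have "real \<Delta> * (1 / 2) ^ t \<le> real \<Delta> * 1" by (intro mult_left_mono) auto
      then show "bound t \<le> real \<Delta>" using bound_le[of t] by linarith
    qed (use V U V0 U0 pos in auto)
    finally show "4 * (tv_dist n (pit n din dout \<omega> t) p)\<^sup>2 \<le> bound t + \<epsilon>" .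
  qed
  have "1 = cexp Map.empty (\<lambda>_. 1)" by (simp add: cexp_const)
  also have "\<dots> \<le> cexp Map.empty (\<lambda>\<omega>. of_bool (\<omega> \<in> G) + of_bool (\<omega> \<in> E1) + of_bool (\<omega> \<in> E2) + of_bool (\<omega> \<in> E3) + of_bool (\<omega> \<in> E4))"
    by (rule cexp_mono) (use good extensions_envs in \<open>auto simp: of_bool_def\<close>)
  also have "\<dots> = prb G + prb E1 + prb E2 + prb E3 + prb E4"
    by (simp only: cexp_add prb_eq)
  finally have union: "1 - prb G \<le> prb E1 + prb E2 + prb E3 + prb E4" by simp
  have lip: "switch_lipschitz (real n * c) ?V"
  proof -
    have "switch_lipschitz c (sqdist t h)"
      using sqdist_lipschitz[OF ths(1)] unfolding c_def sqdist_def[abs_def] .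
    then show ?thesis unfolding switch_lipschitz_def
      by (auto simp: abs_mult right_diff_distrib[symmetric] intro!: mult_left_mono)
  qed
  have c0: "0 \<le> c" by (simp add: c_def)
  have p1: "prb E1 \<le> real m * (real n * c)\<^sup>2 / (\<delta> / 2)\<^sup>2"
    unfolding E1_def by (rule chebyshev[OF lip]) (use c0 pos in auto)
  have p2: "prb E2 \<le> (real \<Delta> * (1 / 2) ^ h + 4 * real n * err) / \<delta>"
  proof -
    have "prb E2 \<le> cexp Map.empty ?U / \<delta>"
      unfolding E2_def by (rule markov) (use pos in \<open>auto simp: sqdist_def intro!: mult_nonneg_nonneg sum_nonneg\<close>)
    also have "\<dots> \<le> (real \<Delta> * (1 / 2) ^ h + 4 * real n * err) / \<delta>"
      unfolding cexp_cmult using n_cexp_sqdist[of h s] bound_le[of h] ths pos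
      by (intro divide_right_mono) auto
    finally show ?thesis .
  qed
  have p3: "prb E3 \<le> real m * ((1 / 2) ^ s * (1 + 2 * real s * \<eta>) + 34 * (real s + 1)\<^sup>2 * \<eta>\<^sup>2 + err) * sqrt (real n)"
  proof -
    have "prb E3 \<le> cexp Map.empty (spread s) / (1 / sqrt (real n))"
      unfolding E3_def by (rule markov) (use n0 in \<open>auto simp: spread_def intro!: sum_nonneg\<close>)
    also have "\<dots> = cexp Map.empty (spread s) * sqrt (real n)" by simp
    also have "\<dots> \<le> real m * ((1 / 2) ^ s * (1 + 2 * real s * \<eta>) + 34 * (real s + 1)\<^sup>2 * \<eta>\<^sup>2 + err) * sqrt (real n)"
      by (intro mult_right_mono cexp_spread ths) auto
    finally show ?thesis .
  qed
  have p4: "prb E4 \<le> real n * ((real s + 2) * \<eta>) / (\<delta> * sqrt (real n) / 2)"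
  proof -
    have "prb E4 \<le> cexp Map.empty ?Y / (\<delta> * sqrt (real n) / 2)"
      unfolding E4_def
      by (rule markov) (use n0 pos in \<open>auto simp: overlap_def pit_nonneg intro!: mult_nonneg_nonneg sum_nonneg\<close>)
    also have "\<dots> \<le> real n * ((real s + 2) * \<eta>) / (\<delta> * sqrt (real n) / 2)"
      unfolding cexp_cmult using pos ths by (intro divide_right_mono mult_left_mono overlap_le) auto
    finally show ?thesis .
  qed
  show ?thesis using union p1 p2 p3 p4 unfolding G_def by linarith
qed

end

subsection \<open>Asymptotics\<close>

text \<open>The factor 2 makes \<open>(1 / 2) ^ len n\<close> at most \<open>1 / n^2\<close>, which
  beats the \<open>m * sqrt n\<close> that Markov's inequality for the spread brings in.\<close>

definition len :: "nat \<Rightarrow> nat" where "len n = nat \<lceil>2 * log 2 (real n)\<rceil>"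

text \<open>Dominates both \<open>R + 3\<close> for \<open>R = 2 * Suc (len n)\<close> and \<open>len n + 2\<close>.\<close>
definition elen :: "nat \<Rightarrow> real" where "elen n = 4 * log 2 (real n) + 9"

lemma len_bounds:
  assumes "0 < n"
  shows "real (len n) \<le> 2 * log 2 (real n) + 1" "(1 / 2) ^ len n \<le> 1 / (real n)\<^sup>2"
proof -
  have l0: "0 \<le> log 2 (real n)" using assms by simp
  then show "real (len n) \<le> 2 * log 2 (real n) + 1" unfolding len_def by linarith
  have "(real n)\<^sup>2 = (2 powr log 2 (real n)) powr 2" using assms by (simp add: powr_numeral)
  also have "\<dots> = 2 powr (2 * log 2 (real n))" by (simp only: powr_powr mult.commute)
  also have "\<dots> \<le> 2 powr real (len n)" unfolding len_def using l0 by (intro powr_mono) linarith+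
  also have "\<dots> = 2 ^ len n" by (simp add: powr_realpow)
  finally have "1 / 2 ^ len n \<le> 1 / (real n)\<^sup>2" using assms by (intro divide_left_mono) auto
  then show "(1 / 2) ^ len n \<le> 1 / (real n)\<^sup>2" by (simp add: power_one_over)
qed

text \<open>Dominates the right-hand side of \<open>good_probability\<close> up to its term in \<open>(1 / 2) ^ h\<close>, with
  \<open>\<eta> = D * elen n / n\<close>.\<close>
definition failure :: "real \<Rightarrow> nat \<Rightarrow> real \<Rightarrow> real \<Rightarrow> real" where
  "failure D h \<delta> x = D * x * (x * (16 * real h * (D ^ Suc h)\<^sup>2 / x\<^sup>2))\<^sup>2 / (\<delta> / 2)\<^sup>2
    + 4 * x * (13 * (4 * log 2 x + 9)\<^sup>2 * (D * (4 * log 2 x + 9) / x)\<^sup>2) / \<delta>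
    + D * x * (1 / x\<^sup>2 * (1 + 2 * (4 * log 2 x + 9) * (D * (4 * log 2 x + 9) / x))
        + 47 * (4 * log 2 x + 9)\<^sup>2 * (D * (4 * log 2 x + 9) / x)\<^sup>2) * sqrt x
    + x * ((4 * log 2 x + 9) * (D * (4 * log 2 x + 9) / x)) / (\<delta> * sqrt x / 2)"

lemma failure_tendsto:
  assumes "0 < D" "0 < \<delta>"
  shows "(\<lambda>n. failure D h \<delta> (real n)) \<longlonglongrightarrow> 0"
proof -
  \<comment> \<open>The factors depending on the symbolic exponent \<open>h\<close> are gathered
    into one constant, so that the limit of the rest is explicit in \<open>n\<close>.\<close>
  define K where "K = 16 * real h * (D ^ Suc h)\<^sup>2"
  have "((\<lambda>n. real n * (real n / (real n)\<^sup>2)\<^sup>2) \<longlongrightarrow> 0) sequentially" by real_asymp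
  then have "((\<lambda>n. D * K\<^sup>2 / (\<delta> / 2)\<^sup>2 * (real n * (real n / (real n)\<^sup>2)\<^sup>2)) \<longlongrightarrow> 0) sequentially"
    by (rule tendsto_mult_right_zero)
  then have 1: "((\<lambda>n. D * real n * (real n * (K / (real n)\<^sup>2))\<^sup>2 / (\<delta> / 2)\<^sup>2) \<longlongrightarrow> 0) sequentially"
    by (simp add: power_mult_distrib power_divide mult_ac)
  have 2: "((\<lambda>n. 4 * real n * (13 * (4 * log 2 (real n) + 9)\<^sup>2 * (D * (4 * log 2 (real n) + 9) / real n)\<^sup>2) / \<delta>) \<longlongrightarrow> 0) sequentially"
    using assms by real_asymp
  have 3: "((\<lambda>n. D * real n * (1 / (real n)\<^sup>2 * (1 + 2 * (4 * log 2 (real n) + 9) * (D * (4 * log 2 (real n) + 9) / real n))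
        + 47 * (4 * log 2 (real n) + 9)\<^sup>2 * (D * (4 * log 2 (real n) + 9) / real n)\<^sup>2) * sqrt (real n)) \<longlongrightarrow> 0) sequentially"
    using assms by real_asymp
  have 4: "((\<lambda>n. real n * ((4 * log 2 (real n) + 9) * (D * (4 * log 2 (real n) + 9) / real n)) / (\<delta> * sqrt (real n) / 2)) \<longlongrightarrow> 0) sequentially"
    using assms by real_asymp
  show ?thesis
    unfolding failure_def K_def[symmetric]
    using tendsto_add[OF tendsto_add[OF tendsto_add[OF 1 2] 3] 4] by simp
qed

text \<open>Convergence in probability is expressed by adding an arbitrary \<open>\<epsilon>\<close>
  to the bound; the quantifier over \<open>\<pi>\<close> also covers environments with several
  invariant laws. Constants are fixed in the order \<open>\<tau>\<close>, \<open>\<delta>\<close>,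
  \<open>h\<close>, and only then \<open>n\<close>.\<close>

theorem theorem3:
  fixes Din Dout :: "nat \<Rightarrow> nat \<Rightarrow> nat" and \<Delta> t :: nat
  assumes "\<And>n i. i < n \<Longrightarrow> 2 \<le> Din n i \<and> 2 \<le> Dout n i"
      and "\<And>n i. i < n \<Longrightarrow> Din n i \<le> \<Delta> \<and> Dout n i \<le> \<Delta>"
      and "\<And>n. num_edges (Din n) n = num_edges (Dout n) n"
  shows "\<forall>\<epsilon>>0. (\<lambda>n. measure_pmf.prob (env_pmf (Din n) (Dout n) n)
           {\<omega>. \<forall>\<pi>. invariant_prob n (Dout n) \<omega> \<pi> \<longrightarrow>
                4 * (tv_dist n (pit n (Din n) (Dout n) \<omega> t) \<pi>)\<^sup>2
                  \<le> real n * (gamma_deg (Din n) (Dout n) n - 1)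
                      / (real (num_edges (Din n) n) * (1 - varrho (Din n) (Dout n) n))
                      * varrho (Din n) (Dout n) n ^ t + \<epsilon>})
         \<longlonglongrightarrow> 1"
proof (intro allI impI)
  fix \<epsilon> :: real assume eps: "0 < \<epsilon>"
  define G where "G n = {\<omega>. \<forall>\<pi>. invariant_prob n (Dout n) \<omega> \<pi> \<longrightarrow>
                4 * (tv_dist n (pit n (Din n) (Dout n) \<omega> t) \<pi>)\<^sup>2
                  \<le> real n * (gamma_deg (Din n) (Dout n) n - 1)
                      / (real (num_edges (Din n) n) * (1 - varrho (Din n) (Dout n) n))
                      * varrho (Din n) (Dout n) n ^ t + \<epsilon>}" for n
  define D where "D = real \<Delta>"
  have "2 \<le> \<Delta>" using assms(1)[of 0 1] assms(2)[of 0 1] by simp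
  then have D: "2 \<le> D" by (simp add: D_def)
  \<comment> \<open>\<open>\<tau>\<close> and \<open>\<delta>\<close> are solved from the two
    smallness conditions of \<open>three_terms_square_le\<close>, with \<open>D\<close> as the
    uniform bound on the leading term.\<close>
  define \<tau> where "\<tau> = \<epsilon> / (2 * D)"
  have lam: "0 < \<tau>" "\<tau> * D \<le> \<epsilon> / 2" using eps D by (auto simp: \<tau>_def)
  define q where "q = 5 + \<tau> + 4 / \<tau>"
  define \<delta> where "\<delta> = \<epsilon> / 2 / q"
  have "0 < q" using lam(1) by (simp add: q_def add_pos_pos)
  then have "0 < \<delta>" "\<delta> * q \<le> \<epsilon> / 2" using eps by (auto simp: \<delta>_def)
  then have del: "0 < \<delta>" "\<delta> * (5 + \<tau> + 4 / \<tau>) \<le> \<epsilon> / 2" by (auto simp: q_def)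
  have "(\<lambda>n. measure_pmf.prob (env_pmf (Din n) (Dout n) n) (G n)) \<longlonglongrightarrow> 1"
  proof (rule tendstoI)
    fix \<kappa> :: real assume kappa: "0 < \<kappa>"
    \<comment> \<open>Half of \<open>\<kappa>\<close> is spent on a fixed \<open>h\<close>,
      independent of \<open>n\<close>; the other half is left for \<open>failure\<close>.\<close>
    have "(\<lambda>h. D * (1 / 2) ^ h / \<delta>) \<longlonglongrightarrow> 0"
      by (intro tendsto_divide_zero tendsto_mult_right_zero LIMSEQ_realpow_zero) auto
    then have "\<forall>\<^sub>F h in sequentially. D * (1 / 2) ^ h / \<delta> < \<kappa> / 2 \<and> t \<le> h"
      using kappa by (intro eventually_conj order_tendstoD(2) eventually_ge_at_top) auto
    then obtain h where h: "D * (1 / 2) ^ h / \<delta> < \<kappa> / 2" "t \<le> h"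
      by (auto simp: eventually_sequentially)
    have ev1: "\<forall>\<^sub>F n in sequentially. failure D h \<delta> (real n) < \<kappa> / 2"
      using kappa D del by (intro order_tendstoD(2)[OF failure_tendsto]) auto
    have ev2: "\<forall>\<^sub>F n in sequentially. elen n \<le> real n"
      unfolding elen_def by real_asymp
    have ev3: "\<forall>\<^sub>F n in sequentially. D * elen n / real n \<le> 1 / 6"
    proof -
      have "((\<lambda>n. D * elen n / real n) \<longlongrightarrow> 0) sequentially" unfolding elen_def by real_asymp
      then have "\<forall>\<^sub>F n in sequentially. D * elen n / real n < 1 / 6" by (rule order_tendstoD) simp
      then show ?thesis by eventually_elim simp
    qed
    have ev4: "\<forall>\<^sub>F n in sequentially. 4 * real n * (13 * (elen n)\<^sup>2 * (D * elen n / real n)\<^sup>2) \<le> \<delta> / 2"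
    proof -
      have "((\<lambda>n. 4 * real n * (13 * (elen n)\<^sup>2 * (D * elen n / real n)\<^sup>2)) \<longlongrightarrow> 0) sequentially"
        unfolding elen_def using D by real_asymp
      then have "\<forall>\<^sub>F n in sequentially. 4 * real n * (13 * (elen n)\<^sup>2 * (D * elen n / real n)\<^sup>2) < \<delta> / 2"
        by (rule order_tendstoD) (use del in simp)
      then show ?thesis by eventually_elim simp
    qed
    have ev5: "\<forall>\<^sub>F n in sequentially. real h \<le> 2 * log 2 (real n)" by real_asymp
    have ev6: "\<forall>\<^sub>F n in sequentially. 2 \<le> sqrt (real n)" by real_asymp
    show "\<forall>\<^sub>F n in sequentially. dist (measure_pmf.prob (env_pmf (Din n) (Dout n) n) (G n)) 1 < \<kappa>"
      using ev1 ev2 ev3 ev4 ev5 ev6 eventually_gt_at_top[of 0]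
    proof eventually_elim
      case (elim n)
      note n0 = elim(7)
      define s where "s = len n"
      define R where "R = 2 * Suc s"
      define \<eta> where "\<eta> = D * elen n / real n"
      have s: "real s \<le> 2 * log 2 (real n) + 1" "(1 / 2) ^ s \<le> 1 / (real n)\<^sup>2"
        unfolding s_def by (rule len_bounds[OF n0])+
      have "real h \<le> real s" using elim(5) unfolding s_def len_def by linarith
      then have hs: "h \<le> s" by simp
      have l0: "0 \<le> log 2 (real n)" using n0 by simp
      have R: "real R + 3 \<le> elen n" "real s + 2 \<le> elen n" using s(1) l0 by (auto simp: R_def elen_def)
      have e0: "0 \<le> elen n" using l0 by (simp add: elen_def)
      have eta0: "0 \<le> \<eta>" using e0 D by (simp add: \<eta>_def)
      interpret config "Din n" "Dout n" n \<Delta>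
        by standard (use assms n0 in auto)
      have m2: "2 * real n \<le> real m" "real m \<le> D * real n" using m_ge m_le by (auto simp: D_def simp flip: of_nat_mult)
      interpret config_bounds "Din n" "Dout n" n \<Delta> R \<eta>
      proof
        show "R + 2 < m" using R(1) elim(2) m2 n0 by linarith
        \<comment> \<open>As \<open>R + 3 \<le> elen n \<le> n\<close> and
          \<open>m \<ge> 2 * n\<close>, at least \<open>n\<close> heads always stay free; hence the
          denominator \<open>n\<close> in \<open>\<eta>\<close>.\<close>
        have "real n \<le> real m - real R - 1" using R(1) elim(2) m2 by linarith
        then have "\<eta> * real n \<le> \<eta> * (real m - real R - 1)" using eta0 by (rule mult_left_mono)
        moreover have "\<eta> * real n = D * elen n" using n0 by (simp add: \<eta>_def)
        moreover have "D * (real R + 3) \<le> D * elen n" using R D by (intro mult_left_mono) auto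
        ultimately show "real \<Delta> * (real R + 3) \<le> \<eta> * (real m - real R - 1)" by (simp add: D_def)
        show "\<eta> \<le> 1 / 6" using elim(3) by (simp add: \<eta>_def)
      qed
      have err': "err \<le> 13 * (elen n)\<^sup>2 * \<eta>\<^sup>2"
        unfolding err_def using R(1) by (intro mult_right_mono mult_left_mono power_mono) auto
      then have nerr: "4 * real n * err \<le> 4 * real n * (13 * (elen n)\<^sup>2 * \<eta>\<^sup>2)" by (intro mult_left_mono) auto
      then have err2: "4 * real n * err \<le> \<delta> / 2" using elim(4) by (simp add: \<eta>_def)
      have sq: "(real s + 1)\<^sup>2 \<le> (elen n)\<^sup>2" using R(2) by (intro power_mono) auto
      let ?c = "16 * real h * (real \<Delta> ^ Suc h)\<^sup>2"
      have t1: "real m * (real n * (?c / (real m)\<^sup>2))\<^sup>2 / (\<delta> / 2)\<^sup>2 \<le> D * real n * (real n * (16 * real h * (D ^ Suc h)\<^sup>2 / (real n)\<^sup>2))\<^sup>2 / (\<delta> / 2)\<^sup>2"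
        unfolding D_def[symmetric]
        using m2 n0 D by (intro divide_right_mono mult_mono power_mono mult_left_mono divide_left_mono mult_nonneg_nonneg) auto
      have t2: "(real \<Delta> * (1 / 2) ^ h + 4 * real n * err) / \<delta> \<le> D * (1 / 2) ^ h / \<delta> + 4 * real n * (13 * (elen n)\<^sup>2 * \<eta>\<^sup>2) / \<delta>"
        unfolding add_divide_distrib[symmetric] D_def
        using nerr del by (intro divide_right_mono add_left_mono) auto
      have t3: "real m * ((1 / 2) ^ s * (1 + 2 * real s * \<eta>) + 34 * (real s + 1)\<^sup>2 * \<eta>\<^sup>2 + err) * sqrt (real n)
         \<le> D * real n * (1 / (real n)\<^sup>2 * (1 + 2 * elen n * \<eta>) + 47 * (elen n)\<^sup>2 * \<eta>\<^sup>2) * sqrt (real n)"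
      proof (intro mult_right_mono mult_mono m2)
        have "(1 / 2) ^ s * (1 + 2 * real s * \<eta>) \<le> 1 / (real n)\<^sup>2 * (1 + 2 * elen n * \<eta>)"
          using s(2) R(2) eta0 by (intro mult_mono add_left_mono mult_right_mono mult_left_mono) auto
        moreover have "34 * (real s + 1)\<^sup>2 * \<eta>\<^sup>2 \<le> 34 * (elen n)\<^sup>2 * \<eta>\<^sup>2"
          using sq by (intro mult_right_mono mult_left_mono) auto
        ultimately show "(1 / 2) ^ s * (1 + 2 * real s * \<eta>) + 34 * (real s + 1)\<^sup>2 * \<eta>\<^sup>2 + err
            \<le> 1 / (real n)\<^sup>2 * (1 + 2 * elen n * \<eta>) + 47 * (elen n)\<^sup>2 * \<eta>\<^sup>2"
          using err' by linarith
      qed (use D eta0 in \<open>auto simp: err_def\<close>)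
      have t4: "real n * ((real s + 2) * \<eta>) / (\<delta> * sqrt (real n) / 2) \<le> real n * (elen n * \<eta>) / (\<delta> * sqrt (real n) / 2)"
        using R(2) eta0 del by (intro divide_right_mono mult_left_mono mult_right_mono) auto
      have "failure D h \<delta> (real n) = D * real n * (real n * (16 * real h * (D ^ Suc h)\<^sup>2 / (real n)\<^sup>2))\<^sup>2 / (\<delta> / 2)\<^sup>2
         + 4 * real n * (13 * (elen n)\<^sup>2 * \<eta>\<^sup>2) / \<delta>
         + D * real n * (1 / (real n)\<^sup>2 * (1 + 2 * elen n * \<eta>) + 47 * (elen n)\<^sup>2 * \<eta>\<^sup>2) * sqrt (real n)
         + real n * (elen n * \<eta>) / (\<delta> * sqrt (real n) / 2)"
        by (simp only: failure_def \<eta>_def elen_def)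
      moreover have "1 - prb (G n) \<le> real m * (real n * (?c / (real m)\<^sup>2))\<^sup>2 / (\<delta> / 2)\<^sup>2 + (real \<Delta> * (1 / 2) ^ h + 4 * real n * err) / \<delta>
      + real m * ((1 / 2) ^ s * (1 + 2 * real s * \<eta>) + 34 * (real s + 1)\<^sup>2 * \<eta>\<^sup>2 + err) * sqrt (real n)
      + real n * ((real s + 2) * \<eta>) / (\<delta> * sqrt (real n) / 2)"
        unfolding G_def bound_def[symmetric]
        by (rule good_probability[OF h(2) hs _ eps del(1) lam(1) _ del(2) err2 elim(6)])
           (use lam(2) in \<open>auto simp: R_def D_def\<close>)
      ultimately have "1 - prb (G n) < \<kappa>" using t1 t2 t3 t4 elim(1) h(1) by linarith
      then show ?case using prb_le_1[of "G n"] by (simp add: prb_def dist_real_def)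
    qed
  qed
  then show "(\<lambda>n. measure_pmf.prob (env_pmf (Din n) (Dout n) n)
           {\<omega>. \<forall>\<pi>. invariant_prob n (Dout n) \<omega> \<pi> \<longrightarrow>
                4 * (tv_dist n (pit n (Din n) (Dout n) \<omega> t) \<pi>)\<^sup>2
                  \<le> real n * (gamma_deg (Din n) (Dout n) n - 1)
                      / (real (num_edges (Din n) n) * (1 - varrho (Din n) (Dout n) n))
                      * varrho (Din n) (Dout n) n ^ t + \<epsilon>})
         \<longlonglongrightarrow> 1"
    unfolding G_def .
qed

end
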